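(* Let $t,a\ge 1$ be integers, let $p_1,\dots,p_{2t+3}\in\mathbb{P}^{2t}$ be points in general position, and let $\sigma_t$ be the $t$-th secant variety of the rational normal curve $C$ of degree $2t$ through these points (a hypersurface in $\mathbb{P}^{2t}$). Then the linear system $$\mathcal{L}(t,a):=\mathcal{L}_{2t,a(t+1)}\big((at)^{2t+3}\big)$$ has exactly one element, namely $a\sigma_t$. In particular $\mathcal{L}=\mathcal{L}(t,a)$ satisfies the following: it is special only if its base locus contains either linear cycles $L_I$ or cones $\mathrm{J}(L_I,\sigma_\tau)$ over the secant varieties $\sigma_\tau$ of $C$; moreover $\dim(\mathcal L)=\sigma\mathrm{ldim}(\mathcal L)$.
   Context: $\mathbb{P}^n$ is projective space over $\mathbb{C}$. The notation below is given for general $n$ and is used with $n=2t$. $\mathcal{L}=\mathcal{L}_{n,d}(m_1,\dots,m_{n+3})$, with $d,m_i\ge0$ integers, is the linear system of degree-$d$ hypersurfaces of $\mathbb{P}^n$ with multiplicity at least $m_i$ at $p_i$, where $p_1,\dots,p_{n+3}$ are in general position. $\mathcal{L}_{n,d}(m^{s})$ means that $s$ points have multiplicity $m$. $a\sigma_t$ is the hypersurface $\sigma_t$ counted $a$ times. $\dim(\mathcal L)$ is the affine dimension, i.e. the dimension of the vector space of degree-$d$ forms defining it. The virtual dimension is $\mathrm{vdim}(\mathcal{L})=\binom{n+d}{n}-\sum_i\binom{n+m_i-1}{n}$, the expected dimension is $\max(\mathrm{vdim}(\mathcal L),0)$, and $\mathcal{L}$ is special if $\dim(\mathcal L)$ is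 strictly greater than the expected dimension. $C$ is the rational normal curve of degree $n$ through the $n+3$ points. $\sigma_\tau$ ($\tau\ge1$) is the closure of the union of the $\mathbb{P}^{\tau-1}$'s spanned by $\tau$ points of $C$, and $\sigma_0=\emptyset$. $L_I$ is the linear span of $\{p_i:i\in I\}$. $\mathrm{J}(L_I,\sigma_\tau)$ is the join of $L_I$ and $\sigma_\tau$, with $\mathrm J(L_I,\emptyset)=L_I$ and $\mathrm J(\emptyset,\sigma_\tau)=\sigma_\tau$. Set $k_C=\sum_{i=1}^{n+3}m_i-nd$, $k_{I,\sigma_\tau}=\sum_{i\in I}m_i+\tau\,k_C-(|I|+\tau-1)d$ and $r_{I,\sigma_\tau}=|I|+2\tau-1$. Secant linear expected dimension: write $n=2l+\epsilon$, $\epsilon\in\{0,1\}$. The (affine) secant linear virtual dimension of $\mathcal L$ is $$\sum_{I,\tau}(-1)^{|I|}\binom{n+k_{I,\sigma_\tau}-r_{I,\sigma_\tau}-1}{n},$$ summed over all $I\subset\{1,\dots,n+3\}$ and $\tau$ with $0\le \tau\le l+\epsilon$ and $0\le|I|\le n-2\tau$, where $\binom{b}{n}=0$ if $b<n$. If $\mathcal L$ is contained in a linear system with negative secant linear virtual dimension, then $\sigma\mathrm{ldim}(\mathcal L)=0$. Otherwise $\sigma\mathrm{ldim}(\mathcal L)$ is the maximum of the secant linear virtual dimension of $\mathcal L$ and $0$. *)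

theory Defs
  imports "HOL-Analysis.Analysis" "HOL-Library.Poly_Mapping"
begin

section \<open>Polynomials in the homogeneous coordinates\<close>

text \<open>The coordinates of the ambient space are indexed by a finite type \<open>'N\<close>, so
  that the projective space in question is the one of dimension \<open>CARD('N) - 1\<close>.\<close>

type_synonym 'N cpoly = "('N \<Rightarrow>\<^sub>0 nat) \<Rightarrow>\<^sub>0 complex"

abbreviation pdim :: "'N::finite itself \<Rightarrow> nat" where
  "pdim _ \<equiv> CARD('N) - 1"

definition peval :: "'N::finite cpoly \<Rightarrow> complex ^ 'N \<Rightarrow> complex" where
  "peval f x = (\<Sum>\<alpha>\<in>Poly_Mapping.keys f.
      Poly_Mapping.lookup f \<alpha> * (\<Prod>i\<in>UNIV. (x $ i) ^ Poly_Mapping.lookup \<alpha> i))"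

definition homogeneous :: "nat \<Rightarrow> 'N::finite cpoly \<Rightarrow> bool" where
  "homogeneous d f \<longleftrightarrow>
     (\<forall>\<alpha>\<in>Poly_Mapping.keys f. (\<Sum>i\<in>UNIV. Poly_Mapping.lookup \<alpha> i) = d)"

definition partial_deriv :: "'N::finite \<Rightarrow> 'N cpoly \<Rightarrow> 'N cpoly" where
  "partial_deriv i f = (\<Sum>\<alpha>\<in>Poly_Mapping.keys f.
      Poly_Mapping.single (\<alpha> - Poly_Mapping.single i 1)
        (of_nat (Poly_Mapping.lookup \<alpha> i) * Poly_Mapping.lookup f \<alpha>))"

definition pscale :: "complex \<Rightarrow> 'N::finite cpoly \<Rightarrow> 'N cpoly" where
  "pscale c f = Poly_Mapping.single 0 c * f"

global_interpretation cpoly: vector_space pscale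
  by standard (simp_all add: pscale_def distrib_left distrib_right single_add mult_single
      flip: mult.assoc)

section \<open>Projective subsets, secant varieties and joins\<close>

text \<open>A subset of projective space is represented by the set of all nonzero vectors
  representing its points; a single point is represented by any one of these vectors.\<close>

definition proj_span :: "(complex ^ 'N::finite) set \<Rightarrow> (complex ^ 'N) set" where
  "proj_span S = vec.span S - {0}"

definition vanishes_on :: "'N::finite cpoly \<Rightarrow> (complex ^ 'N) set \<Rightarrow> bool" where
  "vanishes_on f X \<longleftrightarrow> (\<forall>x\<in>X. peval f x = 0)"

definition zariski_closure :: "(complex ^ 'N::finite) set \<Rightarrow> (complex ^ 'N) set" where
  "zariski_closure X =
     {x. x \<noteq> 0 \<and> (\<forall>d f. homogeneous d f \<longrightarrow> vanishes_on f X \<longrightarrow> peval f x = 0)}"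

text \<open>A rational normal curve is the image of the Veronese parametrisation
  \<open>[s : u] \<mapsto> [s^n : s^(n-1) u : \<dots> : u^n]\<close> in some system of homogeneous
  coordinates, here given by a basis \<open>w 0, \<dots>, w n\<close>.\<close>

definition rational_normal_curve :: "(complex ^ 'N::finite) set \<Rightarrow> bool" where
  "rational_normal_curve C \<longleftrightarrow>
     (\<exists>w :: nat \<Rightarrow> complex ^ 'N. let n = pdim TYPE('N) in
        inj_on w {0..n} \<and> vec.independent (w ` {0..n}) \<and>
        C = {c *s (\<Sum>j = 0..n. (s ^ (n - j) * u ^ j) *s w j) | c s u.
               c \<noteq> 0 \<and> (s, u) \<noteq> (0, 0)})"

text \<open>Linear independence of the \<open>\<tau>\<close> points expresses that they span a
  projective space of dimension \<open>\<tau> - 1\<close>.\<close>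

definition secant :: "nat \<Rightarrow> (complex ^ 'N::finite) set \<Rightarrow> (complex ^ 'N) set" where
  "secant \<tau> C = (if \<tau> = 0 then {} else
     zariski_closure (\<Union>{proj_span T | T.
       T \<subseteq> C \<and> finite T \<and> card T = \<tau> \<and> vec.independent T}))"

definition proj_join ::
    "(complex ^ 'N::finite) set \<Rightarrow> (complex ^ 'N) set \<Rightarrow> (complex ^ 'N) set" where
  "proj_join X Y = (if X = {} then Y else if Y = {} then X else
     zariski_closure (\<Union>x\<in>X. \<Union>y\<in>Y. proj_span {x, y}))"

text \<open>Any \<open>n + 1\<close> of the \<open>n + 3\<close> points are linearly independent.\<close>

definition general_position :: "(nat \<Rightarrow> complex ^ 'N::finite) \<Rightarrow> bool" where
  "general_position p \<longleftrightarrow>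
     (\<forall>I \<subseteq> {1..pdim TYPE('N) + 3}. card I \<le> pdim TYPE('N) + 1 \<longrightarrow>
        inj_on p I \<and> vec.independent (p ` I))"

section \<open>Linear systems with assigned multiple points\<close>

definition mult_at_least :: "nat \<Rightarrow> 'N::finite cpoly \<Rightarrow> complex ^ 'N \<Rightarrow> bool" where
  "mult_at_least m f x \<longleftrightarrow> (\<forall>is. length is < m \<longrightarrow> peval (foldr partial_deriv is f) x = 0)"

definition forms ::
    "(nat \<Rightarrow> complex ^ 'N::finite) \<Rightarrow> nat \<Rightarrow> (nat \<Rightarrow> nat) \<Rightarrow> 'N cpoly set" where
  "forms p d m = {f. homogeneous d f \<and>
     (\<forall>i\<in>{1..pdim TYPE('N) + 3}. mult_at_least (m i) f (p i))}"

text \<open>A hypersurface, counted with multiplicities of its components, is a nonzero form up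
  to nonzero scalars.\<close>

definition hypersurface :: "'N::finite cpoly \<Rightarrow> 'N cpoly set" where
  "hypersurface f = {pscale c f | c. c \<noteq> 0}"

definition linear_system ::
    "(nat \<Rightarrow> complex ^ 'N::finite) \<Rightarrow> nat \<Rightarrow> (nat \<Rightarrow> nat) \<Rightarrow> 'N cpoly set set" where
  "linear_system p d m = hypersurface ` (forms p d m - {0})"

definition base_locus ::
    "(nat \<Rightarrow> complex ^ 'N::finite) \<Rightarrow> nat \<Rightarrow> (nat \<Rightarrow> nat) \<Rightarrow> (complex ^ 'N) set" where
  "base_locus p d m = {x. x \<noteq> 0 \<and> (\<forall>f\<in>forms p d m. peval f x = 0)}"

text \<open>\<open>F\<close> generates the homogeneous ideal of \<open>X\<close>. For such an \<open>F\<close> the hypersurface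
  \<open>X\<close> counted \<open>a\<close> times is \<open>hypersurface (F ^ a)\<close>.\<close>

definition reduced_equation :: "'N::finite cpoly \<Rightarrow> (complex ^ 'N) set \<Rightarrow> bool" where
  "reduced_equation F X \<longleftrightarrow>
     F \<noteq> 0 \<and> (\<exists>e\<ge>1. homogeneous e F) \<and> X = {x. x \<noteq> 0 \<and> peval F x = 0} \<and>
     (\<forall>d G. homogeneous d G \<longrightarrow> (vanishes_on G X \<longleftrightarrow> F dvd G))"

definition dim_system ::
    "(nat \<Rightarrow> complex ^ 'N::finite) \<Rightarrow> nat \<Rightarrow> (nat \<Rightarrow> nat) \<Rightarrow> int" where
  "dim_system p d m = int (cpoly.dim (forms p d m))"

text \<open>In the next definition \<open>n \<ge> 1\<close> is intended, so that \<open>n + m i - 1\<close> is a genuine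
  subtraction.\<close>

definition vdim :: "nat \<Rightarrow> nat \<Rightarrow> (nat \<Rightarrow> nat) \<Rightarrow> int" where
  "vdim n d m = int ((n + d) choose n) - (\<Sum>i = 1..n + 3. int ((n + m i - 1) choose n))"

definition special ::
    "(nat \<Rightarrow> complex ^ 'N::finite) \<Rightarrow> nat \<Rightarrow> (nat \<Rightarrow> nat) \<Rightarrow> bool" where
  "special p d m \<longleftrightarrow> dim_system p d m > max (vdim (pdim TYPE('N)) d m) 0"

section \<open>Secant linear expected dimension\<close>

definition kC :: "nat \<Rightarrow> nat \<Rightarrow> (nat \<Rightarrow> nat) \<Rightarrow> int" where
  "kC n d m = (\<Sum>i = 1..n + 3. int (m i)) - int n * int d"

definition k_sec :: "nat \<Rightarrow> nat \<Rightarrow> (nat \<Rightarrow> nat) \<Rightarrow> nat set \<Rightarrow> nat \<Rightarrow> int" where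
  "k_sec n d m I \<tau> =
     (\<Sum>i\<in>I. int (m i)) + int \<tau> * kC n d m - (int (card I) + int \<tau> - 1) * int d"

definition r_sec :: "nat set \<Rightarrow> nat \<Rightarrow> int" where
  "r_sec I \<tau> = int (card I) + 2 * int \<tau> - 1"

definition ibinom :: "int \<Rightarrow> nat \<Rightarrow> int" where
  "ibinom b n = (if b < int n then 0 else int (nat b choose n))"

text \<open>For \<open>n = 2l + \<epsilon>\<close> the bound \<open>l + \<epsilon>\<close> on \<open>\<tau>\<close> is \<open>n div 2 + n mod 2\<close>.\<close>

definition slvdim :: "nat \<Rightarrow> nat \<Rightarrow> (nat \<Rightarrow> nat) \<Rightarrow> int" where
  "slvdim n d m =
     (\<Sum>(I, \<tau>) \<in> {(I, \<tau>). I \<subseteq> {1..n + 3} \<and> \<tau> \<le> n div 2 + n mod 2 \<and>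
                        int (card I) \<le> int n - 2 * int \<tau>}.
        (-1) ^ card I * ibinom (int n + k_sec n d m I \<tau> - r_sec I \<tau> - 1) n)"

definition sigma_ldim ::
    "(nat \<Rightarrow> complex ^ 'N::finite) \<Rightarrow> nat \<Rightarrow> (nat \<Rightarrow> nat) \<Rightarrow> int" where
  "sigma_ldim p d m =
     (if \<exists>m'. linear_system p d m \<subseteq> linear_system p d m' \<and> slvdim (pdim TYPE('N)) d m' < 0
      then 0 else max (slvdim (pdim TYPE('N)) d m) 0)"

end

theory Submission
  imports Defs "Jordan_Normal_Form.Determinant"
begin

text \<open>
  Put \<open>d = a(t+1)\<close> and let \<open>c\<close> parametrise the curve \<open>C\<close>.

  Why \<open>a\<sigma>\<^sub>t\<close> is the only element.  A form \<open>F\<close> of the system has multiplicity at least \<open>at\<close>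
  along the whole of \<open>C\<close> (lemmas \<open>mult_at_least_rational_curve\<close>, \<open>mult_at_least_curve_set\<close>).
  Indeed, suppose that the derivatives of order less than \<open>\<mu> < at\<close> vanish on \<open>C\<close>, and take
  the derivative of order \<open>\<mu>\<close> in the directions \<open>c(x\<^sub>1), \<dots>, c(x\<^sub>\<mu>)\<close>.  Restricted to \<open>C\<close> it is
  a polynomial of degree at most \<open>2t(d - \<mu>)\<close>, with zeros of order \<open>at - \<mu>\<close> at the \<open>2t+3\<close>
  given points and, by Euler's relation, with a double zero at each \<open>x\<^sub>j\<close>.  These are
  \<open>at - \<mu>\<close> zeros too many, so it vanishes; since the points of \<open>C\<close> span the space,
  multilinearity gives all derivatives of order \<open>\<mu>\<close>.  On the line through two points where
  a form of degree \<open>d\<close> has multiplicities \<open>\<alpha>\<close> and \<open>\<beta>\<close> it has multiplicity at least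
  \<open>\<alpha> + \<beta> - d\<close>, so \<open>F\<close> has multiplicity at least \<open>a\<close> on each span of \<open>t\<close> points of \<open>C\<close>
  (lemmas \<open>mult_at_least_span\<close>, \<open>mult_at_least_secant_span\<close>).

  The Hankel determinant \<open>H\<close> of size \<open>t+1\<close> has degree \<open>t+1\<close> and multiplicity \<open>t\<close> along \<open>C\<close>,
  and it does not vanish at a sum of \<open>t+1\<close> points of \<open>C\<close> (lemma \<open>hankel_det_nonzero\<close>).  There
  are a direction \<open>v\<close> with \<open>H(v) \<noteq> 0\<close> and an open set of lines with this direction each of which
  meets the spans of \<open>t\<close> points of \<open>C\<close> in \<open>t+1\<close> points (lemma \<open>secant_lines\<close>).  On such a line
  both \<open>F\<close> and \<open>H^a\<close> have \<open>t+1\<close> zeros of order \<open>a\<close> and degree at most \<open>a(t+1)\<close>, so they are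
  proportional (lemma \<open>eq_hankel_det_power\<close>).  For the same reason a form that vanishes on
  \<open>\<sigma>\<^sub>t\<close> leaves the remainder zero when it is divided by \<open>H\<close> in the direction \<open>v\<close> (lemma
  \<open>hankel_det_dvd\<close>), so \<open>H\<close> generates the ideal of \<open>\<sigma>\<^sub>t\<close>.

  Why the dimension is the secant linear one.  A system of degree \<open>d\<close> with multiplicities \<open>m'\<close>
  that contains \<open>a\<sigma>\<^sub>t\<close> has all \<open>m'\<^sub>i \<le> at\<close>, because \<open>H^a\<close> has multiplicity exactly \<open>at\<close> on
  \<open>C\<close> (lemma \<open>mult_hankel_det_power_le\<close>).  For such \<open>m'\<close> the alternating sum that defines the
  secant linear virtual dimension is a Verlinde number: the multiplicity of the highest weight
  \<open>\<ell> = d - k\<^sub>C\<close> in the fusion product at level \<open>\<ell>\<close> of the representations of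
  \<open>SL\<^sub>2\<close> with highest weights \<open>d - m'\<^sub>i\<close> (lemma \<open>slvdim_eq_fusion\<close>).  The inclusion-exclusion over \<open>I\<close>
  computes the weights of the tensor product and the sum over \<open>\<tau>\<close> is the sum over the
  affine Weyl group.  As all weights are at most \<open>\<ell>\<close>, the number is nonnegative
  (lemma \<open>slvdim_nonneg\<close>); for \<open>m' = at\<close> all weights equal \<open>\<ell>\<close>, fusion with them is an
  involution, and the number is \<open>1\<close> (lemma \<open>slvdim_secant\<close>).

  Finally \<open>\<sigma>\<^sub>t\<close> itself is one of the cones that may lie in the base locus, with empty
  \<open>I\<close>.
\<close>

(* The linear algebra of curves uses the component notation of Euclidean spaces; matrices of
   variable size are only needed for the Hankel determinant. *)
no_notation Matrix.vec_index (infixl \<open>$\<close> 100)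
no_notation Matrix.scalar_prod (infix \<open>\<bullet>\<close> 70)
hide_const (open) Matrix.vec Matrix.mat Determinant.det Poly_Mapping.degree Module.smult

section \<open>Evaluation of polynomials\<close>

abbreviation expo :: "('a \<Rightarrow>\<^sub>0 'b::zero) \<Rightarrow> 'a \<Rightarrow> 'b" where
  "expo \<equiv> Poly_Mapping.lookup"

definition monomial_value :: "('N::finite \<Rightarrow>\<^sub>0 nat) \<Rightarrow> complex ^ 'N \<Rightarrow> complex" where
  "monomial_value \<alpha> x = (\<Prod>i\<in>UNIV. (x $ i) ^ expo \<alpha> i)"

lemma monomial_value_add: "monomial_value (\<alpha> + \<beta>) x = monomial_value \<alpha> x * monomial_value \<beta> x"
  by (simp add: monomial_value_def lookup_add power_add prod.distrib)

lemma monomial_value_zero [simp]: "monomial_value 0 x = 1"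
  by (simp add: monomial_value_def)

lemma peval_superset:
  assumes "finite A" "Poly_Mapping.keys f \<subseteq> A"
  shows "peval f x = (\<Sum>\<alpha>\<in>A. expo f \<alpha> * monomial_value \<alpha> x)"
  unfolding peval_def monomial_value_def
  using assms by (intro sum.mono_neutral_left) (auto simp: in_keys_iff)

lemma peval_zero [simp]: "peval 0 x = 0"
  by (simp add: peval_def)

lemma peval_add: "peval (f + g) x = peval f x + peval g x"
proof -
  let ?A = "Poly_Mapping.keys f \<union> Poly_Mapping.keys g"
  have "Poly_Mapping.keys (f + g) \<subseteq> ?A" by (rule keys_add)
  then show ?thesis
    by (subst (1 2 3) peval_superset[of ?A]) (auto simp: lookup_add sum.distrib algebra_simps)
qed

lemma peval_sum: "peval (sum f A) x = (\<Sum>a\<in>A. peval (f a) x)"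
  by (induction A rule: infinite_finite_induct) (auto simp: peval_add)

lemma peval_uminus: "peval (- f) x = - peval f x"
  by (metis add.right_inverse add_eq_0_iff peval_add peval_zero)

lemma peval_diff: "peval (f - g) x = peval f x - peval g x"
  using peval_add[of f "- g" x] by (simp add: peval_uminus)

lemma peval_single: "peval (Poly_Mapping.single \<alpha> c) x = c * monomial_value \<alpha> x"
  by (cases "c = 0") (auto simp: peval_def monomial_value_def)

lemma sum_of_monomials: "(\<Sum>\<alpha>\<in>Poly_Mapping.keys f. Poly_Mapping.single \<alpha> (expo f \<alpha>)) = f"
proof (rule poly_mapping_eqI)
  fix k
  show "expo (\<Sum>\<alpha>\<in>Poly_Mapping.keys f. Poly_Mapping.single \<alpha> (expo f \<alpha>)) k = expo f k"
    by (auto simp: lookup_sum lookup_single when_def in_keys_iff sum.delta')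
qed

text \<open>Identities that are additive in a polynomial need only be checked on monomials.\<close>

lemma cpoly_induct [case_names add monomial]:
  fixes P :: "'N::finite cpoly \<Rightarrow> bool"
  assumes add: "\<And>f g. P f \<Longrightarrow> P g \<Longrightarrow> P (f + g)"
    and single: "\<And>\<alpha> c. P (Poly_Mapping.single \<alpha> c)"
  shows "P f"
proof -
  have "P (\<Sum>\<alpha>\<in>A. Poly_Mapping.single \<alpha> (expo f \<alpha>))" if "finite A" for A
    using that
  proof (induction A rule: finite_induct)
    case empty
    then show ?case using single[of 0 0] by simp
  next
    case (insert x F)
    then show ?case using add single by auto
  qed
  from this[of "Poly_Mapping.keys f"] show ?thesis by (simp add: sum_of_monomials)
qed

lemma peval_mult: "peval (f * g) x = peval f x * peval g x"
proof (induction f rule: cpoly_induct)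
  case (add f1 f2)
  then show ?case by (simp add: peval_add distrib_right)
next
  case (monomial \<alpha> c)
  show ?case
  proof (induction g rule: cpoly_induct)
    case (add f1 f2)
    then show ?case by (simp add: peval_add distrib_left)
  next
    case (monomial \<beta> d)
    then show ?case by (simp add: mult_single peval_single monomial_value_add)
  qed
qed

lemma peval_const: "peval (Poly_Mapping.single 0 c) x = c"
  by (simp add: peval_single)

lemma peval_one [simp]: "peval 1 x = 1"
  using peval_const[of 1 x] by simp

lemma peval_power: "peval (f ^ k) x = peval f x ^ k"
  by (induction k) (auto simp: peval_mult)

lemma peval_pscale: "peval (pscale c f) x = c * peval f x"
  by (simp add: pscale_def peval_mult peval_const)

lemma lookup_pscale: "expo (pscale c f) \<alpha> = c * expo f \<alpha>"
proof (induction f rule: cpoly_induct)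
  case (add f g)
  then show ?case by (simp add: pscale_def distrib_left lookup_add)
next
  case (monomial \<beta> d)
  then show ?case by (simp add: pscale_def mult_single lookup_single when_def)
qed

section \<open>Partial and directional derivatives\<close>

text \<open>Monomials that do not contain the variable keep their exponent under truncated subtraction, so
  they could be confused with other ones; their coefficient in the derivative is zero.\<close>

lemma lookup_partial_deriv:
  "expo (partial_deriv i f) \<beta> = of_nat (Suc (expo \<beta> i)) * expo f (\<beta> + Poly_Mapping.single i 1)"
proof -
  let ?e = "Poly_Mapping.single i (1::nat)"
  have *: "(\<alpha> - ?e = \<beta> \<and> expo \<alpha> i \<noteq> 0) \<longleftrightarrow> \<alpha> = \<beta> + ?e" for \<alpha>
  proof
    assume a: "\<alpha> - ?e = \<beta> \<and> expo \<alpha> i \<noteq> 0"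
    show "\<alpha> = \<beta> + ?e"
    proof (rule poly_mapping_eqI)
      fix k
      from a have "expo \<beta> k = expo \<alpha> k - expo ?e k" by (auto simp: lookup_minus)
      then show "expo \<alpha> k = expo (\<beta> + ?e) k"
        using a by (cases "k = i") (auto simp: lookup_add lookup_single when_def)
    qed
  next
    assume "\<alpha> = \<beta> + ?e"
    then show "\<alpha> - ?e = \<beta> \<and> expo \<alpha> i \<noteq> 0" by (simp add: lookup_add)
  qed
  have "expo (partial_deriv i f) \<beta> =
      (\<Sum>\<alpha>\<in>Poly_Mapping.keys f. (of_nat (expo \<alpha> i) * expo f \<alpha>) when (\<alpha> - ?e = \<beta>))"
    by (simp add: partial_deriv_def lookup_sum lookup_single)
  also have "\<dots> = (\<Sum>\<alpha>\<in>Poly_Mapping.keys f.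
      if \<alpha> = \<beta> + ?e then of_nat (expo \<alpha> i) * expo f \<alpha> else 0)"
  proof (intro sum.cong refl)
    fix \<alpha>
    show "((of_nat (expo \<alpha> i) * expo f \<alpha>) when (\<alpha> - ?e = \<beta>)) =
        (if \<alpha> = \<beta> + ?e then of_nat (expo \<alpha> i) * expo f \<alpha> else 0)"
      using *[of \<alpha>] by (cases "\<alpha> = \<beta> + ?e"; cases "expo \<alpha> i = 0") (simp_all add: when_def)
  qed
  also have "\<dots> = of_nat (expo (\<beta> + ?e) i) * expo f (\<beta> + ?e)"
    by (auto simp: sum.delta in_keys_iff)
  finally show ?thesis by (simp add: lookup_add)
qed

lemma partial_deriv_add: "partial_deriv i (f + g) = partial_deriv i f + partial_deriv i g"
  by (rule poly_mapping_eqI) (simp add: lookup_partial_deriv lookup_add algebra_simps)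

lemma partial_deriv_zero [simp]: "partial_deriv i 0 = 0"
  by (simp add: partial_deriv_def)

lemma partial_deriv_pscale: "partial_deriv i (pscale c f) = pscale c (partial_deriv i f)"
  by (rule poly_mapping_eqI) (simp add: lookup_partial_deriv lookup_pscale algebra_simps)

lemma partial_deriv_sum: "partial_deriv i (sum f A) = (\<Sum>a\<in>A. partial_deriv i (f a))"
  by (induction A rule: infinite_finite_induct) (auto simp: partial_deriv_add)

lemma partial_deriv_single:
  "partial_deriv i (Poly_Mapping.single \<alpha> c) =
     Poly_Mapping.single (\<alpha> - Poly_Mapping.single i 1) (of_nat (expo \<alpha> i) * c)"
  by (cases "c = 0") (auto simp: partial_deriv_def)

lemma partial_deriv_commute: "partial_deriv i (partial_deriv j f) = partial_deriv j (partial_deriv i f)"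
proof (cases "i = j")
  case False
  have e: "expo (Poly_Mapping.single k (1::nat)) l = 0" if "k \<noteq> l" for k l :: 'a
    using that by (simp add: lookup_single)
  have two: "expo (partial_deriv k (partial_deriv l f)) \<beta> =
      of_nat (Suc (expo \<beta> k)) * (of_nat (Suc (expo \<beta> l)) *
        expo f (\<beta> + (Poly_Mapping.single k 1 + Poly_Mapping.single l 1)))"
    if "k \<noteq> l" for k l and \<beta> :: "'a \<Rightarrow>\<^sub>0 nat"
    unfolding lookup_partial_deriv[of k] lookup_partial_deriv[of l] lookup_add e[OF that]
    by (simp only: add_0_right add.assoc)
  have swap: "Poly_Mapping.single i (1::nat) + Poly_Mapping.single j 1 =
      Poly_Mapping.single j 1 + Poly_Mapping.single i 1"
    by (rule add.commute)
  show ?thesis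
    using False by (intro poly_mapping_eqI) (simp only: two[OF False] two[OF False[symmetric]] swap mult.left_commute)
qed simp

lemma partial_deriv_mult:
  "partial_deriv i (f * g) = partial_deriv i f * g + f * partial_deriv i g"
proof (induction f rule: cpoly_induct)
  case (add f1 f2)
  then show ?case by (simp add: partial_deriv_add algebra_simps)
next
  case (monomial \<alpha> c)
  show ?case
  proof (induction g rule: cpoly_induct)
    case (add f1 f2)
    then show ?case by (simp add: partial_deriv_add algebra_simps)
  next
    case (monomial \<beta> d)
    let ?e = "Poly_Mapping.single i (1::nat)"
    \<comment> \<open>For a zero exponent the shift fails, but then the term has coefficient zero.\<close>
    have shift: "\<mu> - ?e + \<nu> = \<mu> + \<nu> - ?e" if "expo \<mu> i \<noteq> 0" for \<mu> \<nu> :: "'a \<Rightarrow>\<^sub>0 nat"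
      by (rule poly_mapping_eqI)
         (use that in \<open>auto simp: lookup_add lookup_minus lookup_single when_def\<close>)
    have 1: "Poly_Mapping.single (\<alpha> - ?e + \<beta>) (of_nat (expo \<alpha> i) * c * d) =
             Poly_Mapping.single (\<alpha> + \<beta> - ?e) (of_nat (expo \<alpha> i) * c * d)"
      using shift[of \<alpha> \<beta>] by (cases "expo \<alpha> i = 0") auto
    have 2: "Poly_Mapping.single (\<alpha> + (\<beta> - ?e)) (of_nat (expo \<beta> i) * c * d) =
             Poly_Mapping.single (\<alpha> + \<beta> - ?e) (of_nat (expo \<beta> i) * c * d)"
      using shift[of \<beta> \<alpha>] by (cases "expo \<beta> i = 0") (auto simp: add.commute)
    show ?case
      using 1 2
      by (simp add: mult_single partial_deriv_single lookup_add algebra_simps flip: single_add)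
  qed
qed

definition dir_deriv :: "complex ^ 'N::finite \<Rightarrow> 'N cpoly \<Rightarrow> 'N cpoly" where
  "dir_deriv v f = (\<Sum>i\<in>UNIV. pscale (v $ i) (partial_deriv i f))"

lemma peval_dir_deriv: "peval (dir_deriv v f) x = (\<Sum>i\<in>UNIV. v $ i * peval (partial_deriv i f) x)"
  by (simp add: dir_deriv_def peval_sum peval_pscale)

lemma dir_deriv_add: "dir_deriv v (f + g) = dir_deriv v f + dir_deriv v g"
  by (simp add: dir_deriv_def partial_deriv_add cpoly.scale_right_distrib sum.distrib)

lemma dir_deriv_zero [simp]: "dir_deriv v 0 = 0"
  by (simp add: dir_deriv_def)

lemma dir_deriv_uminus: "dir_deriv v (- f) = - dir_deriv v f"
  by (metis add.right_inverse add_eq_0_iff dir_deriv_add dir_deriv_zero)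

lemma dir_deriv_diff: "dir_deriv v (f - g) = dir_deriv v f - dir_deriv v g"
  using dir_deriv_add[of v f "- g"] by (simp add: dir_deriv_uminus)

lemma dir_deriv_pscale: "dir_deriv v (pscale c f) = pscale c (dir_deriv v f)"
  by (simp add: dir_deriv_def partial_deriv_pscale cpoly.scale_sum_right mult.commute)

lemma pscale_mult_left: "pscale c f * g = pscale c (f * g)"
  by (simp add: pscale_def mult.assoc)

lemma pscale_mult_right: "f * pscale c g = pscale c (f * g)"
  by (simp add: pscale_def mult.left_commute)

lemma dir_deriv_mult: "dir_deriv v (f * g) = dir_deriv v f * g + f * dir_deriv v g"
  by (simp add: dir_deriv_def partial_deriv_mult cpoly.scale_right_distrib sum.distrib
      sum_distrib_left sum_distrib_right pscale_mult_left pscale_mult_right)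

lemma dir_deriv_plus_vec: "dir_deriv (u + v) f = dir_deriv u f + dir_deriv v f"
  by (simp add: dir_deriv_def cpoly.scale_left_distrib sum.distrib)

lemma dir_deriv_scale_vec: "dir_deriv (c *s v) f = pscale c (dir_deriv v f)"
  by (simp add: dir_deriv_def cpoly.scale_sum_right)

lemma dir_deriv_zero_vec [simp]: "dir_deriv 0 f = 0"
  by (simp add: dir_deriv_def)

lemma dir_deriv_axis: "dir_deriv (axis i 1) f = partial_deriv i f"
proof -
  have "dir_deriv (axis i 1) f = (\<Sum>j\<in>UNIV. if j = i then partial_deriv j f else 0)"
    unfolding dir_deriv_def by (intro sum.cong refl) (auto simp: axis_def)
  then show ?thesis by simp
qed

lemma dir_deriv_partial_deriv: "dir_deriv v (partial_deriv i f) = partial_deriv i (dir_deriv v f)"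
  by (simp add: dir_deriv_def partial_deriv_sum partial_deriv_pscale partial_deriv_commute[of _ i])

lemma dir_deriv_commute: "dir_deriv u (dir_deriv v f) = dir_deriv v (dir_deriv u f)"
proof -
  have "dir_deriv u (dir_deriv v f) = (\<Sum>i\<in>UNIV. pscale (u $ i) (dir_deriv v (partial_deriv i f)))"
    by (subst dir_deriv_def) (simp add: dir_deriv_partial_deriv)
  also have "\<dots> = dir_deriv v (dir_deriv u f)"
  proof -
    have s: "dir_deriv v (sum F A) = (\<Sum>a\<in>A. dir_deriv v (F a))" for F :: "'a \<Rightarrow> 'a cpoly" and A
      by (induction A rule: infinite_finite_induct) (auto simp: dir_deriv_add)
    show ?thesis by (subst (3) dir_deriv_def) (simp add: s dir_deriv_pscale)
  qed
  finally show ?thesis .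
qed

section \<open>Homogeneous polynomials\<close>

lemma homogeneous_zero [simp]: "homogeneous d 0"
  by (simp add: homogeneous_def)

lemma homogeneous_add: "homogeneous d f \<Longrightarrow> homogeneous d g \<Longrightarrow> homogeneous d (f + g)"
  using keys_add[of f g] by (auto simp: homogeneous_def)

lemma homogeneous_sum: "(\<And>a. a \<in> A \<Longrightarrow> homogeneous d (f a)) \<Longrightarrow> homogeneous d (sum f A)"
  by (induction A rule: infinite_finite_induct) (auto simp: homogeneous_add)

lemma homogeneous_pscale: "homogeneous d f \<Longrightarrow> homogeneous d (pscale c f)"
  by (auto simp: homogeneous_def in_keys_iff lookup_pscale)

lemma homogeneous_single: "(\<Sum>i\<in>UNIV. expo \<alpha> i) = d \<Longrightarrow> homogeneous d (Poly_Mapping.single \<alpha> c)"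
  by (auto simp: homogeneous_def)

lemma homogeneous_diff: "homogeneous d f \<Longrightarrow> homogeneous d g \<Longrightarrow> homogeneous d (f - g)"
  using homogeneous_add[of d f "- g"] by (simp add: homogeneous_def)

lemma homogeneous_mult:
  assumes "homogeneous d f" "homogeneous e g"
  shows "homogeneous (d + e) (f * g)"
  unfolding homogeneous_def
proof
  fix \<alpha> assume "\<alpha> \<in> Poly_Mapping.keys (f * g)"
  then obtain \<beta> \<gamma> where "\<beta> \<in> Poly_Mapping.keys f" "\<gamma> \<in> Poly_Mapping.keys g" "\<alpha> = \<beta> + \<gamma>"
    using keys_mult[of f g] by auto
  then show "(\<Sum>i\<in>UNIV. expo \<alpha> i) = d + e"
    using assms by (simp add: homogeneous_def lookup_add sum.distrib)
qed

lemma homogeneous_one: "homogeneous 0 1"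
  by (simp add: homogeneous_def)

lemma homogeneous_power: "homogeneous d f \<Longrightarrow> homogeneous (k * d) (f ^ k)"
  by (induction k) (auto simp: homogeneous_one homogeneous_mult)

lemma homogeneous_prod:
  "(\<And>a. a \<in> A \<Longrightarrow> homogeneous 1 (f a)) \<Longrightarrow> homogeneous (card A) (prod f A)"
proof (induction A rule: infinite_finite_induct)
  case (insert x F)
  then show ?case using homogeneous_mult[of 1 "f x" "card F" "prod f F"] by simp
qed (auto simp: homogeneous_one)

lemma homogeneous_partial_deriv: "homogeneous d f \<Longrightarrow> homogeneous (d - 1) (partial_deriv i f)"
  unfolding homogeneous_def
proof
  fix \<alpha> assume f: "\<forall>\<alpha>\<in>Poly_Mapping.keys f. (\<Sum>i\<in>UNIV. expo \<alpha> i) = d"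
    and "\<alpha> \<in> Poly_Mapping.keys (partial_deriv i f)"
  then have "\<alpha> + Poly_Mapping.single i 1 \<in> Poly_Mapping.keys f"
    by (auto simp: in_keys_iff lookup_partial_deriv)
  then have "(\<Sum>j\<in>UNIV. expo (\<alpha> + Poly_Mapping.single i 1) j) = d" using f by blast
  then show "(\<Sum>j\<in>UNIV. expo \<alpha> j) = d - 1"
    by (auto simp: lookup_add sum.distrib lookup_single when_def)
qed

lemma homogeneous_dir_deriv: "homogeneous d f \<Longrightarrow> homogeneous (d - 1) (dir_deriv v f)"
  unfolding dir_deriv_def by (intro homogeneous_sum homogeneous_pscale homogeneous_partial_deriv)

lemma homogeneous_0_imp_const:
  assumes "homogeneous 0 f"
  shows "f = Poly_Mapping.single 0 (expo f 0)"
proof (rule poly_mapping_eqI)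
  fix \<alpha>
  show "expo f \<alpha> = expo (Poly_Mapping.single 0 (expo f 0)) \<alpha>"
  proof (cases "\<alpha> = 0")
    case False
    then have "(\<Sum>i\<in>UNIV. expo \<alpha> i) \<noteq> 0"
      by (metis (mono_tags, lifting) UNIV_I finite lookup_zero poly_mapping_eqI sum_eq_0_iff)
    then have "\<alpha> \<notin> Poly_Mapping.keys f" using assms by (metis homogeneous_def)
    then show ?thesis using False by (simp add: in_keys_iff lookup_single)
  qed simp
qed

lemma partial_deriv_homogeneous_0: "homogeneous 0 f \<Longrightarrow> partial_deriv i f = 0"
  by (subst homogeneous_0_imp_const, assumption) (simp add: partial_deriv_single)

lemma dir_deriv_homogeneous_0: "homogeneous 0 f \<Longrightarrow> dir_deriv v f = 0"
  by (simp add: dir_deriv_def partial_deriv_homogeneous_0)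

lemma peval_scale:
  assumes "homogeneous d f"
  shows "peval f (c *s x) = c ^ d * peval f x"
proof -
  have "peval f (c *s x) = (\<Sum>\<alpha>\<in>Poly_Mapping.keys f. expo f \<alpha> * (c ^ d * monomial_value \<alpha> x))"
    unfolding peval_def monomial_value_def
  proof (intro sum.cong refl arg_cong2[of _ _ _ _ "(*)"])
    fix \<alpha> assume "\<alpha> \<in> Poly_Mapping.keys f"
    then have "(\<Sum>i\<in>UNIV. expo \<alpha> i) = d" using assms by (simp add: homogeneous_def)
    then show "(\<Prod>i\<in>UNIV. (c *s x) $ i ^ expo \<alpha> i) = c ^ d * (\<Prod>i\<in>UNIV. x $ i ^ expo \<alpha> i)"
      by (simp add: power_mult_distrib prod.distrib flip: power_sum)
  qed
  also have "\<dots> = c ^ d * peval f x"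
    by (simp add: peval_def monomial_value_def sum_distrib_left algebra_simps)
  finally show ?thesis .
qed

section \<open>Restriction to polynomial curves\<close>

text \<open>Orders of vanishing are counted on curves with polynomial coordinates, where they become
  divisibility by powers of linear polynomials.\<close>

definition curve_point :: "('N::finite \<Rightarrow> complex poly) \<Rightarrow> complex \<Rightarrow> complex ^ 'N" where
  "curve_point \<gamma> z = (\<chi> i. poly (\<gamma> i) z)"

definition along_curve :: "('N::finite \<Rightarrow> complex poly) \<Rightarrow> 'N cpoly \<Rightarrow> complex poly" where
  "along_curve \<gamma> f = (\<Sum>\<alpha>\<in>Poly_Mapping.keys f. smult (expo f \<alpha>) (\<Prod>i\<in>UNIV. \<gamma> i ^ expo \<alpha> i))"

lemma poly_along_curve: "poly (along_curve \<gamma> f) z = peval f (curve_point \<gamma> z)"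
  by (simp add: along_curve_def peval_def curve_point_def poly_sum poly_prod)

lemma along_curve_add: "along_curve \<gamma> (f + g) = along_curve \<gamma> f + along_curve \<gamma> g"
  by (rule poly_ext) (simp add: poly_along_curve peval_add)

lemma along_curve_single: "along_curve \<gamma> (Poly_Mapping.single \<alpha> c) = smult c (\<Prod>i\<in>UNIV. \<gamma> i ^ expo \<alpha> i)"
  by (rule poly_ext) (simp add: poly_along_curve peval_single monomial_value_def curve_point_def poly_prod)

lemma along_curve_pscale: "along_curve \<gamma> (pscale c f) = smult c (along_curve \<gamma> f)"
  by (rule poly_ext) (simp add: poly_along_curve peval_pscale)

lemma along_curve_zero [simp]: "along_curve \<gamma> 0 = 0"
  by (simp add: along_curve_def)

lemma pderiv_along_curve:
  "pderiv (along_curve \<gamma> f) = (\<Sum>i\<in>UNIV. pderiv (\<gamma> i) * along_curve \<gamma> (partial_deriv i f))"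
proof (induction f rule: cpoly_induct)
  case (add f g)
  then show ?case
    by (simp add: along_curve_add partial_deriv_add pderiv_add distrib_left sum.distrib)
next
  case (monomial \<alpha> c)
  have *: "(\<Prod>j\<in>UNIV - {i}. \<gamma> j ^ expo \<alpha> j) * pderiv (\<gamma> i ^ expo \<alpha> i) =
      pderiv (\<gamma> i) * (smult (of_nat (expo \<alpha> i))
        (\<Prod>j\<in>UNIV. \<gamma> j ^ expo (\<alpha> - Poly_Mapping.single i 1) j))" for i
  proof -
    have "(\<Prod>j\<in>UNIV. \<gamma> j ^ expo (\<alpha> - Poly_Mapping.single i 1) j) =
        \<gamma> i ^ (expo \<alpha> i - 1) * (\<Prod>j\<in>UNIV - {i}. \<gamma> j ^ expo \<alpha> j)"
      by (subst prod.remove[of UNIV i])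
         (auto simp: lookup_minus lookup_single when_def intro!: prod.cong)
    then show ?thesis by (simp add: pderiv_power ac_simps)
  qed
  have "pderiv (along_curve \<gamma> (Poly_Mapping.single \<alpha> c)) =
      smult c (\<Sum>i\<in>UNIV. (\<Prod>j\<in>UNIV - {i}. \<gamma> j ^ expo \<alpha> j) * pderiv (\<gamma> i ^ expo \<alpha> i))"
    by (simp only: along_curve_single pderiv_smult pderiv_prod)
  also have "\<dots> = (\<Sum>i\<in>UNIV. pderiv (\<gamma> i) *
      along_curve \<gamma> (partial_deriv i (Poly_Mapping.single \<alpha> c)))"
  proof -
    have sm: "smult c (sum F A) = (\<Sum>a\<in>A. smult c (F a))" for F :: "'a \<Rightarrow> complex poly" and A
      by (induction A rule: infinite_finite_induct) (auto simp: smult_add_right)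
    show ?thesis
      unfolding * sm partial_deriv_single along_curve_single
      by (intro sum.cong refl) (simp add: mult.commute)
  qed
  finally show ?case .
qed

lemma degree_along_curve:
  assumes f: "homogeneous d f" and \<gamma>: "\<And>i. degree (\<gamma> i) \<le> n"
  shows "degree (along_curve \<gamma> f) \<le> n * d"
  unfolding along_curve_def
proof (rule degree_sum_le)
  fix \<alpha> assume "\<alpha> \<in> Poly_Mapping.keys f"
  then have \<alpha>: "(\<Sum>i\<in>UNIV. expo \<alpha> i) = d" using f by (simp add: homogeneous_def)
  have "degree (\<Prod>i\<in>UNIV. \<gamma> i ^ expo \<alpha> i) \<le> (\<Sum>i\<in>UNIV. degree (\<gamma> i ^ expo \<alpha> i))"
    using degree_prod_sum_le[of UNIV "\<lambda>i. \<gamma> i ^ expo \<alpha> i"] by (simp add: o_def)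
  also have "\<dots> \<le> (\<Sum>i\<in>UNIV. n * expo \<alpha> i)"
    by (rule sum_mono) (rule order.trans[OF degree_power_le mult_right_mono[OF \<gamma>]], simp)
  also have "\<dots> = n * d" by (simp add: \<alpha> flip: sum_distrib_left)
  finally show "degree (smult (expo f \<alpha>) (\<Prod>i\<in>UNIV. \<gamma> i ^ expo \<alpha> i)) \<le> n * d"
    by (rule order.trans[OF degree_smult_le])
qed simp

definition line :: "complex ^ 'N::finite \<Rightarrow> complex ^ 'N \<Rightarrow> 'N \<Rightarrow> complex poly" where
  "line x v = (\<lambda>i. [:x $ i, v $ i:])"

lemma curve_point_line [simp]: "curve_point (line x v) z = x + z *s v"
  by (simp add: curve_point_def line_def Finite_Cartesian_Product.vec_eq_iff)

lemma degree_line: "degree (line x v i) \<le> 1"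
  by (simp add: line_def)

lemma pderiv_along_line: "pderiv (along_curve (line x v) f) = along_curve (line x v) (dir_deriv v f)"
proof -
  have s: "along_curve \<gamma> (sum F A) = (\<Sum>a\<in>A. along_curve \<gamma> (F a))"
    for F :: "'a \<Rightarrow> 'a cpoly" and A \<gamma>
    by (induction A rule: infinite_finite_induct) (auto simp: along_curve_add)
  show ?thesis
    unfolding pderiv_along_curve dir_deriv_def s along_curve_pscale
    by (rule sum.cong[OF refl]) (simp add: line_def pderiv_pCons)
qed

text \<open>Euler's relation: differentiate \<open>f (z x) = z^d f x\<close> at \<open>z = 1\<close>.\<close>

lemma peval_dir_deriv_self:
  assumes "homogeneous d f"
  shows "peval (dir_deriv x f) x = of_nat d * peval f x"
proof -
  have "along_curve (line 0 x) f = monom (peval f x) d"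
  proof (rule poly_ext)
    fix z
    have "poly (along_curve (line 0 x) f) z = peval f (z *s x)"
      unfolding poly_along_curve curve_point_line by (simp only: add_0_left)
    then show "poly (along_curve (line 0 x) f) z = poly (monom (peval f x) d) z"
      unfolding peval_scale[OF assms] poly_monom by (simp only: mult.commute)
  qed
  then have "along_curve (line 0 x) (dir_deriv x f) = monom (of_nat d * peval f x) (d - 1)"
    using pderiv_along_line[of 0 x f] by (simp only: pderiv_monom)
  then have "peval (dir_deriv x f) (0 + 1 *s x) = of_nat d * peval f x"
    using poly_along_curve[of "line 0 x" "dir_deriv x f" 1] by (simp only: curve_point_line poly_monom) simp
  then show ?thesis by (simp only: add_0_left vec.scale_one)
qed

section \<open>Polynomials are determined by their values\<close>

text \<open>A polynomial with zero value function has derivatives with zero value functions.  By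
  induction on a degree bound these derivatives vanish, so only a constant term is left.\<close>

lemma cpoly_eq_0_if_peval_eq_0:
  fixes f :: "'N::finite cpoly"
  assumes "\<And>x. peval f x = 0"
  shows "f = 0"
proof -
  have "f = 0" if "\<And>x. peval f x = 0" "\<And>\<alpha>. \<alpha> \<in> Poly_Mapping.keys f \<Longrightarrow> (\<Sum>i\<in>UNIV. expo \<alpha> i) < k"
    for k and f :: "'N cpoly"
    using that
  proof (induction k arbitrary: f)
    case 0
    have "\<alpha> \<notin> Poly_Mapping.keys f" for \<alpha> using 0(2)[of \<alpha>] by auto
    then have "Poly_Mapping.keys f = {}" by blast
    then show ?case by simp
  next
    case (Suc k)
    have d: "partial_deriv i f = 0" for i
    proof (rule Suc.IH)
      fix x
      have "along_curve (line x (axis i 1)) f = 0"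
        by (rule poly_ext) (simp only: poly_along_curve Suc.prems(1) poly_0)
      then have "along_curve (line x (axis i 1)) (partial_deriv i f) = 0"
        using pderiv_along_line[of x "axis i 1" f] unfolding dir_deriv_axis by (simp only: pderiv_0)
      then have "poly (along_curve (line x (axis i 1)) (partial_deriv i f)) 0 = 0" by simp
      then show "peval (partial_deriv i f) x = 0" by (simp add: poly_along_curve)
    next
      fix \<alpha> assume "\<alpha> \<in> Poly_Mapping.keys (partial_deriv i f)"
      then have "\<alpha> + Poly_Mapping.single i 1 \<in> Poly_Mapping.keys f"
        by (auto simp: in_keys_iff lookup_partial_deriv)
      from Suc.prems(2)[OF this] show "(\<Sum>i\<in>UNIV. expo \<alpha> i) < k"
        by (auto simp: lookup_add sum.distrib lookup_single when_def)
    qed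
    have nz: "expo f \<alpha> = 0" if "\<alpha> \<noteq> 0" for \<alpha>
    proof -
      obtain i where i: "expo \<alpha> i \<noteq> 0" using \<open>\<alpha> \<noteq> 0\<close>
        by (metis lookup_zero poly_mapping_eqI)
      let ?e = "Poly_Mapping.single i (1::nat)"
      have "\<alpha> - ?e + ?e = \<alpha>"
        by (rule poly_mapping_eqI) (use i in \<open>auto simp: lookup_add lookup_minus lookup_single when_def\<close>)
      then show ?thesis using lookup_partial_deriv[of i f "\<alpha> - ?e"] d[of i]
        by (simp del: of_nat_Suc)
    qed
    have "f = Poly_Mapping.single 0 (expo f 0)"
      by (rule poly_mapping_eqI) (use nz in \<open>auto simp: lookup_single when_def\<close>)
    moreover from this have "expo f 0 = 0"
      using Suc.prems(1)[of 0] by (metis peval_const)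
    ultimately show ?case by simp
  qed
  from this[OF assms, of "Suc (\<Sum>\<alpha>\<in>Poly_Mapping.keys f. \<Sum>i\<in>UNIV. expo \<alpha> i)"]
  show ?thesis
    using member_le_sum[of _ "Poly_Mapping.keys f" "\<lambda>\<alpha>. \<Sum>i\<in>UNIV. expo \<alpha> i"]
    by (simp add: less_Suc_eq_le)
qed

section \<open>Multiplicities\<close>

lemma linear_power_Suc_dvd:
  fixes P :: "complex poly"
  assumes "poly P s = 0" "[:- s, 1:] ^ k dvd pderiv P"
  shows "[:- s, 1:] ^ Suc k dvd P"
proof (cases "P = 0")
  case False
  then have "order s P = Suc (order s (pderiv P))" using assms(1) by (rule order_pderiv)
  moreover have "pderiv P \<noteq> 0"
  proof
    assume "pderiv P = 0"
    then obtain c where "P = [:c:]" by (auto simp: pderiv_eq_0_iff elim: degree_eq_zeroE)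
    then show False using assms(1) False by simp
  qed
  ultimately show ?thesis using assms(2) by (simp only: order_divides) simp
qed simp

text \<open>The substitute for Bezout's theorem: forms with high multiplicities are shown to vanish by
  counting their zeros on lines and on rational curves.\<close>

lemma poly_eq_0_if_many_roots:
  fixes P :: "complex poly"
  assumes S: "finite S" and dvd: "\<And>s. s \<in> S \<Longrightarrow> [:- s, 1:] ^ e s dvd P"
    and deg: "degree P < (\<Sum>s\<in>S. e s)"
  shows "P = 0"
proof (rule ccontr)
  assume P: "P \<noteq> 0"
  have "(\<Sum>s\<in>S. e s) \<le> (\<Sum>s\<in>S. count (proots P) s)"
    by (rule sum_mono) (use dvd P order_divides in auto)
  also have "\<dots> \<le> (\<Sum>s\<in>S \<union> set_mset (proots P). count (proots P) s)"
    by (rule sum_mono2) (use S in auto)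
  also have "\<dots> = size (proots P)"
    unfolding size_multiset_overloaded_eq
    by (rule sum.mono_neutral_right) (use S in \<open>auto simp: not_in_iff\<close>)
  also have "\<dots> \<le> degree P" by (rule size_proots_le)
  finally show False using deg by simp
qed

lemma mult_at_least_0 [simp]: "mult_at_least 0 f x"
  by (simp add: mult_at_least_def)

text \<open>Splitting off the innermost derivative; most proofs about multiplicities are inductions along
  this recursion.\<close>

lemma mult_at_least_Suc:
  "mult_at_least (Suc m) f x \<longleftrightarrow> peval f x = 0 \<and> (\<forall>i. mult_at_least m (partial_deriv i f) x)"
  (is "?L \<longleftrightarrow> ?R")
proof
  assume L: ?L
  have "peval f x = 0" using L[unfolded mult_at_least_def, rule_format, of "[]"] by simp
  moreover have "peval (foldr partial_deriv is (partial_deriv i f)) x = 0" if "length is < m" for "is" i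
    using L[unfolded mult_at_least_def, rule_format, of "is @ [i]"] that by simp
  ultimately show ?R by (simp add: mult_at_least_def)
next
  assume R: ?R
  show ?L
    unfolding mult_at_least_def
  proof (intro allI impI)
    fix "is" :: "'a list" assume "length is < Suc m"
    then show "peval (foldr partial_deriv is f) x = 0"
      using R by (cases "is" rule: rev_cases) (auto simp: mult_at_least_def)
  qed
qed

lemma mult_at_least_mono: "mult_at_least m f x \<Longrightarrow> k \<le> m \<Longrightarrow> mult_at_least k f x"
  by (auto simp: mult_at_least_def)

lemma mult_at_least_zero [simp]: "mult_at_least m 0 x"
  by (induction m) (auto simp: mult_at_least_Suc)

lemma mult_at_least_add:
  "mult_at_least m f x \<Longrightarrow> mult_at_least m g x \<Longrightarrow> mult_at_least m (f + g) x"
  by (induction m arbitrary: f g) (auto simp: mult_at_least_Suc peval_add partial_deriv_add)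

lemma mult_at_least_pscale: "mult_at_least m f x \<Longrightarrow> mult_at_least m (pscale c f) x"
  by (induction m arbitrary: f) (auto simp: mult_at_least_Suc peval_pscale partial_deriv_pscale)

lemma mult_at_least_sum:
  "(\<And>a. a \<in> A \<Longrightarrow> mult_at_least m (f a) x) \<Longrightarrow> mult_at_least m (sum f A) x"
  by (induction A rule: infinite_finite_induct) (auto simp: mult_at_least_add)

lemma mult_at_least_diff:
  "mult_at_least m f x \<Longrightarrow> mult_at_least m g x \<Longrightarrow> mult_at_least m (f - g) x"
proof -
  assume f: "mult_at_least m f x" and g: "mult_at_least m g x"
  have eq: "f - g = f + pscale (-1) g" by (rule poly_mapping_eqI) (simp add: lookup_add lookup_minus lookup_pscale)
  show ?thesis unfolding eq by (rule mult_at_least_add[OF f mult_at_least_pscale[OF g]])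
qed

lemma mult_at_least_partial_deriv: "mult_at_least m f x \<Longrightarrow> mult_at_least (m - 1) (partial_deriv i f) x"
  by (cases m) (auto simp: mult_at_least_Suc)

lemma mult_at_least_dir_deriv: "mult_at_least m f x \<Longrightarrow> mult_at_least (m - 1) (dir_deriv v f) x"
  unfolding dir_deriv_def
  by (intro mult_at_least_sum mult_at_least_pscale mult_at_least_partial_deriv)

lemma mult_at_least_mult:
  assumes "mult_at_least m f x" "mult_at_least k g x"
  shows "mult_at_least (m + k) (f * g) x"
proof -
  \<comment> \<open>The Leibniz rule lowers only one of the orders, and \<open>m - 1\<close> does not drop for \<open>m = 0\<close>; so the
    induction is over a lower bound \<open>n\<close> of the sum.\<close>
  have "mult_at_least n (f * g) x" if "mult_at_least m f x" "mult_at_least k g x" "n \<le> m + k"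
    for n m k and f g :: "'a cpoly"
    using that
  proof (induction n arbitrary: m k f g)
    case (Suc n)
    have "peval f x * peval g x = 0"
      using Suc.prems by (cases m; cases k) (auto simp: mult_at_least_Suc)
    moreover have "mult_at_least n (partial_deriv i (f * g)) x" for i
      unfolding partial_deriv_mult
      using Suc.prems
      by (intro mult_at_least_add Suc.IH[of "m - 1" _ k] Suc.IH[of m _ "k - 1"]
          mult_at_least_partial_deriv) auto
    ultimately show ?case by (simp add: mult_at_least_Suc peval_mult)
  qed simp
  then show ?thesis using assms by blast
qed

lemma mult_at_least_power: "mult_at_least m f x \<Longrightarrow> mult_at_least (k * m) (f ^ k) x"
  by (induction k) (auto simp: mult_at_least_mult)

lemma mult_at_least_prod:
  "(\<And>a. a \<in> A \<Longrightarrow> peval (f a) x = 0) \<Longrightarrow> mult_at_least (card A) (prod f A) x"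
proof (induction A rule: infinite_finite_induct)
  case (insert a A)
  then have "mult_at_least 1 (f a) x" by (simp add: mult_at_least_Suc)
  then show ?case using insert mult_at_least_mult[of 1 "f a" x "card A" "prod f A"] by simp
qed auto

lemma mult_at_least_scale:
  assumes "homogeneous d f" "mult_at_least m f x" "c \<noteq> 0 \<or> m \<le> d"
  shows "mult_at_least m f (c *s x)"
  using assms
proof (induction m arbitrary: d f)
  case (Suc m)
  have "mult_at_least m (partial_deriv i f) (c *s x)" for i
    by (rule Suc.IH[of "d - 1"]) (use Suc.prems homogeneous_partial_deriv in \<open>auto simp: mult_at_least_Suc\<close>)
  then show ?case using Suc.prems by (simp add: mult_at_least_Suc peval_scale)
qed simp

lemma mult_at_least_along_curve:
  assumes "mult_at_least k g (curve_point \<gamma> s)"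
  shows "[:- s, 1:] ^ k dvd along_curve \<gamma> g"
  using assms
proof (induction k arbitrary: g)
  case (Suc k)
  show ?case
  proof (rule linear_power_Suc_dvd)
    show "poly (along_curve \<gamma> g) s = 0" using Suc.prems by (simp add: poly_along_curve mult_at_least_Suc)
    show "[:- s, 1:] ^ k dvd pderiv (along_curve \<gamma> g)"
      unfolding pderiv_along_curve
      using Suc by (intro dvd_sum dvd_mult) (auto simp: mult_at_least_Suc)
  qed
qed simp

text \<open>A derivative of order \<open>j < \<alpha> + \<beta> - d\<close> has degree \<open>d - j\<close> and at least
  \<open>\<alpha> + \<beta> - 2 j\<close> zeros on the line, namely at the parameters \<open>0\<close> and \<open>1\<close>.\<close>

lemma mult_at_least_on_line:
  assumes "homogeneous d f" "mult_at_least \<alpha> f x" "mult_at_least \<beta> f y" "k + d \<le> \<alpha> + \<beta>"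
  shows "mult_at_least k f (x + z *s (y - x))"
  using assms
proof (induction k arbitrary: d f \<alpha> \<beta>)
  case (Suc k)
  let ?P = "along_curve (line x (y - x)) f"
  have "?P = 0"
  proof (rule poly_eq_0_if_many_roots)
    show "finite {0, 1 :: complex}" by simp
    show "[:- s, 1:] ^ (if s = 0 then \<alpha> else \<beta>) dvd ?P" if "s \<in> {0, 1}" for s
      using that Suc.prems by (intro mult_at_least_along_curve) auto
    show "degree ?P < (\<Sum>s\<in>{0, 1 :: complex}. if s = 0 then \<alpha> else \<beta>)"
      using degree_along_curve[OF Suc.prems(1), of "line x (y - x)" 1] degree_line[of x "y - x"]
        Suc.prems(4) by simp
  qed
  then have 0: "peval f (x + z *s (y - x)) = 0"
    using poly_along_curve[of "line x (y - x)" f z] by simp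
  have "mult_at_least k (partial_deriv i f) (x + z *s (y - x))" for i
  proof (cases "d = 0")
    case True
    then show ?thesis using Suc.prems(1) by (simp add: partial_deriv_homogeneous_0)
  next
    case False
    show ?thesis
      by (rule Suc.IH[OF homogeneous_partial_deriv[OF Suc.prems(1)]
            mult_at_least_partial_deriv[OF Suc.prems(2)] mult_at_least_partial_deriv[OF Suc.prems(3)]])
         (use False Suc.prems(4) in linarith)
  qed
  with 0 show ?case by (simp add: mult_at_least_Suc)
qed simp

lemma mult_at_least_join:
  assumes f: "homogeneous d f" and \<alpha>: "mult_at_least \<alpha> f x" "\<alpha> \<le> d"
    and \<beta>: "mult_at_least \<beta> f y" "\<beta> \<le> d" and k: "k + d \<le> \<alpha> + \<beta>"
  shows "mult_at_least k f (u *s x + v *s y)"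
proof -
  \<comment> \<open>The point is the midpoint of \<open>2 u x\<close> and \<open>2 v y\<close>.\<close>
  have "mult_at_least k f ((2 * u) *s x + (1 / 2) *s ((2 * v) *s y - (2 * u) *s x))"
    using mult_at_least_scale[OF f \<alpha>(1)] mult_at_least_scale[OF f \<beta>(1)] \<alpha> \<beta> k
    by (intro mult_at_least_on_line[OF f]) auto
  moreover have "(2 * u) *s x + (1 / 2) *s ((2 * v) *s y - (2 * u) *s x) = u *s x + v *s y"
    by (simp add: Finite_Cartesian_Product.vec_eq_iff algebra_simps)
  ultimately show ?thesis by simp
qed

text \<open>Start with order \<open>m\<close> at one spanning point.  By the join lemma the order drops by at most
  \<open>d - m\<close> with each further one.\<close>

lemma mult_at_least_span:
  assumes f: "homogeneous d f" and m: "m \<le> d"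
    and T: "finite T" "T \<noteq> {}" "\<And>y. y \<in> T \<Longrightarrow> mult_at_least m f y"
    and x: "x \<in> vec.span T" and k: "k + (card T - 1) * d \<le> card T * m"
  shows "mult_at_least k f x"
  using T x k
proof (induction T arbitrary: x k rule: finite_ne_induct)
  case (singleton y)
  then obtain c where "x = c *s y" by (auto simp: vec.span_singleton)
  then show ?case
    using mult_at_least_scale[OF f, of m y c] mult_at_least_mono[of m f x k] singleton m by simp
next
  case (insert y T)
  obtain c where c: "x - c *s y \<in> vec.span T"
    using insert.prems(2) by (auto simp: vec.span_insert)
  define q where "q = card T"
  have q: "q \<ge> 1" using insert.hyps by (simp add: q_def card_gt_0_iff Suc_le_eq)
  have k: "k + q * d \<le> q * m + m"
    using insert.prems(3) insert.hyps by (simp add: q_def)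
  obtain r where r: "d = m + r" using m le_Suc_ex by blast
  have kr: "k + q * r \<le> m" using k by (simp add: r algebra_simps)
  have q': "q * r = (q - 1) * r + r" using q by (cases q) auto
  \<comment> \<open>the order on the span of \<open>q\<close> points\<close>
  define k' where "k' = m - (q - 1) * r"
  have k'm: "k' \<le> m" and k'k: "k + d \<le> m + k'" and k': "k' + (q - 1) * r = m"
    using kr q' r by (auto simp: k'_def)
  have "k' + (card T - 1) * d \<le> card T * m"
  proof -
    have "k' + (q - 1) * d = (k' + (q - 1) * r) + (q - 1) * m"
      by (simp only: r distrib_left add_ac)
    also have "\<dots> = q * m" unfolding k' using q by (cases q) auto
    finally show ?thesis by (simp add: q_def)
  qed
  then have "mult_at_least k' f (x - c *s y)"
    using insert.IH[of "x - c *s y" k'] insert.prems(1) c by blast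
  then have "mult_at_least k f (c *s y + 1 *s (x - c *s y))"
    using insert.prems(1)[of y] m k'm k'k by (intro mult_at_least_join[OF f]) auto
  then show ?case by simp
qed

section \<open>Multiplicity along a rational curve\<close>

definition tangent :: "('N::finite \<Rightarrow> complex poly) \<Rightarrow> complex \<Rightarrow> complex ^ 'N" where
  "tangent \<gamma> = curve_point (\<lambda>i. pderiv (\<gamma> i))"

lemma poly_pderiv_along_curve:
  "poly (pderiv (along_curve \<gamma> g)) z = peval (dir_deriv (tangent \<gamma> z) g) (curve_point \<gamma> z)"
  by (simp add: pderiv_along_curve poly_sum poly_along_curve peval_dir_deriv tangent_def curve_point_def)

text \<open>By Euler's relation, applied to \<open>g\<close> and to its derivative along the tangent at \<open>x\<close>, the value and
  the derivative at \<open>x\<close> are multiples of those of the restriction of \<open>g\<close> to the curve.\<close>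

lemma double_root_dir_deriv:
  assumes g: "homogeneous e g" and 0: "along_curve \<gamma> g = 0"
  shows "[:- x, 1:] ^ 2 dvd along_curve \<gamma> (dir_deriv (curve_point \<gamma> x) g)"
proof -
  let ?c = "curve_point \<gamma> x" and ?t = "tangent \<gamma> x"
  let ?P = "along_curve \<gamma> (dir_deriv ?c g)"
  have "poly ?P x = of_nat e * peval g ?c"
    by (simp only: poly_along_curve peval_dir_deriv_self[OF g])
  also have "peval g ?c = 0" using poly_along_curve[of \<gamma> g x] 0 by simp
  finally have 1: "poly ?P x = 0" by simp
  have "poly (pderiv ?P) x = peval (dir_deriv ?c (dir_deriv ?t g)) ?c"
    by (simp only: poly_pderiv_along_curve dir_deriv_commute)
  also have "\<dots> = of_nat (e - 1) * peval (dir_deriv ?t g) ?c"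
    by (simp only: peval_dir_deriv_self[OF homogeneous_dir_deriv[OF g]])
  also have "peval (dir_deriv ?t g) ?c = 0"
    using poly_pderiv_along_curve[of \<gamma> g x] 0 by simp
  finally have "[:- x, 1:] ^ 1 dvd pderiv ?P" by (simp add: poly_eq_0_iff_dvd)
  with 1 show ?thesis using linear_power_Suc_dvd[of ?P x 1] by (simp only: numeral_2_eq_2 One_nat_def)
qed

abbreviation dir_derivs :: "(complex ^ 'N::finite) list \<Rightarrow> 'N cpoly \<Rightarrow> 'N cpoly" where
  "dir_derivs vs f \<equiv> foldr dir_deriv vs f"

lemma dir_derivs_dir_deriv: "dir_derivs us (dir_deriv v f) = dir_deriv v (dir_derivs us f)"
  by (induction us) (auto simp: dir_deriv_commute)

lemma homogeneous_dir_derivs: "homogeneous d f \<Longrightarrow> homogeneous (d - length vs) (dir_derivs vs f)"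
  by (induction vs) (auto dest: homogeneous_dir_deriv)

lemma mult_at_least_dir_derivs: "mult_at_least m f x \<Longrightarrow> mult_at_least (m - length vs) (dir_derivs vs f) x"
  by (induction vs) (auto dest: mult_at_least_dir_deriv)

lemma dir_derivs_axes: "dir_derivs (map (\<lambda>i. axis i 1) is) f = foldr partial_deriv is f"
  by (induction "is") (auto simp: dir_deriv_axis)

text \<open>With \<open>\<mu> = length xs\<close> the derivative has degree at most \<open>n (d - \<mu>)\<close> on the curve, but
  \<open>(n + 3) (m - \<mu>)\<close> zeros in \<open>Z\<close> and \<open>2 \<mu>\<close> further ones.  Without the latter,
  which reflect that the leading form is a form on the normal bundle, the count would only give about
  a third of the multiplicity.\<close>

lemma dir_derivs_curve_points_vanish:
  fixes \<gamma> :: "'N::finite \<Rightarrow> complex poly"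
  assumes F: "homogeneous d F" and \<gamma>: "\<And>i. degree (\<gamma> i) \<le> n"
    and Z: "finite Z" "card Z = n + 3" "\<And>z. z \<in> Z \<Longrightarrow> mult_at_least m F (curve_point \<gamma> z)"
    and k: "k \<le> m" "m \<le> d" "n * d + k \<le> (n + 3) * m"
    and \<mu>: "\<And>z. mult_at_least (length xs) F (curve_point \<gamma> z)"
    and xs: "distinct xs" "set xs \<inter> Z = {}" "length xs < k"
  shows "along_curve \<gamma> (dir_derivs (map (curve_point \<gamma>) xs) F) = 0"
proof (rule poly_eq_0_if_many_roots)
  let ?c = "curve_point \<gamma>"
  let ?P = "along_curve \<gamma> (dir_derivs (map ?c xs) F)"
  let ?e = "\<lambda>s. if s \<in> Z then m - length xs else 2"
  show "finite (Z \<union> set xs)" using Z by simp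
  fix s assume "s \<in> Z \<union> set xs"
  show "[:- s, 1:] ^ ?e s dvd ?P"
  proof (cases "s \<in> Z")
    case True
    then show ?thesis
      using mult_at_least_along_curve[OF mult_at_least_dir_derivs[OF Z(3)[OF True], of "map ?c xs"]] by simp
  next
    case False
    then obtain ys zs where s: "xs = ys @ s # zs"
      using \<open>s \<in> Z \<union> set xs\<close> by (auto simp: in_set_conv_decomp)
    let ?g = "dir_derivs (map ?c ys @ map ?c zs) F"
    have "peval ?g (?c z) = 0" for z
      using mult_at_least_dir_derivs[OF \<mu>[of z], of "map ?c ys @ map ?c zs"]
      by (simp add: s mult_at_least_Suc Suc_diff_le)
    then have "along_curve \<gamma> ?g = 0" by (intro poly_ext) (simp add: poly_along_curve)
    then have "[:- s, 1:] ^ 2 dvd along_curve \<gamma> (dir_deriv (?c s) ?g)"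
      by (rule double_root_dir_deriv[OF homogeneous_dir_derivs[OF F]])
    then show ?thesis using False by (simp add: s dir_derivs_dir_deriv)
  qed
next
  let ?c = "curve_point \<gamma>"
  let ?P = "along_curve \<gamma> (dir_derivs (map ?c xs) F)"
  let ?e = "\<lambda>s. if s \<in> Z then m - length xs else 2"
  define \<mu> where "\<mu> = length xs"
  have "degree ?P \<le> n * (d - \<mu>)"
    using degree_along_curve[OF homogeneous_dir_derivs[OF F, of "map ?c xs"] \<gamma>] by (simp add: \<mu>_def)
  also have "\<dots> < (n + 3) * (m - \<mu>) + 2 * \<mu>"
  proof -
    obtain m' where m': "m = \<mu> + m'" using xs(3) k(1) by (metis \<mu>_def le_Suc_ex less_imp_le order_trans)
    obtain d' where d': "d = \<mu> + d'" using k(2) m' by (metis le_Suc_ex add_leE)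
    have "n * \<mu> + n * d' + k \<le> (n + 3) * \<mu> + (n + 3) * m'"
      using k(3) by (simp add: m' d' algebra_simps)
    then show ?thesis using xs(3) by (simp add: m' d' \<mu>_def algebra_simps)
  qed
  also have "\<dots> = (\<Sum>s\<in>Z. ?e s) + (\<Sum>s\<in>set xs. ?e s)"
  proof -
    have "(\<Sum>s\<in>set xs. ?e s) = (\<Sum>s\<in>set xs. 2)" by (intro sum.cong refl) (use xs(2) in auto)
    then show ?thesis using xs(1) Z by (simp add: \<mu>_def distinct_card)
  qed
  also have "\<dots> = (\<Sum>s\<in>Z \<union> set xs. ?e s)"
    using xs(2) Z by (intro sum.union_disjoint[symmetric]) auto
  finally show "degree ?P < (\<Sum>s\<in>Z \<union> set xs. ?e s)" .
qed

text \<open>For \<open>k = (n + 3) m - n d\<close> this is the lower bound \<open>k\<^sub>C\<close> for the multiplicity along a rational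
  normal curve.  By induction on the order, all derivatives of the next order in directions of
  distinct general points of the curve vanish on it.  These points span the space, so one direction
  after the other may be replaced by an arbitrary vector.\<close>

theorem mult_at_least_rational_curve:
  fixes \<gamma> :: "'N::finite \<Rightarrow> complex poly"
  assumes F: "homogeneous d F" and \<gamma>: "\<And>i. degree (\<gamma> i) \<le> n"
    and Z: "finite Z" "card Z = n + 3" "\<And>z. z \<in> Z \<Longrightarrow> mult_at_least m F (curve_point \<gamma> z)"
    and k: "k \<le> m" "m \<le> d" "n * d + k \<le> (n + 3) * m"
    and span: "\<And>S. finite S \<Longrightarrow> vec.span (curve_point \<gamma> ` (- S)) = UNIV"
  shows "mult_at_least k F (curve_point \<gamma> z)"
proof -
  let ?c = "curve_point \<gamma>"
  have "\<forall>z. mult_at_least \<mu> F (?c z)" if "\<mu> \<le> k" for \<mu>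
    using that
  proof (induction \<mu>)
    case (Suc \<mu>)
    then have IH: "mult_at_least \<mu> F (?c z)" for z by simp
    have *: "peval (dir_derivs (us @ map ?c xs) F) (?c z) = 0"
      if "length us + length xs = \<mu>" "distinct xs" "set xs \<inter> Z = {}" for us xs z
      using that
    proof (induction us arbitrary: xs)
      case Nil
      then have "along_curve \<gamma> (dir_derivs (map ?c xs) F) = 0"
        using IH Suc.prems by (intro dir_derivs_curve_points_vanish[OF F \<gamma> Z k]) auto
      then show ?case using poly_along_curve[of \<gamma> "dir_derivs (map ?c xs) F" z] by simp
    next
      case (Cons u us)
      let ?g = "dir_derivs (us @ map ?c xs) F"
      have "u \<in> vec.span (?c ` (- (Z \<union> set xs)))" using span[of "Z \<union> set xs"] Z by simp
      then have "peval (dir_deriv u ?g) (?c z) = 0"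
      proof (induction u rule: vec.span_induct)
        show "vec.subspace {u. peval (dir_deriv u ?g) (?c z) = 0}"
          by (auto simp: vec.subspace_def dir_deriv_plus_vec dir_deriv_scale_vec peval_add peval_pscale)
      next
        fix v assume "v \<in> ?c ` (- (Z \<union> set xs))"
        then obtain x where "v = ?c x" "x \<notin> Z" "x \<notin> set xs" by auto
        then show "peval (dir_deriv v ?g) (?c z) = 0"
          using Cons.IH[of "x # xs"] Cons.prems by (simp add: dir_derivs_dir_deriv)
      qed
      then show ?case by simp
    qed
    show ?case
      unfolding mult_at_least_def
    proof (intro allI impI)
      fix z "is" assume l: "length (is :: 'N list) < Suc \<mu>"
      show "peval (foldr partial_deriv is F) (?c z) = 0"
      proof (cases "length is = \<mu>")
        case True
        then show ?thesis
          using *[of "map (\<lambda>i. axis i 1) is" "[]" z] by (simp add: dir_derivs_axes)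
      next
        case False
        then show ?thesis using IH[of z] l by (simp add: mult_at_least_def)
      qed
    qed
  qed simp
  then show ?thesis by blast
qed

section \<open>Division in the direction of a vector\<close>

lemma funpow_dir_deriv_diff: "(dir_deriv v ^^ k) (f - g) = (dir_deriv v ^^ k) f - (dir_deriv v ^^ k) g"
  by (induction k) (auto simp: dir_deriv_diff)

lemma funpow_dir_deriv_pscale: "(dir_deriv v ^^ k) (pscale c f) = pscale c ((dir_deriv v ^^ k) f)"
  by (induction k) (auto simp: dir_deriv_pscale)

lemma funpow_dir_deriv_zero [simp]: "(dir_deriv v ^^ k) 0 = 0"
  by (induction k) auto

lemma funpow_dir_deriv_mono: "(dir_deriv v ^^ k) f = 0 \<Longrightarrow> k \<le> m \<Longrightarrow> (dir_deriv v ^^ m) f = 0"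
  using funpow_add[of "m - k" k "dir_deriv v"] by simp

lemma dir_deriv_const [simp]: "dir_deriv v (Poly_Mapping.single 0 c) = 0"
  by (rule dir_deriv_homogeneous_0) (auto simp: homogeneous_def)

lemma homogeneous_top_dir_deriv:
  assumes "homogeneous d f"
  shows "(dir_deriv v ^^ d) f = Poly_Mapping.single 0 (fact d * peval f v)"
  using assms
proof (induction d arbitrary: f)
  case 0
  then have "f = Poly_Mapping.single 0 (expo f 0)" by (rule homogeneous_0_imp_const)
  moreover from this have "peval f v = expo f 0" by (metis peval_const)
  ultimately show ?case by simp
next
  case (Suc d)
  have "homogeneous d (dir_deriv v f)" using homogeneous_dir_deriv[OF Suc.prems] by simp
  from Suc.IH[OF this] show ?case
    by (simp add: peval_dir_deriv_self[OF Suc.prems] funpow_Suc_right mult_ac del: funpow.simps)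
qed

lemma homogeneous_dir_deriv_vanishes: "homogeneous d f \<Longrightarrow> (dir_deriv v ^^ Suc d) f = 0"
  by (simp add: homogeneous_top_dir_deriv)

lemma funpow_pderiv_eq_0:
  fixes P :: "complex poly"
  shows "(pderiv ^^ k) P = 0 \<Longrightarrow> P = 0 \<or> degree P < k"
proof (induction k arbitrary: P)
  case (Suc k)
  then have "pderiv P = 0 \<or> degree (pderiv P) < k" by (simp add: funpow_Suc_right del: funpow.simps)
  then show ?case by (auto simp: degree_pderiv pderiv_eq_0_iff)
qed simp

text \<open>The equation \<open>D\<^sub>v\<^sup>k f = 0\<close> says that \<open>f\<close> has degree less than \<open>k\<close> in the direction \<open>v\<close>.  In this
  form it refers to no coordinates.\<close>

lemma along_line_eq_0_or_degree_less:
  assumes "(dir_deriv v ^^ k) f = 0"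
  shows "along_curve (line y v) f = 0 \<or> degree (along_curve (line y v) f) < k"
proof (rule funpow_pderiv_eq_0)
  have "(pderiv ^^ j) (along_curve (line y v) f) = along_curve (line y v) ((dir_deriv v ^^ j) f)" for j
    by (induction j) (auto simp: pderiv_along_line)
  then show "(pderiv ^^ k) (along_curve (line y v) f) = 0" using assms by simp
qed

lemma dir_deriv_of_nat [simp]: "dir_deriv v (of_nat k) = 0"
  using dir_deriv_const[of v "of_nat k"] by (simp only: single_of_nat)

lemma funpow_dir_deriv_mult_invariant:
  assumes "dir_deriv v g = 0"
  shows "(dir_deriv v ^^ k) (g * f) = g * (dir_deriv v ^^ k) f"
  by (induction k) (auto simp: dir_deriv_mult assms)

lemma funpow_dir_deriv_mult_unit_slope:
  assumes "dir_deriv v l = 1"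
  shows "(dir_deriv v ^^ Suc k) (l * f) = l * (dir_deriv v ^^ Suc k) f + of_nat (Suc k) * (dir_deriv v ^^ k) f"
  by (induction k) (auto simp: dir_deriv_mult assms dir_deriv_add algebra_simps)

text \<open>Multiples of \<open>F\<close> with constant leading coefficient in every degree from \<open>e\<close> on; they cancel
  leading terms in the division.\<close>

lemma funpow_dir_deriv_power_mult:
  assumes F: "(dir_deriv v ^^ e) F = Poly_Mapping.single 0 c" and l: "dir_deriv v l = 1"
  shows "(dir_deriv v ^^ (e + m)) (l ^ m * F) = Poly_Mapping.single 0 (c * (fact (e + m) / fact e))"
proof (induction m)
  case (Suc m)
  have 0: "(dir_deriv v ^^ Suc (e + m)) (l ^ m * F) = 0" using Suc by simp
  have "(dir_deriv v ^^ (e + Suc m)) (l ^ Suc m * F) =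
      (dir_deriv v ^^ Suc (e + m)) (l * (l ^ m * F))" by (simp add: mult_ac)
  also have "\<dots> = of_nat (Suc (e + m)) * (dir_deriv v ^^ (e + m)) (l ^ m * F)"
    by (simp only: funpow_dir_deriv_mult_unit_slope[OF l] 0 mult_zero_right add_0_left)
  also have "\<dots> = Poly_Mapping.single 0 (of_nat (Suc (e + m)) * (c * (fact (e + m) / fact e)))"
    by (simp only: Suc of_nat_single[symmetric] mult_single add_0_left single_of_nat[symmetric])
  also have "of_nat (Suc (e + m)) * (c * (fact (e + m) / fact e)) = c * (fact (e + Suc m) / fact e)"
    by (simp add: mult_ac)
  finally show ?case .
qed (use F in simp)

lemma exists_form_of_slope_one:
  assumes "v \<noteq> 0"
  shows "\<exists>l. dir_deriv v l = 1"
proof -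
  from assms obtain i where i: "v $ i \<noteq> 0" by (auto simp: Finite_Cartesian_Product.vec_eq_iff)
  have "dir_deriv v (Poly_Mapping.single (Poly_Mapping.single i 1) (1 / v $ i)) = 1"
    (is "dir_deriv v ?l = 1")
  proof -
    have "dir_deriv v ?l = (\<Sum>k\<in>UNIV. if k = i then Poly_Mapping.single 0 1 else 0)"
      unfolding dir_deriv_def
    proof (intro sum.cong refl)
      fix k
      show "pscale (v $ k) (partial_deriv k ?l) = (if k = i then Poly_Mapping.single 0 1 else 0)"
        using i by (simp add: partial_deriv_single lookup_single pscale_def mult_single)
    qed
    then show ?thesis by simp
  qed
  then show ?thesis by blast
qed

text \<open>The leading coefficient of \<open>f\<close> along \<open>v\<close> is constant on the lines in this direction, so one of the
  above multiples of \<open>F\<close> cancels the leading term.\<close>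

lemma division_along:
  assumes F: "(dir_deriv v ^^ e) F = Poly_Mapping.single 0 c" "c \<noteq> 0" and v: "v \<noteq> 0"
    and f: "(dir_deriv v ^^ k) f = 0"
  shows "\<exists>Q R. f = F * Q + R \<and> (dir_deriv v ^^ e) R = 0"
  using f
proof (induction k arbitrary: f)
  case 0
  then show ?case by (intro exI[of _ 0]) simp
next
  case (Suc k)
  obtain l where l: "dir_deriv v l = 1" using exists_form_of_slope_one[OF v] by blast
  show ?case
  proof (cases "Suc k \<le> e")
    case True
    then show ?thesis
      using funpow_dir_deriv_mono[OF Suc.prems True] by (intro exI[of _ 0] exI[of _ f]) simp
  next
    case False
    then obtain m where k: "k = e + m" using le_Suc_ex[of e k] by auto
    \<comment> \<open>the leading coefficient of \<open>f\<close> along \<open>v\<close>, up to the factor \<open>k!\<close>\<close>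
    define g where "g = (dir_deriv v ^^ k) f"
    define a where "a = c * (fact (e + m) / fact e)"
    have a: "a \<noteq> 0" using F(2) by (simp add: a_def)
    have g: "dir_deriv v g = 0" using Suc.prems by (simp add: g_def)
    let ?h = "pscale (1 / a) (g * (l ^ m * F))"
    have "(dir_deriv v ^^ k) ?h = pscale (1 / a) (g * Poly_Mapping.single 0 a)"
      by (simp only: funpow_dir_deriv_pscale funpow_dir_deriv_mult_invariant[OF g] k
          funpow_dir_deriv_power_mult[OF F(1) l] a_def)
    also have "\<dots> = g"
      using a by (simp add: pscale_def mult.commute[of g] mult_single flip: mult.assoc)
    finally have "(dir_deriv v ^^ k) (f - ?h) = 0" by (simp add: funpow_dir_deriv_diff g_def)
    from Suc.IH[OF this] obtain Q R where QR: "f - ?h = F * Q + R" "(dir_deriv v ^^ e) R = 0" by blast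
    have "?h = F * pscale (1 / a) (g * l ^ m)"
      by (simp add: pscale_mult_right mult_ac)
    then have "f = F * (Q + pscale (1 / a) (g * l ^ m)) + R"
      using QR(1) by (simp add: algebra_simps)
    then show ?thesis using QR(2) by blast
  qed
qed

text \<open>On each line through a point of the open set there are infinitely many zeros.\<close>

lemma cpoly_eq_0_if_vanishes_on_open:
  fixes f :: "'N::finite cpoly"
  assumes \<Omega>: "open \<Omega>" "y \<in> \<Omega>" and f: "\<And>x. x \<in> \<Omega> \<Longrightarrow> peval f x = 0"
  shows "f = 0"
proof (rule cpoly_eq_0_if_peval_eq_0)
  fix x
  let ?P = "along_curve (line y (x - y)) f" and ?S = "{s. y + s *s (x - y) \<in> \<Omega>}"
  have "continuous_on UNIV (\<lambda>s. y + s *s (x - y))"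
    unfolding vector_scalar_mult_def by (intro continuous_intros)
  then have "open ?S" using continuous_open_preimage[OF _ open_UNIV \<Omega>(1)] by (simp add: vimage_def)
  moreover have "0 \<in> ?S" using \<Omega>(2) by simp
  ultimately have "infinite ?S" using finite_imp_not_open by blast
  moreover have "?S \<subseteq> {s. poly ?P s = 0}" using f by (auto simp: poly_along_curve)
  ultimately have "infinite {s. poly ?P s = 0}" using finite_subset by blast
  then have "?P = 0" using poly_roots_finite by blast
  then have "peval f (y + 1 *s (x - y)) = 0"
    using poly_along_curve[of "line y (x - y)" f 1] by simp
  then show "peval f x = 0" by simp
qed

text \<open>On each of the lines the zeros outnumber the degree, and the lines fill an open set.\<close>

lemma cpoly_eq_0_if_many_zeros_on_lines:
  assumes \<Omega>: "open \<Omega>" "\<Omega> \<noteq> {}" and k: "k \<le> e * a"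
    and deg: "(dir_deriv v ^^ k) f = 0"
    and lines: "\<And>y. y \<in> \<Omega> \<Longrightarrow> \<exists>S. finite S \<and> card S = e \<and> (\<forall>s\<in>S. mult_at_least a f (y + s *s v))"
  shows "f = 0"
proof -
  from \<Omega>(2) obtain y0 where y0: "y0 \<in> \<Omega>" by blast
  show ?thesis
  proof (rule cpoly_eq_0_if_vanishes_on_open[OF \<Omega>(1) y0])
    fix y assume "y \<in> \<Omega>"
    then obtain S where S: "finite S" "card S = e" "\<forall>s\<in>S. mult_at_least a f (y + s *s v)"
      using lines by blast
    let ?P = "along_curve (line y v) f"
    have "?P = 0"
    proof (rule ccontr)
      assume "?P \<noteq> 0"
      then have "degree ?P < k" using along_line_eq_0_or_degree_less[OF deg] by blast
      then have "degree ?P < (\<Sum>s\<in>S. a)" using k S(2) by simp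
      then have "?P = 0"
        using S by (intro poly_eq_0_if_many_roots[OF S(1), of "\<lambda>_. a"] mult_at_least_along_curve) auto
      with \<open>?P \<noteq> 0\<close> show False by blast
    qed
    then show "peval f y = 0" using poly_along_curve[of "line y v" f 0] by simp
  qed
qed

text \<open>Put \<open>l\<^sub>i = d - m\<^sub>i\<close>, \<open>\<Lambda> = \<Sum> l\<^sub>i\<close> and \<open>p = d + 2 - k\<^sub>C\<close>.  The binomial
  coefficient in the term of \<open>(I, \<tau>)\<close> is the coefficient of \<open>x^d\<close> in
  \<open>x^(\<tau> p + \<Sum>\<^sub>I (l\<^sub>i + 1)) / (1 - x)^(n + 1)\<close>, so the sum over \<open>I\<close> is the coefficient of \<open>x^(d - \<tau> p)\<close> in
  \<open>(1 - x)\<^sup>2 \<Prod> (1 + x + \<dots> + x^l\<^sub>i)\<close>.  The product is the character of a tensor product of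
  representations of \<open>SL\<^sub>2\<close>; one factor \<open>1 - x\<close> turns weights into multiplicities.  Adding the
  translates by multiples of \<open>p\<close> gives the fusion product at level \<open>p - 2\<close>.  Series are written as
  functions on the integers, so \<open>back_diff q\<close> is multiplication by \<open>1 - x^q\<close> and
  \<open>window_sum l\<close> is multiplication by \<open>1 + x + \<dots> + x^l\<close>.\<close>

(* The step 1 of a difference has to stay a numeral. *)
declare One_nat_def [simp del]

section \<open>The secant linear virtual dimension as a fusion multiplicity\<close>

definition back_diff :: "nat \<Rightarrow> (int \<Rightarrow> int) \<Rightarrow> int \<Rightarrow> int" where
  "back_diff q F x = F x - F (x - int q)"

definition window_sum :: "nat \<Rightarrow> (int \<Rightarrow> int) \<Rightarrow> int \<Rightarrow> int" where
  "window_sum l F x = (\<Sum>y\<in>{x - int l..x}. F y)"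

lemma sum_int_split:
  fixes F :: "int \<Rightarrow> int"
  assumes "a \<le> b + 1" "b \<le> c"
  shows "(\<Sum>x\<in>{a..c}. F x) = (\<Sum>x\<in>{a..b}. F x) + (\<Sum>x\<in>{b + 1..c}. F x)"
proof -
  have "{a..c} = {a..b} \<union> {b + 1..c}" using assms by auto
  then show ?thesis by (simp add: sum.union_disjoint)
qed

lemma window_sum_Suc: "window_sum (Suc l) F x = window_sum l F x + F (x - int l - 1)"
  using sum_int_split[of "x - int l - 1" "x - int l - 1" x F]
  by (simp add: window_sum_def algebra_simps)

lemma window_sum_back_diff: "window_sum l (back_diff 1 F) = back_diff (Suc l) F"
proof
  fix x
  show "window_sum l (back_diff 1 F) x = back_diff (Suc l) F x"
    by (induction l) (auto simp: window_sum_Suc, auto simp: window_sum_def back_diff_def algebra_simps)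
qed

lemma back_diff_window_sum: "back_diff 1 (window_sum l F) = window_sum l (back_diff 1 F)"
proof
  fix x
  show "back_diff 1 (window_sum l F) x = window_sum l (back_diff 1 F) x"
    by (induction l) (auto simp: window_sum_Suc back_diff_def, auto simp: window_sum_def back_diff_def algebra_simps)
qed

text \<open>The factorisation \<open>1 - x^(l + 1) = (1 - x) (1 + x + \<dots> + x^l)\<close>, once for each factor.\<close>

lemma foldr_back_diff:
  "foldr (\<lambda>i. back_diff (Suc (l i))) xs F =
   foldr (\<lambda>i. window_sum (l i)) xs ((back_diff 1 ^^ length xs) F)"
proof (induction xs arbitrary: F)
  case (Cons i xs)
  have *: "foldr (\<lambda>i. window_sum (l i)) ys (back_diff 1 G) =
      back_diff 1 (foldr (\<lambda>i. window_sum (l i)) ys G)" for ys G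
    by (induction ys) (auto simp: back_diff_window_sum)
  show ?case
    by (simp add: Cons.IH * window_sum_back_diff)
qed simp

lemma foldr_back_diff_inclusion_exclusion:
  assumes "distinct xs"
  shows "(\<Sum>I\<in>Pow (set xs). (-1) ^ card I * F (x - (\<Sum>i\<in>I. int (q i)))) =
    foldr (\<lambda>i. back_diff (q i)) xs F x"
  using assms
proof (induction xs arbitrary: x)
  case (Cons i xs)
  let ?f = "\<lambda>I. (-1) ^ card I * F (x - (\<Sum>i\<in>I. int (q i)))"
  have i: "i \<notin> set xs" using Cons by simp
  have disj: "Pow (set xs) \<inter> insert i ` Pow (set xs) = {}" using i by auto
  have inj: "inj_on (insert i) (Pow (set xs))"
    using i by (intro inj_onI) (metis Diff_insert_absorb PowD subsetD)
  have "sum ?f (Pow (set (i # xs))) = sum ?f (Pow (set xs)) + sum ?f (insert i ` Pow (set xs))"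
    using disj by (simp add: Pow_insert sum.union_disjoint)
  also have "sum ?f (insert i ` Pow (set xs)) = (\<Sum>I\<in>Pow (set xs). ?f (insert i I))"
    using inj by (simp add: sum.reindex)
  also have "\<dots> = (\<Sum>I\<in>Pow (set xs). - ((-1) ^ card I * F ((x - int (q i)) - (\<Sum>i\<in>I. int (q i)))))"
  proof (intro sum.cong refl)
    fix I assume "I \<in> Pow (set xs)"
    then have "finite I" "i \<notin> I" using i by (auto intro: finite_subset)
    then show "?f (insert i I) = - ((-1) ^ card I * F ((x - int (q i)) - (\<Sum>i\<in>I. int (q i))))"
      by (simp add: algebra_simps)
  qed
  finally show ?case
    using Cons by (simp add: sum_negf back_diff_def)
qed simp

lemma window_sum_sum: "window_sum l (\<lambda>x. \<Sum>\<tau>\<in>A. F \<tau> x) = (\<lambda>x. \<Sum>\<tau>\<in>A. window_sum l (F \<tau>) x)"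
  by (rule ext) (simp add: window_sum_def sum.swap[of _ A])

lemma window_sum_shift: "window_sum l (\<lambda>x. F (x - s)) = (\<lambda>x. window_sum l F (x - s))"
proof
  fix x
  show "window_sum l (\<lambda>x. F (x - s)) x = window_sum l F (x - s)"
    by (induction l) (auto simp: window_sum_Suc, auto simp: window_sum_def algebra_simps)
qed

lemma foldr_window_sum_shifts:
  "foldr (\<lambda>i. window_sum (l i)) xs (\<lambda>x. \<Sum>\<tau>\<in>A. F (x - s \<tau>)) =
   (\<lambda>x. \<Sum>\<tau>\<in>A. foldr (\<lambda>i. window_sum (l i)) xs F (x - s \<tau>))"
  by (induction xs) (auto simp: window_sum_sum window_sum_shift)

text \<open>Window sums look back at most \<open>\<Sum> l\<^sub>i\<close> places, so sequences may be periodised by finite sums.\<close>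

lemma foldr_window_sum_cong:
  assumes "\<And>y. x - (\<Sum>i\<leftarrow>xs. int (l i)) \<le> y \<Longrightarrow> y \<le> x \<Longrightarrow> F y = G y"
  shows "foldr (\<lambda>i. window_sum (l i)) xs F x = foldr (\<lambda>i. window_sum (l i)) xs G x"
  using assms
proof (induction xs arbitrary: x)
  case (Cons i xs)
  show ?case
    unfolding foldr_Cons o_def
    by (subst (1 2) window_sum_def, rule sum.cong[OF refl], rule Cons.IH) (use Cons.prems in auto)
qed simp

subsection \<open>Positivity\<close>

lemma sum_antisymmetric:
  fixes F :: "int \<Rightarrow> int"
  assumes "\<And>x. F (c - x) = - F x" "a + b = c"
  shows "(\<Sum>x\<in>{a..b}. F x) = 0"
proof -
  have "(\<Sum>x\<in>{a..b}. F x) = (\<Sum>x\<in>{a..b}. F (c - x))"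
    by (rule sum.reindex_bij_witness[of _ "\<lambda>x. c - x" "\<lambda>x. c - x"]) (use assms(2) in auto)
  then show ?thesis by (simp add: assms(1) sum_negf)
qed

text \<open>With the weight \<open>c - 2 x\<close> of the place \<open>x\<close>, the first two conditions say that \<open>F\<close> is antisymmetric
  under the affine Weyl group, whose walls are the multiples of \<open>p\<close>, and the third that it is
  nonnegative on the fundamental alcove.\<close>

definition alcove_positive :: "int \<Rightarrow> int \<Rightarrow> (int \<Rightarrow> int) \<Rightarrow> bool" where
  "alcove_positive p c F \<longleftrightarrow>
     (\<forall>x. F (c - x) = - F x) \<and> (\<forall>x. F (x + p) = F x) \<and>
     (\<forall>x. 0 \<le> c - 2 * x \<longrightarrow> c - 2 * x \<le> p \<longrightarrow> 0 \<le> F x)"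

text \<open>The fusion rule.  The part of the window beyond the wall \<open>0\<close> cancels against its mirror
  image, and so does the part beyond the wall \<open>p\<close>.  As \<open>l < p\<close>, the two cancelled parts are
  disjoint, and what is left lies in the alcove.\<close>

lemma alcove_positive_window_sum:
  assumes F: "alcove_positive p c F" and l: "int l < p"
  shows "alcove_positive p (c + int l) (window_sum l F)"
proof -
  have anti: "F (c - x) = - F x" and per: "F (x + p) = F x"
    and pos: "0 \<le> c - 2 * x \<Longrightarrow> c - 2 * x \<le> p \<Longrightarrow> 0 \<le> F x" for x
    using F by (auto simp: alcove_positive_def)
  have anti': "F (c - p - x) = - F x" for x
    using per[of "c - p - x"] anti[of x] by simp
  show ?thesis
    unfolding alcove_positive_def
  proof (intro conjI allI impI)
    fix x
    have "window_sum l F (c + int l - x) = (\<Sum>y\<in>{x - int l..x}. F (c - y))"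
      unfolding window_sum_def
      by (rule sum.reindex_bij_witness[of _ "\<lambda>y. c - y" "\<lambda>y. c - y"]) auto
    then show "window_sum l F (c + int l - x) = - window_sum l F x"
      by (simp add: anti sum_negf window_sum_def)
  next
    fix x
    show "window_sum l F (x + p) = window_sum l F x"
      unfolding window_sum_def
      by (rule sum.reindex_bij_witness[of _ "\<lambda>y. y + p" "\<lambda>y. y - p"])
         (use per[of "_ - p"] per in \<open>auto simp: algebra_simps\<close>)
  next
    fix x assume k: "0 \<le> c + int l - 2 * x" "c + int l - 2 * x \<le> p"
    \<comment> \<open>\<open>{A..B}\<close> is the part of the window that survives the cancellation.\<close>
    define B where "B = (if c - 2 * x < 0 then c - x - 1 else x)"
    define A where "A = (if c - 2 * (x - int l) > p then c - p - x + int l + 1 else x - int l)"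
    have "(\<Sum>y\<in>{x - int l..x}. F y) = (\<Sum>y\<in>{x - int l..B}. F y)"
    proof (cases "c - 2 * x < 0")
      case True
      then show ?thesis
        using sum_int_split[of "x - int l" "c - x - 1" x F] k
          sum_antisymmetric[of F c "c - x" x] anti by (simp add: B_def)
    qed (simp add: B_def)
    also have "\<dots> = (\<Sum>y\<in>{A..B}. F y)"
    proof (cases "c - 2 * (x - int l) > p")
      case True
      then have "c - p - (x - int l) \<le> B" using k l by (auto simp: B_def)
      then show ?thesis
        using sum_int_split[of "x - int l" "c - p - (x - int l)" B F] True
          sum_antisymmetric[of F "c - p" "x - int l" "c - p - (x - int l)"] anti'
        by (simp add: A_def algebra_simps)
    qed (simp add: A_def)
    also have "\<dots> \<ge> 0"
    proof (intro sum_nonneg pos)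
      fix y assume y: "y \<in> {A..B}"
      show "0 \<le> c - 2 * y" using y by (auto simp: B_def split: if_splits)
      show "c - 2 * y \<le> p" using y by (auto simp: A_def split: if_splits)
    qed
    finally show "0 \<le> window_sum l F x" by (simp add: window_sum_def)
  qed
qed

lemma alcove_positive_foldr:
  assumes "alcove_positive p c F" and "\<And>i. i \<in> set xs \<Longrightarrow> int (l i) < p"
  shows "alcove_positive p (c + (\<Sum>i\<leftarrow>xs. int (l i))) (foldr (\<lambda>i. window_sum (l i)) xs F)"
  using assms(2)
proof (induction xs)
  case (Cons i xs)
  have "alcove_positive p (c + (\<Sum>i\<leftarrow>xs. int (l i)) + int (l i))
      (window_sum (l i) (foldr (\<lambda>i. window_sum (l i)) xs F))"
    by (rule alcove_positive_window_sum) (use Cons in auto)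
  then show ?case by (simp add: algebra_simps)
qed (use assms(1) in simp)

definition multiples :: "int \<Rightarrow> int \<Rightarrow> int" where
  "multiples p x = of_bool (p dvd x)"

lemma alcove_positive_multiples:
  assumes "p > 1"
  shows "alcove_positive p 1 (back_diff 1 (multiples p))"
  unfolding alcove_positive_def
proof (intro conjI allI impI)
  fix x
  have "p dvd 1 - x \<longleftrightarrow> p dvd x - 1" "p dvd - x \<longleftrightarrow> p dvd x"
    using dvd_minus_iff[of p "x - 1"] by auto
  then show "back_diff 1 (multiples p) (1 - x) = - back_diff 1 (multiples p) x"
    by (simp add: back_diff_def multiples_def)
  have "p dvd x + p - 1 \<longleftrightarrow> p dvd x - 1"
    using dvd_add_left_iff[of p p "x - 1"] by (simp add: algebra_simps)
  then show "back_diff 1 (multiples p) (x + p) = back_diff 1 (multiples p) x"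
    by (simp add: back_diff_def multiples_def)
next
  fix x assume x: "0 \<le> 1 - 2 * x" "1 - 2 * x \<le> p"
  have "\<not> p dvd 1 - x"
    using x assms by (intro zdvd_not_zless) auto
  then have "\<not> p dvd x - 1"
    using dvd_minus_iff[of p "x - 1"] by auto
  then show "0 \<le> back_diff 1 (multiples p) x" by (simp add: back_diff_def multiples_def)
qed

text \<open>The window misses one place of a full period, over which the sequence sums to zero: fusion with
  the weight of the level is a translation.\<close>

lemma window_sum_multiples:
  assumes "p = int l + 2"
  shows "window_sum l (\<lambda>x. s * back_diff 1 (multiples p) (x + r)) =
     (\<lambda>x. - s * back_diff 1 (multiples p) (x + r + 1))"
proof
  fix x
  have "window_sum l (\<lambda>x. s * back_diff 1 (multiples p) (x + r)) x =
      s * window_sum l (\<lambda>x. back_diff 1 (multiples p) (x - (- r))) x"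
    by (simp add: window_sum_def sum_distrib_left)
  also have "\<dots> = s * back_diff (Suc l) (multiples p) (x + r)"
    by (simp only: window_sum_shift window_sum_back_diff) simp
  also have "\<dots> = - s * back_diff 1 (multiples p) (x + r + 1)"
  proof -
    have "x + r - int (Suc l) = (x + r + 1) - p" using assms by simp
    then have "p dvd x + r - int (Suc l) \<longleftrightarrow> p dvd x + r + 1"
      by (metis dvd_diff dvd_refl dvd_diff_commute diff_add_cancel dvd_add)
    then show ?thesis by (simp add: back_diff_def multiples_def)
  qed
  finally show "window_sum l (\<lambda>x. s * back_diff 1 (multiples p) (x + r)) x =
      - s * back_diff 1 (multiples p) (x + r + 1)" .
qed

lemma foldr_window_sum_multiples:
  assumes "p = int l + 2"
  shows "foldr (\<lambda>i. window_sum l) xs (back_diff 1 (multiples p)) =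
    (\<lambda>x. (-1) ^ length xs * back_diff 1 (multiples p) (x + int (length xs)))"
proof (induction xs)
  case (Cons i xs)
  then show ?case
    by (simp add: window_sum_multiples[OF assms] algebra_simps)
qed simp

subsection \<open>Binomial coefficients\<close>

lemma ibinom_diff: "ibinom (int (Suc n) + x) (Suc n) - ibinom (int (Suc n) + (x - 1)) (Suc n) = ibinom (int n + x) n"
proof -
  consider "x < 0" | "x = 0" | k where "x = int (Suc k)"
    by (metis int_cases negative_zless not0_implies_Suc of_nat_0)
  then show ?thesis
  proof cases
    case 3
    have "nat (int (Suc n) + x) = Suc (Suc n + k)" "nat (int (Suc n) + (x - 1)) = Suc n + k"
      "nat (int n + x) = Suc n + k" using 3 by auto
    then show ?thesis using 3 by (simp add: ibinom_def)
  next
    case 2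
    have "nat (1 + int n) = Suc n" by simp
    then show ?thesis using 2 by (simp add: ibinom_def)
  qed (simp add: ibinom_def)
qed

lemma back_diff_funpow_ibinom:
  "(back_diff 1 ^^ Suc n) (\<lambda>x. ibinom (int n + x) n) = (\<lambda>x. of_bool (x = 0))"
proof (induction n)
  case 0
  show ?case by (auto simp: back_diff_def ibinom_def fun_eq_iff)
next
  case (Suc n)
  have "back_diff 1 (\<lambda>x. ibinom (int (Suc n) + x) (Suc n)) = (\<lambda>x. ibinom (int n + x) n)"
    by (rule ext) (simp only: back_diff_def of_nat_1 ibinom_diff)
  then show ?case using Suc by (simp only: funpow_Suc_right[of "Suc n"] o_def)
qed

text \<open>The translates by \<open>-T - 1, \<dots>, T\<close> times \<open>p\<close> suffice for the periodic sequence near the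
  origin.  The asymmetry of this range is the one that the reflection of the sum over
  \<open>\<tau> \<ge> 0\<close> produces.\<close>

lemma sum_shifted_delta:
  assumes p: "p \<ge> 1" and x: "- int T \<le> x" "x \<le> int T"
  shows "(\<Sum>\<tau>\<in>{- int T - 1..int T}. back_diff 1 (\<lambda>x. of_bool (x = 0)) (x - \<tau> * p)) =
    back_diff 1 (multiples p) x"
proof -
  have m: "(\<Sum>\<tau>\<in>{- int T - 1..int T}. of_bool (y - \<tau> * p = 0)) = multiples p y"
    if y: "- int T - 1 \<le> y" "y \<le> int T" for y
  proof (cases "p dvd y")
    case True
    then obtain k where k: "y = p * k" by blast
    have "- int T - 1 \<le> k"
    proof (rule ccontr)
      assume "\<not> ?thesis"
      then have "k < - int T - 1" by simp
      moreover from this have "p * k \<le> 1 * k" using p by (intro mult_right_mono_neg) auto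
      ultimately show False using y k by simp
    qed
    moreover have "k \<le> int T"
    proof (rule ccontr)
      assume "\<not> ?thesis"
      moreover from this have "1 * k \<le> p * k" using p by (intro mult_right_mono) auto
      ultimately show False using y k by simp
    qed
    moreover have "y - \<tau> * p = 0 \<longleftrightarrow> \<tau> = k" for \<tau> using k p by (auto simp: mult.commute)
    ultimately show ?thesis using True by (simp add: multiples_def of_bool_def sum.delta)
  next
    case False
    then show ?thesis by (auto simp: multiples_def intro!: sum.neutral)
  qed
  have "(\<Sum>\<tau>\<in>{- int T - 1..int T}. back_diff 1 (\<lambda>x. of_bool (x = 0)) (x - \<tau> * p)) =
    (\<Sum>\<tau>\<in>{- int T - 1..int T}. of_bool (x - \<tau> * p = 0)) -
    (\<Sum>\<tau>\<in>{- int T - 1..int T}. of_bool ((x - 1) - \<tau> * p = 0))"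
    by (simp only: back_diff_def of_nat_1 sum_subtractf Groups.diff_right_commute[of x 1])
  also have "\<dots> = back_diff 1 (multiples p) x"
    using x by (simp only: m back_diff_def of_nat_1)
  finally show ?thesis .
qed

subsection \<open>The fusion formula\<close>

lemma ibinom_neg: "x < 0 \<Longrightarrow> ibinom (int n + x) n = 0"
  by (simp add: ibinom_def)

text \<open>The sum extends over all \<open>I\<close> and all \<open>\<tau> \<le> T\<close>, because each additional term has an upper
  argument less than \<open>n\<close>: \<open>\<Sum>\<^sub>I (l\<^sub>i + 1) + \<tau> p \<ge> |I| (a + 1) + \<tau> (a + 2) > d\<close> as soon as
  \<open>|I| + 2 \<tau> > 2 t\<close>.\<close>

lemma slvdim_inclusion_exclusion:
  assumes n: "n = 2 * t" and d: "d = a * (t + 1)"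
    and m: "\<And>i. i \<in> {1..n + 3} \<Longrightarrow> m i \<le> a * t"
    and p: "p = int d + 2 - kC n d m" "p \<ge> int a + 2" and T: "T \<ge> t"
  shows "slvdim n d m = (\<Sum>\<tau>\<le>T. \<Sum>I\<in>Pow {1..n + 3}.
    (-1) ^ card I * ibinom (int n + (int d - int \<tau> * p - (\<Sum>i\<in>I. int (Suc (d - m i))))) n)"
proof -
  let ?b = "\<lambda>I \<tau>. int d - int \<tau> * p - (\<Sum>i\<in>I. int (Suc (d - m i)))"
  let ?S = "{(I, \<tau>). I \<subseteq> {1..n + 3} \<and> \<tau> \<le> n div 2 + n mod 2 \<and> int (card I) \<le> int n - 2 * int \<tau>}"
  have d': "d = a * t + a" using d by (simp add: distrib_left)
  have md: "m i \<le> d" if "i \<in> {1..n + 3}" for i using m[OF that] d' by simp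
  have b: "int n + k_sec n d m I \<tau> - r_sec I \<tau> - 1 = int n + ?b I \<tau>" if I: "I \<subseteq> {1..n + 3}" for I \<tau>
  proof -
    have "(\<Sum>i\<in>I. int (Suc (d - m i))) = (\<Sum>i\<in>I. int d + 1 - int (m i))"
      by (intro sum.cong refl) (use I md in \<open>force simp: of_nat_diff\<close>)
    also have "\<dots> = int (card I) * (int d + 1) - (\<Sum>i\<in>I. int (m i))"
      by (simp add: sum_subtractf)
    finally have s: "(\<Sum>i\<in>I. int (Suc (d - m i))) = int (card I) * (int d + 1) - (\<Sum>i\<in>I. int (m i))" .
    have k: "kC n d m = int d + 2 - p" using p by simp
    show ?thesis unfolding s k_sec_def r_sec_def k by (simp add: algebra_simps)
  qed
  have neg: "?b I \<tau> < 0" if I: "I \<subseteq> {1..n + 3}" and out: "(I, \<tau>) \<notin> ?S" for I \<tau>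
  proof -
    have fin: "finite I" using I finite_subset by blast
    have big: "2 * t + 1 \<le> card I + 2 * \<tau>" using I out n by auto
    have "(\<Sum>i\<in>I. int (Suc (d - m i))) \<ge> (\<Sum>i\<in>I. int a + 1)"
    proof (rule sum_mono)
      fix i assume "i \<in> I"
      then have "m i + a \<le> d" using m[of i] I d' by auto
      then show "int a + 1 \<le> int (Suc (d - m i))" by simp
    qed
    then have s: "(\<Sum>i\<in>I. int (Suc (d - m i))) \<ge> int (card I) * (int a + 1)" by simp
    have t: "int \<tau> * p \<ge> int \<tau> * (int a + 2)" using p by (intro mult_left_mono) auto
    have "2 * int d < 2 * (int (card I) * (int a + 1) + int \<tau> * (int a + 2))"
    proof (cases "card I = 0")
      case True
      then have "int \<tau> \<ge> int t + 1" using big by linarith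
      then have "(int t + 1) * (int a + 2) \<le> int \<tau> * (int a + 2)" by (intro mult_right_mono) auto
      then show ?thesis using True d by (simp add: algebra_simps)
    next
      case False
      then have "1 * int a \<le> int (card I) * int a" by (intro mult_right_mono) auto
      moreover have "(2 * int t + 1) * (int a + 2) \<le> (int (card I) + 2 * int \<tau>) * (int a + 2)"
        using big by (intro mult_right_mono) auto
      ultimately show ?thesis using d by (simp add: algebra_simps)
    qed
    then have "int d < int (card I) * (int a + 1) + int \<tau> * (int a + 2)" by simp
    also have "\<dots> \<le> (\<Sum>i\<in>I. int (Suc (d - m i))) + int \<tau> * p"
      using s t by (rule add_mono)
    finally have "int d < (\<Sum>i\<in>I. int (Suc (d - m i))) + int \<tau> * p" .
    moreover have "x - z - y < 0" if "x < y + z" for x y z :: int using that by simp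
    ultimately show ?thesis by blast
  qed
  have "slvdim n d m = (\<Sum>(I, \<tau>)\<in>?S. (-1) ^ card I * ibinom (int n + ?b I \<tau>) n)"
    unfolding slvdim_def by (intro sum.cong refl) (auto simp only: b mem_Collect_eq prod.case)
  also have "\<dots> = (\<Sum>(I, \<tau>)\<in>Pow {1..n + 3} \<times> {..T}. (-1) ^ card I * ibinom (int n + ?b I \<tau>) n)"
  proof (rule sum.mono_neutral_left)
    show "?S \<subseteq> Pow {1..n + 3} \<times> {..T}" using n T by auto
    show "\<forall>x\<in>Pow {1..n + 3} \<times> {..T} - ?S.
        (case x of (I, \<tau>) \<Rightarrow> (-1) ^ card I * ibinom (int n + ?b I \<tau>) n) = 0"
    proof
      fix x assume "x \<in> Pow {1..n + 3} \<times> {..T} - ?S"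
      then obtain I \<tau> where x: "x = (I, \<tau>)" and I: "I \<subseteq> {1..n + 3}" "(I, \<tau>) \<notin> ?S" by blast
      show "(case x of (I, \<tau>) \<Rightarrow> (-1) ^ card I * ibinom (int n + ?b I \<tau>) n) = 0"
        using ibinom_neg[OF neg[OF I], of n] x by (simp only: prod.case mult_zero_right)
    qed
  qed simp
  also have "\<dots> = (\<Sum>\<tau>\<le>T. \<Sum>I\<in>Pow {1..n + 3}. (-1) ^ card I * ibinom (int n + ?b I \<tau>) n)"
    by (subst sum.swap) (simp add: sum.cartesian_product)
  finally show ?thesis .
qed

lemma foldr_window_sum_antisymmetric:
  assumes "\<And>x. F (c - x) = - F x"
  shows "foldr (\<lambda>i. window_sum (l i)) xs F (c + (\<Sum>i\<leftarrow>xs. int (l i)) - x) =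
     - foldr (\<lambda>i. window_sum (l i)) xs F x"
proof (induction xs arbitrary: x)
  case (Cons i xs)
  let ?G = "foldr (\<lambda>i. window_sum (l i)) xs F" and ?c = "c + (\<Sum>i\<leftarrow>xs. int (l i))"
  have "window_sum (l i) ?G (?c + int (l i) - x) = (\<Sum>y\<in>{x - int (l i)..x}. ?G (?c - y))"
    unfolding window_sum_def
    by (rule sum.reindex_bij_witness[of _ "\<lambda>y. ?c - y" "\<lambda>y. ?c - y"]) auto
  also have "\<dots> = - window_sum (l i) ?G x"
    unfolding window_sum_def[of "l i"] by (simp only: Cons.IH sum_negf)
  finally show ?case by (simp add: algebra_simps)
qed (use assms in simp)

text \<open>The sequence \<open>W\<close> of the tensor product is antisymmetric, and \<open>1 + \<Lambda> = 2 d - 1 + p\<close>.  So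
  \<open>- W (d - \<tau> p - 1) = W (d + (\<tau> + 1) p)\<close>, and the differences of \<open>W\<close> in the sum over
  \<open>\<tau> \<ge> 0\<close> are its values at all translates of \<open>d\<close>.\<close>

lemma slvdim_eq_fusion:
  assumes n: "n = 2 * t" and d: "d = a * (t + 1)"
    and m: "\<And>i. i \<in> {1..n + 3} \<Longrightarrow> m i \<le> a * t"
    and p: "p = int d + 2 - kC n d m" "p \<ge> int a + 2"
  shows "slvdim n d m =
    foldr (\<lambda>i. window_sum (d - m i)) [1..<n + 4] (back_diff 1 (multiples p)) (int d)"
proof -
  define l where "l = (\<lambda>i. d - m i)"
  define xs where "xs = [1..<n + 4]"
  define \<Lambda> where "\<Lambda> = (\<Sum>i\<leftarrow>xs. int (l i))"
  \<comment> \<open>large enough for all places that the windows reach from \<open>d\<close>\<close>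
  define T where "T = t + d + nat \<Lambda>"
  define \<delta> where "\<delta> = back_diff 1 (\<lambda>x. of_bool (x = 0))"
  define W where "W = foldr (\<lambda>i. window_sum (l i)) xs \<delta>"
  have set_xs: "set xs = {1..n + 3}" and len: "length xs = Suc (Suc (Suc n))" by (auto simp: xs_def)
  have \<Lambda>0: "\<Lambda> \<ge> 0" unfolding \<Lambda>_def by (rule sum_list_nonneg) auto
  have \<Lambda>: "\<Lambda> = 2 * int d - 2 + p"
  proof -
    have "\<Lambda> = (\<Sum>i\<in>{1..n + 3}. int (l i))"
      unfolding \<Lambda>_def by (subst sum_list_distinct_conv_sum_set) (simp_all add: set_xs, simp add: xs_def)
    also have "\<dots> = (\<Sum>i\<in>{1..n + 3}. int d - int (m i))"
    proof (intro sum.cong refl)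
      fix i assume "i \<in> {1..n + 3}"
      then have "m i \<le> d" using m[of i] d by (simp add: distrib_left)
      then show "int (l i) = int d - int (m i)" by (simp add: l_def of_nat_diff)
    qed
    also have "\<dots> = int (n + 3) * int d - (\<Sum>i\<in>{1..n + 3}. int (m i))"
      by (simp add: sum_subtractf)
    finally show ?thesis using p by (simp add: kC_def algebra_simps)
  qed
  have full: "(\<Sum>I\<in>Pow {1..n + 3}. (-1) ^ card I * ibinom (int n + (x - (\<Sum>i\<in>I. int (Suc (l i))))) n) =
      W x - W (x - 1)" for x
  proof -
    have "(\<Sum>I\<in>Pow {1..n + 3}. (-1) ^ card I * ibinom (int n + (x - (\<Sum>i\<in>I. int (Suc (l i))))) n) =
        foldr (\<lambda>i. back_diff (Suc (l i))) xs (\<lambda>x. ibinom (int n + x) n) x"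
      using foldr_back_diff_inclusion_exclusion[of xs "\<lambda>x. ibinom (int n + x) n" x "\<lambda>i. Suc (l i)"]
      by (simp only: set_xs) (simp add: xs_def)
    also have "\<dots> = foldr (\<lambda>i. window_sum (l i)) xs (back_diff 1 \<delta>) x"
      unfolding foldr_back_diff len \<delta>_def
      using back_diff_funpow_ibinom[of n] by simp
    also have "\<dots> = back_diff 1 W x"
      unfolding W_def by (rule fun_cong, induction xs) (auto simp: back_diff_window_sum)
    finally show ?thesis by (simp add: back_diff_def)
  qed
  have anti: "W (1 + \<Lambda> - x) = - W x" for x
    unfolding W_def \<Lambda>_def
    by (rule foldr_window_sum_antisymmetric) (auto simp: \<delta>_def back_diff_def)
  have "slvdim n d m = (\<Sum>\<tau>\<le>T. W (int d - int \<tau> * p) - W (int d - int \<tau> * p - 1))"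
    using slvdim_inclusion_exclusion[OF n d m p, of T] full by (simp add: T_def l_def)
  also have "\<dots> = (\<Sum>\<tau>\<le>T. W (int d - int \<tau> * p) + W (int d - (- int \<tau> - 1) * p))"
  proof (intro sum.cong refl)
    fix \<tau>
    have "1 + \<Lambda> - (int d - int \<tau> * p - 1) = int d - (- int \<tau> - 1) * p"
      by (simp add: \<Lambda> algebra_simps)
    then show "W (int d - int \<tau> * p) - W (int d - int \<tau> * p - 1) =
        W (int d - int \<tau> * p) + W (int d - (- int \<tau> - 1) * p)"
      using anti[of "int d - int \<tau> * p - 1"] by (simp only: diff_conv_add_uminus minus_minus)
  qed
  also have "\<dots> = (\<Sum>\<tau>\<in>{0..int T}. W (int d - \<tau> * p)) + (\<Sum>\<tau>\<in>{- int T - 1..- 1}. W (int d - \<tau> * p))"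
  proof -
    have "(\<Sum>\<tau>\<le>T. W (int d - int \<tau> * p)) = (\<Sum>\<tau>\<in>{0..int T}. W (int d - \<tau> * p))"
      by (rule sum.reindex_bij_witness[of _ nat int]) auto
    moreover have "(\<Sum>\<tau>\<le>T. W (int d - (- int \<tau> - 1) * p)) = (\<Sum>\<tau>\<in>{- int T - 1..- 1}. W (int d - \<tau> * p))"
      by (rule sum.reindex_bij_witness[of _ "\<lambda>x. nat (- x - 1)" "\<lambda>\<tau>. - int \<tau> - 1"]) auto
    ultimately show ?thesis by (simp add: sum.distrib)
  qed
  also have "\<dots> = (\<Sum>\<tau>\<in>{- int T - 1..int T}. W (int d - \<tau> * p))"
    using sum_int_split[of "- int T - 1" "-1" "int T" "\<lambda>\<tau>. W (int d - \<tau> * p)"] by simp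
  also have "\<dots> = foldr (\<lambda>i. window_sum (l i)) xs
      (\<lambda>x. \<Sum>\<tau>\<in>{- int T - 1..int T}. \<delta> (x - \<tau> * p)) (int d)"
    unfolding W_def by (subst foldr_window_sum_shifts) (rule refl)
  also have "\<dots> = foldr (\<lambda>i. window_sum (l i)) xs (back_diff 1 (multiples p)) (int d)"
  proof (rule foldr_window_sum_cong)
    fix y assume "int d - (\<Sum>i\<leftarrow>xs. int (l i)) \<le> y" "y \<le> int d"
    then have "- int T \<le> y" "y \<le> int T" using \<Lambda>0 by (auto simp: T_def \<Lambda>_def[symmetric])
    then show "(\<Sum>\<tau>\<in>{- int T - 1..int T}. \<delta> (y - \<tau> * p)) = back_diff 1 (multiples p) y"
      unfolding \<delta>_def using p by (intro sum_shifted_delta) auto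
  qed
  finally show ?thesis by (simp add: l_def xs_def)
qed

text \<open>The other multiplicities contribute at most \<open>(n + 2) a t = n d\<close> to \<open>k\<^sub>C + n d\<close>.  Hence no highest
  weight exceeds the level.\<close>

lemma kC_bound:
  assumes n: "n = 2 * t" and d: "d = a * (t + 1)"
    and m: "\<And>i. i \<in> {1..n + 3} \<Longrightarrow> m i \<le> a * t" and j: "j \<in> {1..n + 3}"
  shows "int d - int (m j) \<le> int d - kC n d m"
proof -
  have "(\<Sum>i\<in>{1..n + 3} - {j}. int (m i)) \<le> (\<Sum>i\<in>{1..n + 3} - {j}. int (a * t))"
  proof (rule sum_mono)
    fix i assume "i \<in> {1..n + 3} - {j}"
    then have "m i \<le> a * t" by (intro m) simp
    then show "int (m i) \<le> int (a * t)" by (simp only: of_nat_le_iff)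
  qed
  also have "\<dots> = int (n + 2) * int (a * t)" using j by (simp add: card_Diff_singleton)
  finally have "(\<Sum>i\<in>{1..n + 3}. int (m i)) \<le> int (m j) + int (n + 2) * int (a * t)"
    using j by (subst sum.remove[of _ j]) auto
  then show ?thesis using n d by (simp add: kC_def algebra_simps)
qed

text \<open>The place \<open>d\<close> has weight \<open>p - 1\<close> in the fusion product, so it lies in the alcove.\<close>

lemma slvdim_nonneg:
  assumes n: "n = 2 * t" and d: "d = a * (t + 1)" and a: "a \<ge> 1"
    and m: "\<And>i. i \<in> {1..n + 3} \<Longrightarrow> m i \<le> a * t"
  shows "slvdim n d m \<ge> 0"
proof -
  define p where "p = int d + 2 - kC n d m"
  have l: "int (d - m i) + 2 \<le> p" if "i \<in> {1..n + 3}" for i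
  proof -
    have "m i \<le> d" using m[OF that] d by (simp add: distrib_left)
    then show ?thesis using kC_bound[of n t d a m i] n d m that by (simp add: p_def of_nat_diff)
  qed
  have "a \<le> d - m 1" using m[of 1] d by (simp add: distrib_left)
  then have p: "p \<ge> int a + 2" using l[of 1] by auto
  define \<Lambda> where "\<Lambda> = (\<Sum>i\<leftarrow>[1..<n + 4]. int (d - m i))"
  have "\<Lambda> = (\<Sum>i\<in>{1..n + 3}. int (d - m i))"
    unfolding \<Lambda>_def by (subst sum_list_distinct_conv_sum_set) (auto intro!: sum.cong)
  also have "\<dots> = (\<Sum>i\<in>{1..n + 3}. int d - int (m i))"
  proof (intro sum.cong refl)
    fix i assume "i \<in> {1..n + 3}"
    then have "m i \<le> d" using m[of i] d by (simp add: distrib_left)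
    then show "int (d - m i) = int d - int (m i)" by (simp add: of_nat_diff)
  qed
  also have "\<dots> = int (n + 3) * int d - (\<Sum>i\<in>{1..n + 3}. int (m i))"
    by (simp add: sum_subtractf)
  finally have \<Lambda>: "1 + \<Lambda> - 2 * int d = p - 1" by (simp add: p_def kC_def algebra_simps)
  have "alcove_positive p (1 + \<Lambda>)
      (foldr (\<lambda>i. window_sum (d - m i)) [1..<n + 4] (back_diff 1 (multiples p)))"
    unfolding \<Lambda>_def
  proof (rule alcove_positive_foldr)
    show "alcove_positive p 1 (back_diff 1 (multiples p))"
      using p a by (intro alcove_positive_multiples) auto
    fix i assume "i \<in> set [1..<n + 4]"
    then show "int (d - m i) < p" using l[of i] by auto
  qed
  then have "0 \<le> foldr (\<lambda>i. window_sum (d - m i)) [1..<n + 4] (back_diff 1 (multiples p)) (int d)"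
    using \<Lambda> p a by (auto simp: alcove_positive_def)
  then show ?thesis
    using slvdim_eq_fusion[OF n d m p_def p] by simp
qed

text \<open>Here all weights equal the level \<open>a\<close>; each of the \<open>2 t + 3\<close> factors translates by one place and
  changes the sign.\<close>

lemma slvdim_secant:
  assumes "a \<ge> 1"
  shows "slvdim (2 * t) (a * (t + 1)) (\<lambda>_. a * t) = 1"
proof -
  let ?d = "a * (t + 1)" and ?p = "int a + 2"
  have p: "?p = int ?d + 2 - kC (2 * t) ?d (\<lambda>_. a * t)" by (simp add: kC_def algebra_simps)
  have "slvdim (2 * t) ?d (\<lambda>_. a * t) =
      foldr (\<lambda>i. window_sum (?d - a * t)) [1..<2 * t + 4] (back_diff 1 (multiples ?p)) (int ?d)"
    by (rule slvdim_eq_fusion[OF refl refl _ p]) auto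
  also have "?d - a * t = a" by (simp add: distrib_left)
  also have "foldr (\<lambda>i. window_sum a) [1..<2 * t + 4] (back_diff 1 (multiples ?p)) (int ?d) =
      - back_diff 1 (multiples ?p) (int ?d + int (2 * t + 3))"
  proof -
    have len: "length [1..<2 * t + 4] = 2 * t + 3" and sgn: "(-1 :: int) ^ (2 * t + 3) = -1"
      by (simp_all add: power_add)
    show ?thesis unfolding foldr_window_sum_multiples[OF refl] len sgn by (simp only: mult_minus_left mult_1)
  qed
  also have "\<dots> = 1"
  proof -
    have e: "int ?d + int (2 * t + 3) = ?p * (int t + 1) + 1" by (simp add: algebra_simps)
    have "\<not> ?p dvd ?p * (int t + 1) + 1"
    proof
      assume "?p dvd ?p * (int t + 1) + 1"
      then have "?p dvd 1" by (metis dvd_add_right_iff dvd_triv_left)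
      then show False using assms by simp
    qed
    then show ?thesis unfolding e by (simp add: back_diff_def multiples_def)
  qed
  finally show ?thesis .
qed

section \<open>The Hankel determinant of a rational normal curve\<close>

interpretation peval_hom: comm_ring_hom "\<lambda>f. peval f x" for x
  by unfold_locales (simp_all add: peval_add peval_mult)

lemma poly_sum_monom:
  fixes c :: "nat \<Rightarrow> complex"
  shows "poly (\<Sum>j\<le>n. monom (c j) j) z = (\<Sum>j\<le>n. c j * z ^ j)"
  by (simp add: poly_sum poly_monom)

text \<open>A determinant whose rows in \<open>R\<close> vanish at \<open>x\<close> is a sum of products, each with \<open>card R\<close>
  factors that vanish at \<open>x\<close>.\<close>

lemma mult_at_least_det:
  fixes A :: "'N::finite cpoly Matrix.mat"
  assumes A: "A \<in> carrier_mat m m" and R: "R \<subseteq> {0..<m}"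
    and 0: "\<And>i j. i \<in> R \<Longrightarrow> j < m \<Longrightarrow> peval (A $$ (i, j)) x = 0"
  shows "mult_at_least (card R) (Determinant.det A) x"
  unfolding det_def'[OF A]
proof (rule mult_at_least_sum)
  fix \<pi> assume "\<pi> \<in> {\<pi>. \<pi> permutes {0..<m}}"
  then have \<pi>: "\<pi> i < m" if "i \<in> {0..<m}" for i
    using that permutes_in_image[of \<pi> "{0..<m}" i] by auto
  have "mult_at_least (card R) (\<Prod>i\<in>R. A $$ (i, \<pi> i)) x"
    using R \<pi> 0 by (intro mult_at_least_prod) auto
  moreover have "(\<Prod>i = 0..<m. A $$ (i, \<pi> i)) =
      (\<Prod>i\<in>{0..<m} - R. A $$ (i, \<pi> i)) * (\<Prod>i\<in>R. A $$ (i, \<pi> i))"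
    using R by (intro prod.subset_diff) auto
  ultimately have "mult_at_least (0 + card R) (\<Prod>i = 0..<m. A $$ (i, \<pi> i)) x"
    using mult_at_least_mult[OF mult_at_least_0] by simp
  then have "mult_at_least (0 + (0 + card R)) (signof \<pi> * (\<Prod>i = 0..<m. A $$ (i, \<pi> i))) x"
    by (intro mult_at_least_mult mult_at_least_0)
  then show "mult_at_least (card R) (signof \<pi> * (\<Prod>i = 0..<m. A $$ (i, \<pi> i))) x" by simp
qed

lemma homogeneous_det:
  fixes A :: "'N::finite cpoly Matrix.mat"
  assumes A: "A \<in> carrier_mat m m" and h: "\<And>i j. i < m \<Longrightarrow> j < m \<Longrightarrow> homogeneous 1 (A $$ (i, j))"
  shows "homogeneous m (Determinant.det A)"
  unfolding det_def'[OF A]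
proof (rule homogeneous_sum)
  fix \<pi> assume "\<pi> \<in> {\<pi>. \<pi> permutes {0..<m}}"
  then have \<pi>: "\<pi> i < m" if "i \<in> {0..<m}" for i
    using that permutes_in_image[of \<pi> "{0..<m}" i] by auto
  have "homogeneous (card {0..<m}) (\<Prod>i = 0..<m. A $$ (i, \<pi> i))"
    using \<pi> h by (intro homogeneous_prod) auto
  moreover have "homogeneous 0 (signof \<pi> :: 'N cpoly)"
    using homogeneous_diff[OF homogeneous_zero homogeneous_one] by (cases "sign \<pi> = 1") (auto simp: homogeneous_one sign_def)
  ultimately show "homogeneous m (signof \<pi> * (\<Prod>i = 0..<m. A $$ (i, \<pi> i)))"
    using homogeneous_mult[of 0 "signof \<pi>" m "\<Prod>i = 0..<m. A $$ (i, \<pi> i)"] by simp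
qed

text \<open>A basis \<open>w\<close> determines the rational normal curve that is in standard position with respect to
  it.\<close>

locale rnc_coordinates =
  fixes w :: "nat \<Rightarrow> complex ^ 'N::finite" and t :: nat
  assumes t: "t \<ge> 1" and card_N: "CARD('N) = 2 * t + 1"
    and inj_w: "inj_on w {0..2 * t}" and indep_w: "vec.independent (w ` {0..2 * t})"
begin

lemma span_w: "vec.span (w ` {0..2 * t}) = UNIV"
proof -
  have "UNIV \<subseteq> vec.span (w ` {0..2 * t})"
    by (rule vec.card_ge_dim_independent) (use indep_w inj_w in \<open>auto simp: card_cart_basis card_N card_image\<close>)
  then show ?thesis by auto
qed

definition coord :: "nat \<Rightarrow> complex ^ 'N \<Rightarrow> complex" where
  "coord j y = vec.representation (w ` {0..2 * t}) y (w j)"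

lemma coord_add: "coord j (x + y) = coord j x + coord j y"
  unfolding coord_def by (subst vec.representation_add) (use indep_w span_w in auto)

lemma coord_scale: "coord j (c *s x) = c * coord j x"
  unfolding coord_def by (subst vec.representation_scale) (use indep_w span_w in auto)

lemma coord_zero [simp]: "coord j 0 = 0"
  using coord_scale[of j 0 0] by simp

lemma coord_sum: "coord j (sum f A) = (\<Sum>a\<in>A. coord j (f a))"
  by (induction A rule: infinite_finite_induct) (auto simp: coord_add)

lemma coord_w: "i \<le> 2 * t \<Longrightarrow> j \<le> 2 * t \<Longrightarrow> coord j (w i) = of_bool (i = j)"
  unfolding coord_def
  by (subst vec.representation_basis) (use indep_w inj_w in \<open>auto dest: inj_onD\<close>)

definition coord_form :: "nat \<Rightarrow> 'N cpoly" where
  "coord_form j = (\<Sum>i\<in>UNIV. Poly_Mapping.single (Poly_Mapping.single i 1) (coord j (axis i 1)))"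

lemma peval_coord_form: "peval (coord_form j) y = coord j y"
proof -
  have m: "monomial_value (Poly_Mapping.single i 1) y = y $ i" for i
  proof -
    have "monomial_value (Poly_Mapping.single i 1) y = (\<Prod>k\<in>UNIV. if k = i then y $ i else 1)"
      unfolding monomial_value_def by (intro prod.cong refl) (auto simp: lookup_single when_def)
    then show ?thesis by simp
  qed
  have "y = (\<Sum>i\<in>UNIV. y $ i *s axis i 1)"
    by (simp add: basis_expansion)
  then have "coord j y = coord j (\<Sum>i\<in>UNIV. y $ i *s axis i 1)" by (rule arg_cong)
  also have "\<dots> = (\<Sum>i\<in>UNIV. y $ i * coord j (axis i 1))" by (simp only: coord_sum coord_scale)
  finally show ?thesis by (simp add: coord_form_def peval_sum peval_single m mult.commute)
qed

lemma homogeneous_coord_form: "homogeneous 1 (coord_form j)"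
proof -
  have "(\<Sum>k\<in>UNIV. expo (Poly_Mapping.single i (1::nat)) k) = 1" for i :: 'N
    by (simp add: lookup_single when_def)
  then show ?thesis unfolding coord_form_def by (intro homogeneous_sum homogeneous_single) auto
qed

text \<open>The catalecticant matrix.  It has rank one on the curve, hence rank at most \<open>t\<close> on the spans of
  \<open>t\<close> points of the curve.\<close>

definition hankel :: "'N cpoly Matrix.mat" where
  "hankel = Matrix.mat (Suc t) (Suc t) (\<lambda>(i, j). coord_form (i + j))"

definition hankel_det :: "'N cpoly" where
  "hankel_det = Determinant.det hankel"

lemma hankel_carrier: "hankel \<in> carrier_mat (Suc t) (Suc t)"
  by (simp add: hankel_def)

lemma homogeneous_hankel_det: "homogeneous (t + 1) hankel_det"
  unfolding hankel_det_def Suc_eq_plus1[symmetric]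
  by (rule homogeneous_det[OF hankel_carrier]) (simp add: hankel_def homogeneous_coord_form)

definition curve_vec :: "complex \<Rightarrow> complex \<Rightarrow> complex ^ 'N" where
  "curve_vec s u = (\<Sum>j = 0..2 * t. (s ^ (2 * t - j) * u ^ j) *s w j)"

abbreviation veronese :: "complex \<Rightarrow> complex ^ 'N" where
  "veronese \<equiv> curve_vec 1"

lemma coord_curve_vec: "j \<le> 2 * t \<Longrightarrow> coord j (curve_vec s u) = s ^ (2 * t - j) * u ^ j"
  by (simp add: curve_vec_def coord_sum coord_scale coord_w sum.delta of_bool_def if_distrib cong: if_cong)

lemma curve_vec_scale: "curve_vec (c * s) (c * u) = c ^ (2 * t) *s curve_vec s u"
proof -
  have "((c * s) ^ (2 * t - j) * (c * u) ^ j) = c ^ (2 * t) * (s ^ (2 * t - j) * u ^ j)" if "j \<in> {0..2 * t}" for j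
    using that by (simp add: power_mult_distrib flip: power_add)
  then show ?thesis by (simp add: curve_vec_def vec.scale_sum_right)
qed

lemma curve_vec_eq_veronese: "s \<noteq> 0 \<Longrightarrow> curve_vec s u = s ^ (2 * t) *s veronese (u / s)"
  using curve_vec_scale[of s 1 "u / s"] by simp

lemma curve_vec_at_infinity: "curve_vec 0 u = u ^ (2 * t) *s w (2 * t)"
proof -
  have "curve_vec 0 u = (\<Sum>j = 0..2 * t. if j = 2 * t then u ^ (2 * t) *s w (2 * t) else 0)"
    unfolding curve_vec_def by (intro sum.cong refl) (auto simp: power_0_left)
  then show ?thesis by simp
qed

text \<open>At the point with parameter \<open>z\<close> each row of the Hankel matrix is \<open>z\<close> times the previous one.
  Subtracting this multiple, from the last row upwards, makes \<open>t\<close> rows vanish at that point.\<close>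

lemma mult_hankel_det_veronese: "mult_at_least t hankel_det (veronese z)"
proof -
  let ?n = "Suc t"
  define P :: "'N cpoly Matrix.mat" where
    "P = Matrix.mat ?n ?n (\<lambda>(i, k). if k = i then 1 else if Suc k = i then Poly_Mapping.single 0 (- z) else 0)"
  have P: "P \<in> carrier_mat ?n ?n" by (simp add: P_def)
  have "Determinant.det P = prod_list (diag_mat P)"
    by (rule det_lower_triangular[OF _ P]) (auto simp: P_def)
  also have "diag_mat P = replicate ?n 1"
    by (rule nth_equalityI) (auto simp: diag_mat_def P_def simp del: upt_Suc replicate_Suc)
  finally have "Determinant.det P = 1" by simp
  then have d: "hankel_det = Determinant.det (P * hankel)"
    using det_mult[OF P hankel_carrier] by (simp add: hankel_det_def)
  have "mult_at_least (card {1..t}) (Determinant.det (P * hankel)) (veronese z)"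
  proof (rule mult_at_least_det[of _ ?n])
    show "P * hankel \<in> carrier_mat ?n ?n" using P hankel_carrier by (rule mult_carrier_mat)
    show "{1..t} \<subseteq> {0..<?n}" by auto
    fix i j assume i: "i \<in> {1..t}" and j: "j < ?n"
    then obtain k where k: "i = Suc k" by (cases i) auto
    have "(P * hankel) $$ (i, j) = (\<Sum>l = 0..<?n. P $$ (i, l) * hankel $$ (l, j))"
      using i j P hankel_carrier by (simp add: index_mult_mat scalar_prod_def)
    also have "\<dots> = (\<Sum>l\<in>{k, Suc k}. P $$ (i, l) * hankel $$ (l, j))"
      by (rule sum.mono_neutral_right) (use i k in \<open>auto simp: P_def\<close>)
    also have "\<dots> = Poly_Mapping.single 0 (- z) * coord_form (k + j) + coord_form (Suc (k + j))"
      using i j k by (simp add: P_def hankel_def)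
    finally show "peval ((P * hankel) $$ (i, j)) (veronese z) = 0"
      using i j k by (simp add: peval_add peval_mult peval_const peval_coord_form coord_curve_vec)
  qed
  then show ?thesis using d by simp
qed

lemma mult_hankel_det_at_infinity: "mult_at_least t hankel_det (w (2 * t))"
proof -
  have "mult_at_least (card {0..<t}) (Determinant.det hankel) (w (2 * t))"
    by (rule mult_at_least_det[OF hankel_carrier])
       (auto simp: hankel_def peval_coord_form coord_w)
  then show ?thesis by (simp add: hankel_det_def)
qed

lemma mult_hankel_det_curve_vec: "mult_at_least t hankel_det (curve_vec s u)"
proof (cases "s = 0")
  case True
  then show ?thesis
    using mult_at_least_scale[OF homogeneous_hankel_det mult_hankel_det_at_infinity, of "u ^ (2 * t)"]
    by (simp add: curve_vec_at_infinity)
next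
  case False
  then show ?thesis
    using mult_at_least_scale[OF homogeneous_hankel_det mult_hankel_det_veronese, of "s ^ (2 * t)" "u / s"]
      curve_vec_eq_veronese[OF False, of u] by simp
qed

text \<open>At a sum of \<open>t + 1\<close> points of the curve a kernel vector of the Hankel matrix is a polynomial
  \<open>q\<close> of degree at most \<open>t\<close> that is orthogonal to all such polynomials for a weighted evaluation
  at these points.  Testing with the polynomials that vanish at all points but one shows that \<open>q\<close>
  vanishes at all of them, so \<open>q = 0\<close>.  At infinity the value of \<open>q\<close> is its coefficient of degree
  \<open>t\<close>.\<close>

lemma hankel_det_nonzero:
  assumes Z: "finite Z" "\<And>z. z \<in> Z \<Longrightarrow> \<kappa> z \<noteq> 0"
    and b: "card Z = t + 1 \<and> b = 0 \<or> card Z = t \<and> b \<noteq> 0"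
  shows "peval hankel_det ((\<Sum>z\<in>Z. \<kappa> z *s veronese z) + b *s w (2 * t)) \<noteq> 0"
proof
  let ?n = "Suc t" and ?y = "(\<Sum>z\<in>Z. \<kappa> z *s veronese z) + b *s w (2 * t)"
  let ?M = "map_mat (\<lambda>f. peval f ?y) hankel"
  assume "peval hankel_det ?y = 0"
  then have "Determinant.det ?M = 0" by (simp add: hankel_det_def)
  moreover have M: "?M \<in> carrier_mat ?n ?n" using hankel_carrier by simp
  ultimately obtain v where v: "v \<in> carrier_vec ?n" "v \<noteq> 0\<^sub>v ?n" "?M *\<^sub>v v = 0\<^sub>v ?n"
    using det_0_iff_vec_prod_zero[OF M] by blast
  define c where "c = Matrix.vec_index v"
  define q where "q = (\<Sum>j\<le>t. monom (c j) j)"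
  have deg_q: "degree q \<le> t" unfolding q_def
    by (rule degree_sum_le) (auto intro: order.trans[OF degree_monom_le])
  have coeff_q: "coeff q j = (if j \<le> t then c j else 0)" for j
    by (simp add: q_def coeff_sum if_distrib cong: if_cong)
  have coord_y: "coord j ?y = (\<Sum>z\<in>Z. \<kappa> z * z ^ j) + b * of_bool (j = 2 * t)" if "j \<le> 2 * t" for j
    using that by (auto simp: coord_add coord_sum coord_scale coord_curve_vec coord_w)
  have row: "(\<Sum>z\<in>Z. \<kappa> z * z ^ i * poly q z) + b * of_bool (i = t) * coeff q t = 0" if i: "i \<le> t" for i
  proof -
    have "Matrix.vec_index (?M *\<^sub>v v) i = (\<Sum>j\<le>t. coord (i + j) ?y * c j)"
      using i v(1) hankel_carrier
      by (simp add: hankel_def scalar_prod_def c_def peval_coord_form atLeast0LessThan lessThan_Suc_atMost)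
    then have "0 = (\<Sum>j\<le>t. coord (i + j) ?y * c j)" using v(3) i by simp
    also have "\<dots> = (\<Sum>j\<le>t. (\<Sum>z\<in>Z. \<kappa> z * z ^ i * (c j * z ^ j)) + (if j = t then b * of_bool (i = t) * c t else 0))"
    proof (intro sum.cong refl)
      fix j assume "j \<in> {..t}"
      then have e: "coord (i + j) ?y = (\<Sum>z\<in>Z. \<kappa> z * z ^ (i + j)) + (if j = t then b * of_bool (i = t) else 0)"
        using i by (subst coord_y) auto
      have A: "(\<Sum>z\<in>Z. \<kappa> z * z ^ (i + j)) * c j = (\<Sum>z\<in>Z. \<kappa> z * z ^ i * (c j * z ^ j))"
        unfolding sum_distrib_right by (simp add: power_add mult_ac)
      show "coord (i + j) ?y * c j =
          (\<Sum>z\<in>Z. \<kappa> z * z ^ i * (c j * z ^ j)) + (if j = t then b * of_bool (i = t) * c t else 0)"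
        unfolding e distrib_right A by simp
    qed
    also have "\<dots> = (\<Sum>z\<in>Z. \<kappa> z * z ^ i * poly q z) + b * of_bool (i = t) * c t"
      by (simp add: sum.distrib q_def poly_sum_monom sum_distrib_left sum.swap[of _ Z])
    finally show ?thesis by (simp add: coeff_q)
  qed
  have orth: "(\<Sum>z\<in>Z. \<kappa> z * poly r z * poly q z) + b * coeff r t * coeff q t = 0" if r: "degree r \<le> t" for r
  proof -
    have "poly r z = (\<Sum>i\<le>t. coeff r i * z ^ i)" for z
      using r by (subst poly_altdef) (auto intro!: sum.mono_neutral_left intro: le_degree)
    then have "(\<Sum>z\<in>Z. \<kappa> z * poly r z * poly q z) =
        (\<Sum>i\<le>t. coeff r i * (\<Sum>z\<in>Z. \<kappa> z * z ^ i * poly q z))"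
      by (simp add: sum_distrib_left sum_distrib_right sum.swap[of _ Z] mult_ac)
    moreover have "b * coeff r t * coeff q t = (\<Sum>i\<le>t. coeff r i * (b * of_bool (i = t) * coeff q t))"
    proof -
      have "(\<Sum>i\<le>t. coeff r i * (b * of_bool (i = t) * coeff q t)) =
          (\<Sum>i\<le>t. if i = t then b * coeff r t * coeff q t else 0)"
        by (intro sum.cong refl) auto
      then show ?thesis by simp
    qed
    ultimately have "(\<Sum>z\<in>Z. \<kappa> z * poly r z * poly q z) + b * coeff r t * coeff q t =
        (\<Sum>i\<le>t. coeff r i * ((\<Sum>z\<in>Z. \<kappa> z * z ^ i * poly q z) + b * of_bool (i = t) * coeff q t))"
      by (simp only: distrib_left sum.distrib)
    also have "\<dots> = 0" by (intro sum.neutral) (simp add: row)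
    finally show ?thesis .
  qed
  have lead: "b * coeff q t = 0"
  proof (cases "b = 0")
    case False
    then have "card Z = t" using b by simp
    let ?r = "\<Prod>z\<in>Z. [:- z, 1:]"
    have "degree ?r = t" using \<open>card Z = t\<close> by (simp add: degree_prod_sum_eq)
    moreover have "lead_coeff ?r = 1" by (simp add: lead_coeff_prod)
    moreover have "(\<Sum>z\<in>Z. \<kappa> z * poly ?r z * poly q z) = 0"
      using Z(1) by (intro sum.neutral) (auto simp: poly_prod)
    ultimately show ?thesis using orth[of ?r] by simp
  qed simp
  have zero: "poly q z = 0" if z: "z \<in> Z" for z
  proof -
    let ?r = "\<Prod>x\<in>Z - {z}. [:- x, 1:]"
    have "degree ?r = card Z - 1" using z Z(1) by (simp add: degree_prod_sum_eq)
    then have "degree ?r \<le> t" using b by auto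
    moreover have "b * coeff ?r t * coeff q t = 0" using lead by auto
    ultimately have "(\<Sum>x\<in>Z. \<kappa> x * poly ?r x * poly q x) = 0"
      using orth[of ?r] by (simp only: add_0_right)
    moreover have "(\<Sum>x\<in>Z - {z}. \<kappa> x * poly ?r x * poly q x) = 0"
      using Z(1) by (intro sum.neutral) (auto simp: poly_prod)
    ultimately have "\<kappa> z * poly ?r z * poly q z = 0"
      using sum.remove[OF Z(1) z, of "\<lambda>x. \<kappa> x * poly ?r x * poly q x"] by (simp only: add_0_right)
    moreover have "poly ?r z \<noteq> 0" using Z(1) by (simp add: poly_prod)
    ultimately show ?thesis using Z(2)[OF z] by simp
  qed
  have "q = 0"
  proof (rule poly_eq_0_if_many_roots[OF Z(1)])
    show "[:- s, 1:] ^ 1 dvd q" if "s \<in> Z" for s using zero[OF that] by (simp add: poly_eq_0_iff_dvd)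
    show "degree q < (\<Sum>s\<in>Z. 1)"
    proof (cases "b = 0")
      case True
      then show ?thesis using b deg_q by simp
    next
      case False
      then have "coeff q t = 0" "card Z = t" using lead b by auto
      then have "degree q < t" using deg_q t
        by (metis degree_0 leading_coeff_0_iff le_neq_implies_less not_one_le_zero zero_less_iff_neq_zero)
      then show ?thesis using \<open>card Z = t\<close> by simp
    qed
  qed
  then have "c j = 0" if "j \<le> t" for j using coeff_q[of j] that by simp
  then have "v = 0\<^sub>v ?n" using v(1) by (intro eq_vecI) (auto simp: c_def)
  then show False using v(2) by simp
qed

section \<open>Polynomial parametrisations of the curve\<close>

definition param :: "complex poly \<Rightarrow> complex poly \<Rightarrow> 'N \<Rightarrow> complex poly" where
  "param P Q i = (\<Sum>j = 0..2 * t. smult (w j $ i) (P ^ (2 * t - j) * Q ^ j))"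

lemma curve_point_param: "curve_point (param P Q) z = curve_vec (poly P z) (poly Q z)"
  by (simp add: curve_point_def param_def curve_vec_def Finite_Cartesian_Product.vec_eq_iff poly_sum mult.commute)

lemma degree_param:
  assumes "degree P \<le> 1" "degree Q \<le> 1"
  shows "degree (param P Q i) \<le> 2 * t"
  unfolding param_def
proof (rule degree_sum_le)
  fix j assume j: "j \<in> {0..2 * t}"
  have "degree (P ^ (2 * t - j) * Q ^ j) \<le> degree (P ^ (2 * t - j)) + degree (Q ^ j)"
    by (rule degree_mult_le)
  also have "\<dots> \<le> 1 * (2 * t - j) + 1 * j"
    by (intro add_mono order.trans[OF degree_power_le] mult_right_mono assms) auto
  also have "\<dots> = 2 * t" using j by simp
  finally show "degree (smult (w j $ i) (P ^ (2 * t - j) * Q ^ j)) \<le> 2 * t"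
    by (rule order.trans[OF degree_smult_le])
qed simp

lemma inj_veronese: "inj veronese"
proof (rule injI)
  fix x y assume "veronese x = veronese y"
  then have "coord 1 (veronese x) = coord 1 (veronese y)" by simp
  then show "x = y" using t by (simp add: coord_curve_vec)
qed

text \<open>For \<open>r\<close> of degree at most \<open>2 t\<close>, the functional whose restriction to the curve is \<open>r\<close>.\<close>

definition pairing :: "complex poly \<Rightarrow> complex ^ 'N \<Rightarrow> complex" where
  "pairing r y = (\<Sum>j\<le>2 * t. coeff r j * coord j y)"

lemma pairing_veronese:
  assumes "degree r \<le> 2 * t"
  shows "pairing r (veronese z) = poly r z"
proof -
  have "poly r z = (\<Sum>i\<le>2 * t. coeff r i * z ^ i)"
    using assms by (subst poly_altdef) (auto intro!: sum.mono_neutral_left intro: le_degree)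
  then show ?thesis by (simp add: pairing_def coord_curve_vec)
qed

text \<open>The polynomials that vanish at all parameters but one give a dual family of functionals.\<close>

lemma independent_veronese:
  assumes Z: "finite Z" "card Z \<le> 2 * t + 1"
  shows "vec.independent (veronese ` Z)"
proof
  assume "vec.dependent (veronese ` Z)"
  then obtain f y where y: "y \<in> veronese ` Z" "f y \<noteq> 0" and 0: "(\<Sum>v\<in>veronese ` Z. f v *s v) = 0"
    using Z(1) by (auto simp: vec.dependent_finite)
  from y obtain z where z: "z \<in> Z" "f (veronese z) \<noteq> 0" by auto
  let ?r = "\<Prod>x\<in>Z - {z}. [:- x, 1:]"
  have r: "degree ?r \<le> 2 * t" using z Z by (simp add: degree_prod_sum_eq)
  have "0 = pairing ?r (\<Sum>x\<in>Z. f (veronese x) *s veronese x)"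
  proof -
    have "inj_on veronese Z" using inj_veronese by (rule inj_on_subset) simp
    then have "(\<Sum>x\<in>Z. f (veronese x) *s veronese x) = 0"
      using 0 by (simp only: sum.reindex o_def)
    then show ?thesis by (simp add: pairing_def)
  qed
  also have "\<dots> = (\<Sum>x\<in>Z. f (veronese x) * pairing ?r (veronese x))"
    by (simp add: pairing_def coord_sum coord_scale sum_distrib_left sum.swap[of _ Z] mult_ac)
  also have "\<dots> = (\<Sum>x\<in>Z. f (veronese x) * poly ?r x)"
    by (simp only: pairing_veronese[OF r])
  also have "\<dots> = f (veronese z) * poly ?r z + (\<Sum>x\<in>Z - {z}. f (veronese x) * poly ?r x)"
    using z Z by (intro sum.remove) auto
  also have "(\<Sum>x\<in>Z - {z}. f (veronese x) * poly ?r x) = 0"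
    using Z(1) by (intro sum.neutral) (auto simp: poly_prod)
  finally have "poly ?r z = 0" using z by simp
  then show False using Z(1) by (simp add: poly_prod)
qed

lemma span_veronese_cofinite:
  assumes "finite S"
  shows "vec.span (veronese ` (- S)) = UNIV"
proof -
  have "infinite (- S)" using assms infinite_UNIV_char_0 by (metis Compl_eq_Diff_UNIV finite_Diff2)
  then obtain Z where Z: "finite Z" "card Z = 2 * t + 1" "Z \<subseteq> - S"
    using infinite_arbitrarily_large[of "- S" "2 * t + 1"] by blast
  have "UNIV \<subseteq> vec.span (veronese ` Z)"
    by (rule vec.card_ge_dim_independent)
       (use Z independent_veronese in \<open>auto simp: card_cart_basis card_N card_image inj_on_subset[OF inj_veronese]\<close>)
  also have "\<dots> \<subseteq> vec.span (veronese ` (- S))" using Z(3) by (intro vec.span_mono) auto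
  finally show ?thesis by auto
qed

end

section \<open>Lines that meet the secant variety in many points\<close>

lemma sum_scale_axis:
  fixes c :: "'N::finite \<Rightarrow> complex"
  shows "(\<Sum>j\<in>UNIV. c j *s axis j 1) = (\<chi> j. c j)"
  using basis_expansion[of "\<chi> j. c j"] by simp

lemma has_derivative_scale_curve_point:
  fixes \<gamma> :: "'N::finite \<Rightarrow> complex poly" and f x :: "'b::real_normed_vector \<Rightarrow> complex"
  assumes f: "(f has_derivative f') (at p)" and x: "(x has_derivative x') (at p)"
  shows "((\<lambda>h. f h *s curve_point \<gamma> (x h)) has_derivative
    (\<lambda>h. f' h *s curve_point \<gamma> (x p) + (f p * x' h) *s tangent \<gamma> (x p))) (at p)"
proof -
  have lin: "bounded_linear (\<lambda>c::complex. c *s a)" for a :: "complex ^ 'N"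
    by (subst linear_conv_bounded_linear[symmetric], rule linearI)
       (simp_all add: Finite_Cartesian_Product.vec_eq_iff algebra_simps)
  have pol: "((\<lambda>h. poly (\<gamma> j) (x h)) has_derivative (\<lambda>h. poly (pderiv (\<gamma> j)) (x p) * x' h)) (at p)" for j
    by (rule has_derivative_compose[OF x]) (use poly_DERIV[of "\<gamma> j" "x p"] in \<open>simp add: has_field_derivative_def\<close>)
  have "((\<lambda>h. \<Sum>j\<in>UNIV. (f h * poly (\<gamma> j) (x h)) *s axis j 1) has_derivative
    (\<lambda>h. \<Sum>j\<in>UNIV. (f p * (poly (pderiv (\<gamma> j)) (x p) * x' h) + f' h * poly (\<gamma> j) (x p)) *s axis j 1)) (at p)"
    by (intro has_derivative_sum bounded_linear.has_derivative[OF lin] has_derivative_mult f pol)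
  moreover have "(\<lambda>h. \<Sum>j\<in>UNIV. (f h * poly (\<gamma> j) (x h)) *s axis j 1) = (\<lambda>h. f h *s curve_point \<gamma> (x h))"
    unfolding sum_scale_axis by (simp add: fun_eq_iff Finite_Cartesian_Product.vec_eq_iff curve_point_def)
  moreover have "(\<lambda>h. \<Sum>j\<in>UNIV. (f p * (poly (pderiv (\<gamma> j)) (x p) * x' h) + f' h * poly (\<gamma> j) (x p)) *s axis j 1) =
      (\<lambda>h. f' h *s curve_point \<gamma> (x p) + (f p * x' h) *s tangent \<gamma> (x p))"
    unfolding sum_scale_axis
    by (simp add: fun_eq_iff Finite_Cartesian_Product.vec_eq_iff curve_point_def tangent_def algebra_simps)
  ultimately show ?thesis by simp
qed

text \<open>A vector \<open>a\<close> orthogonal to \<open>V\<close> gives a real functional that vanishes on \<open>V\<close>.  On a complex line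
  inside \<open>V\<close> the complex functional with this real part vanishes as well.\<close>

lemma proper_subspace_annihilator:
  fixes V :: "(complex ^ 'N::finite) set"
  assumes V: "subspace V" "V \<noteq> UNIV"
  shows "\<exists>a. a \<noteq> 0 \<and> (\<forall>y. (\<forall>c. c *s y \<in> V) \<longrightarrow> (\<Sum>j\<in>UNIV. cnj (a $ j) * y $ j) = 0)"
proof -
  have "span V \<noteq> UNIV" using V by (simp add: span_eq_iff[THEN iffD2])
  from span_not_UNIV_orthogonal[OF this] obtain a where a: "a \<noteq> 0" "\<And>x. x \<in> span V \<Longrightarrow> a \<bullet> x = 0" by blast
  have inner: "a \<bullet> y = Re (\<Sum>j\<in>UNIV. cnj (a $ j) * y $ j)" for y
    by (simp add: inner_vec_def inner_complex_def)
  have "(\<Sum>j\<in>UNIV. cnj (a $ j) * y $ j) = 0" if y: "\<forall>c. c *s y \<in> V" for y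
  proof -
    let ?\<phi> = "\<Sum>j\<in>UNIV. cnj (a $ j) * y $ j"
    have "a \<bullet> (cnj ?\<phi> *s y) = 0" using a(2) y span_base by blast
    moreover have "(\<Sum>j\<in>UNIV. cnj (a $ j) * (cnj ?\<phi> *s y) $ j) = cnj ?\<phi> * ?\<phi>"
      by (simp add: sum_distrib_left mult_ac)
    ultimately have "Re (cnj ?\<phi> * ?\<phi>) = 0" by (simp only: inner)
    moreover have "Re (cnj z * z) = 0 \<longleftrightarrow> z = 0" for z
      by (simp add: complex_eq_iff sum_power2_eq_zero_iff flip: power2_eq_square)
    ultimately show ?thesis by (simp only:)
  qed
  with a(1) show ?thesis by blast
qed

context rnc_coordinates
begin

abbreviation veronese_polys :: "'N \<Rightarrow> complex poly" where
  "veronese_polys \<equiv> param 1 [:0, 1:]"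

lemma curve_point_veronese_polys: "curve_point veronese_polys z = veronese z"
  by (simp add: curve_point_param)

lemma degree_veronese_polys: "degree (veronese_polys i) \<le> 2 * t"
  by (rule degree_param) auto

text \<open>Hermite interpolation: a functional that vanishes at a point of the curve and, together with
  its derivative, at \<open>t\<close> further points is a polynomial of degree at most \<open>2 t\<close> with
  \<open>2 t + 1\<close> zeros.\<close>

lemma hermite_annihilator:
  fixes \<xi> :: "complex ^ 'N"
  assumes J: "card J = t + 1" "k \<in> J" and inj: "inj_on (\<lambda>i. \<xi> $ i) J"
    and v: "\<And>i. i \<in> J \<Longrightarrow> (\<Sum>j\<in>UNIV. a $ j * veronese (\<xi> $ i) $ j) = 0"
    and d: "\<And>i. i \<in> J - {k} \<Longrightarrow> (\<Sum>j\<in>UNIV. a $ j * tangent veronese_polys (\<xi> $ i) $ j) = 0"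
  shows "(\<Sum>j\<in>UNIV. a $ j * y $ j) = 0"
proof -
  have fin: "finite J" using J by (simp add: card_ge_0_finite)
  define P where "P = (\<Sum>j\<in>UNIV. smult (a $ j) (veronese_polys j))"
  have P: "poly P z = (\<Sum>j\<in>UNIV. a $ j * veronese z $ j)" for z
    by (simp add: P_def poly_sum curve_point_def flip: curve_point_veronese_polys)
  have "pderiv P = (\<Sum>j\<in>UNIV. smult (a $ j) (pderiv (veronese_polys j)))"
  proof -
    have "pderiv (sum F A) = (\<Sum>j\<in>A. pderiv (F j))" for F :: "'N \<Rightarrow> complex poly" and A
      by (induction A rule: infinite_finite_induct) (auto simp: pderiv_add)
    then show ?thesis by (simp add: P_def pderiv_smult)
  qed
  then have P': "poly (pderiv P) z = (\<Sum>j\<in>UNIV. a $ j * tangent veronese_polys z $ j)" for z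
    by (simp add: poly_sum tangent_def curve_point_def)
  let ?e = "\<lambda>s. if s = \<xi> $ k then 1 else 2"
  have "P = 0"
  proof (rule poly_eq_0_if_many_roots)
    show "finite ((\<lambda>i. \<xi> $ i) ` J)" using fin by simp
    fix s assume "s \<in> (\<lambda>i. \<xi> $ i) ` J"
    then obtain i where i: "i \<in> J" "s = \<xi> $ i" by blast
    have 0: "poly P s = 0" using v[OF i(1)] i by (simp add: P)
    show "[:- s, 1:] ^ ?e s dvd P"
    proof (cases "s = \<xi> $ k")
      case False
      then have "poly (pderiv P) s = 0" using d[of i] i by (auto simp: P')
      then have "[:- s, 1:] ^ 1 dvd pderiv P" by (simp add: poly_eq_0_iff_dvd)
      from linear_power_Suc_dvd[OF 0 this] show ?thesis using False by (simp add: numeral_2_eq_2 One_nat_def)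
    qed (use 0 in \<open>simp add: poly_eq_0_iff_dvd\<close>)
  next
    have "degree P \<le> 2 * t" unfolding P_def
      by (rule degree_sum_le) (auto intro!: order.trans[OF degree_smult_le] degree_veronese_polys)
    also have "\<dots> < (\<Sum>i\<in>J. if i = k then 1 else 2)"
    proof -
      have "(\<Sum>i\<in>J. if i = k then 1 else 2 :: nat) = 1 + (\<Sum>i\<in>J - {k}. if i = k then 1 else 2)"
        using fin J(2) by (simp add: sum.remove)
      also have "(\<Sum>i\<in>J - {k}. if i = k then 1 else 2 :: nat) = (\<Sum>i\<in>J - {k}. 2)"
        by (intro sum.cong refl) auto
      finally show ?thesis using J fin by simp
    qed
    also have "(\<Sum>i\<in>J. if i = k then 1 else 2) = (\<Sum>i\<in>J. ?e (\<xi> $ i))"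
      using inj J(2) by (intro sum.cong refl) (auto dest: inj_onD)
    also have "\<dots> = (\<Sum>s\<in>(\<lambda>i. \<xi> $ i) ` J. ?e s)"
      by (simp only: sum.reindex[OF inj] o_def)
    finally show "degree P < (\<Sum>s\<in>(\<lambda>i. \<xi> $ i) ` J. ?e s)" .
  qed
  then have 0: "(\<Sum>j\<in>UNIV. a $ j * veronese z $ j) = 0" for z using P[of z] by simp
  have "y \<in> vec.span (veronese ` (- {}))" using span_veronese_cofinite[of "{}"] by simp
  then show ?thesis
  proof (induction y rule: vec.span_induct)
    show "vec.subspace {y. (\<Sum>j\<in>UNIV. a $ j * y $ j) = 0}"
    proof -
      have "(\<Sum>j\<in>UNIV. a $ j * (c *s x) $ j) = c * (\<Sum>j\<in>UNIV. a $ j * x $ j)" for c x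
        by (simp add: sum_distrib_left mult_ac)
      then show ?thesis by (auto simp: vec.subspace_def distrib_left sum.distrib simp del: vector_smult_component)
    qed
  qed (use 0 in auto)
qed

text \<open>The arguments are coefficients \<open>\<lambda>\<close>, curve parameters \<open>x\<close> and a line parameter \<open>s\<close>.  The value
  \<open>y = \<Sum> \<lambda>\<^sub>i c(x\<^sub>i) - s v\<close> is a point whose parallel to \<open>v\<close> meets the span of the \<open>c(x\<^sub>i)\<close> at the
  parameter \<open>s\<close>.  Families of all sizes share one domain, a normed space, and use the components in \<open>I\<close>.\<close>

definition secant_family :: "'N set \<Rightarrow> complex ^ 'N \<Rightarrow> (complex ^ 'N) \<times> (complex ^ 'N) \<times> complex \<Rightarrow> complex ^ 'N" where
  "secant_family I v h = (\<Sum>i\<in>I. fst h $ i *s veronese (fst (snd h) $ i)) - snd (snd h) *s v"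

definition secant_family_deriv ::
  "'N set \<Rightarrow> complex ^ 'N \<Rightarrow> complex ^ 'N \<Rightarrow> complex ^ 'N \<Rightarrow>
    (complex ^ 'N) \<times> (complex ^ 'N) \<times> complex \<Rightarrow> complex ^ 'N" where
  "secant_family_deriv I v l x h =
     (\<Sum>i\<in>I. fst h $ i *s veronese (x $ i) + (l $ i * fst (snd h) $ i) *s tangent veronese_polys (x $ i)) -
     snd (snd h) *s v"

lemma secant_family_has_derivative:
  "(secant_family I v has_derivative secant_family_deriv I v l x) (at (l, x, s))"
proof -
  have 1: "((\<lambda>h. fst h $ i) has_derivative (\<lambda>h. fst h $ i)) (at p)"
    and 2: "((\<lambda>h. fst (snd h) $ i) has_derivative (\<lambda>h. fst (snd h) $ i)) (at p)" 
    and 3: "((\<lambda>h. snd (snd h)) has_derivative (\<lambda>h. snd (snd h))) (at p)"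
    for i and p :: "(complex ^ 'N) \<times> (complex ^ 'N) \<times> complex"
    by (intro bounded_linear_imp_has_derivative
        bounded_linear_compose[OF bounded_linear_vec_nth] bounded_linear_compose[OF bounded_linear_fst]
        bounded_linear_compose[OF bounded_linear_snd] bounded_linear_fst bounded_linear_snd)+
  have 4: "((\<lambda>h. snd (snd h) *s v) has_derivative (\<lambda>h. snd (snd h) *s v)) (at p)"
    for p :: "(complex ^ 'N) \<times> (complex ^ 'N) \<times> complex"
    using has_derivative_scale_curve_point[OF 3[of p] has_derivative_const[of 0], of "\<lambda>i. [:v $ i:]"]
    by (simp add: curve_point_def)
  have "((\<lambda>h. (\<Sum>i\<in>I. fst h $ i *s curve_point veronese_polys (fst (snd h) $ i)) - snd (snd h) *s v) has_derivative
     (\<lambda>h. (\<Sum>i\<in>I. fst h $ i *s curve_point veronese_polys (fst (snd (l, x, s)) $ i) +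
         (fst (l, x, s) $ i * fst (snd h) $ i) *s tangent veronese_polys (fst (snd (l, x, s)) $ i)) -
       snd (snd h) *s v)) (at (l, x, s))"
    by (intro has_derivative_diff has_derivative_sum has_derivative_scale_curve_point 1 2 4)
  then show ?thesis
    by (simp add: curve_point_veronese_polys secant_family_def[abs_def] secant_family_deriv_def[abs_def])
qed

text \<open>The directions \<open>c(\<xi>\<^sub>i)\<close> and \<open>c'(\<xi>\<^sub>i)\<close> with \<open>i \<noteq> k\<close> and \<open>v\<close> are in the range.  Modulo the others
  \<open>v\<close> is \<open>c(\<xi>\<^sub>k)\<close>, so a functional that vanishes on the range is excluded by Hermite
  interpolation.\<close>

lemma secant_family_deriv_surj:
  fixes \<xi> :: "complex ^ 'N"
  assumes J: "card J = t + 1" "k \<in> J" and inj: "inj_on (\<lambda>i. \<xi> $ i) J"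
    and l: "\<And>i. i \<in> J - {k} \<Longrightarrow> l $ i \<noteq> 0"
  defines "v \<equiv> \<Sum>i\<in>J. veronese (\<xi> $ i)"
  shows "range (secant_family_deriv (J - {k}) v l \<xi>) = UNIV"
proof (rule ccontr)
  let ?D = "secant_family_deriv (J - {k}) v l \<xi>"
  assume "range ?D \<noteq> UNIV"
  moreover have "linear ?D"
    using secant_family_has_derivative[of "J - {k}" v l \<xi> 0] by (blast intro: has_derivative_linear)
  then have "subspace (range ?D)" using linear_subspace_image subspace_UNIV by blast
  ultimately obtain b where b: "b \<noteq> 0"
    "\<And>y. (\<forall>c. c *s y \<in> range ?D) \<Longrightarrow> (\<Sum>j\<in>UNIV. cnj (b $ j) * y $ j) = 0"
    using proper_subspace_annihilator by blast
  define a where "a = (\<chi> j. cnj (b $ j))"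
  have a: "(\<Sum>j\<in>UNIV. a $ j * y $ j) = 0" if "\<And>c. c *s y \<in> range ?D" for y
    using b(2)[of y] that by (simp add: a_def)
  have fin: "finite J" using J by (simp add: card_ge_0_finite)
  have single: "(\<Sum>n\<in>J - {k}. (if n = i then c else 0) *s f n) = c *s f i" if "i \<in> J - {k}" for i c and f :: "'N \<Rightarrow> complex ^ 'N"
  proof -
    have "(\<Sum>n\<in>J - {k}. (if n = i then c else 0) *s f n) = (\<Sum>n\<in>J - {k}. if n = i then c *s f i else 0)"
      by (intro sum.cong refl) auto
    then show ?thesis using that fin by simp
  qed
  have ver: "(\<Sum>j\<in>UNIV. a $ j * veronese (\<xi> $ i) $ j) = 0" if i: "i \<in> J - {k}" for i
  proof (rule a)
    fix c
    have "?D (\<chi> n. if n = i then c else 0, 0, 0) = c *s veronese (\<xi> $ i)"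
      using single[OF i, of c "\<lambda>n. veronese (\<xi> $ n)"] by (simp add: secant_family_deriv_def)
    then show "c *s veronese (\<xi> $ i) \<in> range ?D" by (metis rangeI)
  qed
  have tan: "(\<Sum>j\<in>UNIV. a $ j * tangent veronese_polys (\<xi> $ i) $ j) = 0" if i: "i \<in> J - {k}" for i
  proof (rule a)
    fix c
    have "(\<Sum>n\<in>J - {k}. (l $ n * (if n = i then c / l $ i else 0)) *s tangent veronese_polys (\<xi> $ n)) =
        (\<Sum>n\<in>J - {k}. (if n = i then c else 0) *s tangent veronese_polys (\<xi> $ n))"
      using l[OF i] by (intro sum.cong refl) auto
    then have "?D (0, \<chi> n. if n = i then c / l $ i else 0, 0) = c *s tangent veronese_polys (\<xi> $ i)"
      using single[OF i, of c "\<lambda>n. tangent veronese_polys (\<xi> $ n)"] by (simp add: secant_family_deriv_def)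
    then show "c *s tangent veronese_polys (\<xi> $ i) \<in> range ?D" by (metis rangeI)
  qed
  have "(\<Sum>j\<in>UNIV. a $ j * v $ j) = 0"
  proof (rule a)
    fix c
    have "?D (0, 0, - c) = c *s v" by (simp add: secant_family_deriv_def)
    then show "c *s v \<in> range ?D" by (metis rangeI)
  qed
  also have "(\<Sum>j\<in>UNIV. a $ j * v $ j) = (\<Sum>i\<in>J. \<Sum>j\<in>UNIV. a $ j * veronese (\<xi> $ i) $ j)"
    by (simp add: v_def sum_distrib_left sum.swap[of _ J])
  also have "\<dots> = (\<Sum>j\<in>UNIV. a $ j * veronese (\<xi> $ k) $ j) +
      (\<Sum>i\<in>J - {k}. \<Sum>j\<in>UNIV. a $ j * veronese (\<xi> $ i) $ j)"
    using fin J(2) by (rule sum.remove)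
  also have "(\<Sum>i\<in>J - {k}. \<Sum>j\<in>UNIV. a $ j * veronese (\<xi> $ i) $ j) = 0"
    using ver by (intro sum.neutral) auto
  finally have k: "(\<Sum>j\<in>UNIV. a $ j * veronese (\<xi> $ k) $ j) = 0" by simp
  have "(\<Sum>j\<in>UNIV. a $ j * y $ j) = 0" for y
  proof (rule hermite_annihilator[OF J inj])
    show "(\<Sum>j\<in>UNIV. a $ j * veronese (\<xi> $ i) $ j) = 0" if "i \<in> J" for i
      using that k ver[of i] by (cases "i = k") auto
  qed (rule tan)
  then have "(\<Sum>j\<in>UNIV. a $ j * axis i 1 $ j) = 0" for i .
  then have "a $ i = 0" for i
    by (simp add: axis_def if_distrib cong: if_cong)
  then show False using b(1) by (simp add: a_def Finite_Cartesian_Product.vec_eq_iff)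
qed

lemma secant_family_open:
  fixes \<xi> :: "complex ^ 'N"
  assumes J: "card J = t + 1" "k \<in> J" and inj: "inj_on (\<lambda>i. \<xi> $ i) J"
    and l: "\<And>i. i \<in> J - {k} \<Longrightarrow> l $ i \<noteq> 0" and \<epsilon>: "\<epsilon> > 0"
  defines "v \<equiv> \<Sum>i\<in>J. veronese (\<xi> $ i)"
  shows "secant_family (J - {k}) v (l, \<xi>, s) \<in> interior (secant_family (J - {k}) v ` ball (l, \<xi>, s) \<epsilon>)"
proof -
  let ?f = "secant_family (J - {k}) v" and ?D = "secant_family_deriv (J - {k}) v l \<xi>"
  have der: "(?f has_derivative ?D) (at (l, \<xi>, s))" by (rule secant_family_has_derivative)
  have lin: "linear ?D" using der by (rule has_derivative_linear)
  have "surj ?D" unfolding v_def by (rule secant_family_deriv_surj[OF J inj l])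
  then obtain g where g: "linear g" "?D \<circ> g = id"
    using linear_surjective_right_inverse[OF lin] by blast
  have "continuous (at p) ?f" for p
    using secant_family_has_derivative[of "J - {k}" v "fst p" "fst (snd p)" "snd (snd p)"]
    by (auto intro: has_derivative_continuous)
  then have "continuous_on UNIV ?f" by (simp add: continuous_on_eq_continuous_at)
  then show ?thesis
    using g \<epsilon> by (intro sussmann_open_mapping[OF open_UNIV _ _ der])
      (auto simp: linear_conv_bounded_linear interior_open)
qed

definition meets_secants :: "complex ^ 'N \<Rightarrow> complex ^ 'N \<Rightarrow> bool" where
  "meets_secants v y \<longleftrightarrow> (\<exists>S. finite S \<and> card S = t + 1 \<and>
     (\<forall>s\<in>S. \<exists>Z. finite Z \<and> card Z = t \<and> y + s *s v \<in> vec.span (veronese ` Z)))"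

text \<open>The line through \<open>\<Sum> \<xi>\<^sub>i c(\<xi>\<^sub>i)\<close> in the direction
  \<open>v = \<Sum> c(\<xi>\<^sub>i)\<close>, both sums over \<open>t + 1\<close> points \<open>c(\<xi>\<^sub>i)\<close> of the curve, meets the
  spans of \<open>t\<close> of these points at the parameters \<open>-\<xi>\<^sub>k\<close>.  These intersections are transversal,
  so they persist on all nearby parallel lines.\<close>

theorem secant_lines:
  "\<exists>v \<Omega>. peval hankel_det v \<noteq> 0 \<and> open \<Omega> \<and> \<Omega> \<noteq> {} \<and> (\<forall>y\<in>\<Omega>. meets_secants v y)"
proof -
  obtain e :: "'N \<Rightarrow> nat" where e: "inj e"
    using finite_imp_inj_to_nat_seg[of "UNIV :: 'N set"] by auto
  obtain J :: "'N set" where J: "card J = t + 1"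
    using obtain_subset_with_card_n[of "t + 1" "UNIV :: 'N set"] card_N by auto
  have fin: "finite J" by simp
  \<comment> \<open>Integral parameters have distance at least \<open>1\<close>, so they stay distinct under changes by less
    than \<open>1 / 2\<close>.\<close>
  define \<xi> :: "complex ^ 'N" where "\<xi> = (\<chi> i. of_nat (e i))"
  have sep: "1 \<le> dist (\<xi> $ i) (\<xi> $ j)" if "i \<noteq> j" for i j
  proof -
    have "e i \<noteq> e j" using e that by (auto dest: injD)
    then have "1 \<le> \<bar>real (e i) - real (e j)\<bar>" by linarith
    also have "\<dots> = cmod (of_real (real (e i) - real (e j)))" by (simp only: norm_of_real)
    finally show ?thesis by (simp add: \<xi>_def dist_norm)
  qed
  have inj: "inj_on (\<lambda>i. \<xi> $ i) J" using sep by (intro inj_onI) (metis dist_self not_one_le_zero)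
  define v where "v = (\<Sum>i\<in>J. veronese (\<xi> $ i))"
  define y0 where "y0 = (\<Sum>i\<in>J. \<xi> $ i *s veronese (\<xi> $ i))"
  define base where "base k = ((\<chi> i. \<xi> $ i - \<xi> $ k), \<xi>, - (\<xi> $ k))" for k
  define \<Omega> where "\<Omega> = (\<Inter>k\<in>J. interior (secant_family (J - {k}) v ` ball (base k) (1 / 2)))"
  have y0: "secant_family (J - {k}) v (base k) = y0" if "k \<in> J" for k
  proof -
    have "secant_family (J - {k}) v (base k) =
        (\<Sum>i\<in>J - {k}. (\<xi> $ i - \<xi> $ k) *s veronese (\<xi> $ i)) + \<xi> $ k *s v"
      by (simp add: secant_family_def base_def)
    also have "(\<Sum>i\<in>J - {k}. (\<xi> $ i - \<xi> $ k) *s veronese (\<xi> $ i)) =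
        (\<Sum>i\<in>J. (\<xi> $ i - \<xi> $ k) *s veronese (\<xi> $ i))"
      by (rule sum.mono_neutral_left) (use fin in auto)
    also have "\<dots> + \<xi> $ k *s v = y0"
      by (simp add: v_def y0_def vec.scale_left_diff_distrib sum_subtractf vec.scale_sum_right)
    finally show ?thesis .
  qed
  show ?thesis
  proof (intro exI[of _ v] exI[of _ \<Omega>] conjI ballI)
    show "open \<Omega>" unfolding \<Omega>_def using fin by (intro open_INT) auto
    have "y0 \<in> interior (secant_family (J - {k}) v ` ball (base k) (1 / 2))" if k: "k \<in> J" for k
    proof -
      have "(\<chi> i. \<xi> $ i - \<xi> $ k) $ i \<noteq> 0" if "i \<in> J - {k}" for i
        using sep[of i k] that by auto
      from secant_family_open[OF J k inj this, of "1 / 2" "- (\<xi> $ k)"] show ?thesis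
        using y0[OF k] by (simp add: base_def v_def)
    qed
    then have "y0 \<in> \<Omega>" by (simp add: \<Omega>_def)
    then show "\<Omega> \<noteq> {}" by blast
    have "v = (\<Sum>z\<in>(\<lambda>i. \<xi> $ i) ` J. 1 *s veronese z) + 0 *s w (2 * t)"
      by (simp add: v_def sum.reindex[OF inj])
    then show "peval hankel_det v \<noteq> 0"
      using hankel_det_nonzero[of "(\<lambda>i. \<xi> $ i) ` J" "\<lambda>_. 1" 0] fin J by (simp add: card_image[OF inj])
  next
    fix y assume y: "y \<in> \<Omega>"
    have "\<exists>h. dist (base k) h < 1 / 2 \<and> y = secant_family (J - {k}) v h" if "k \<in> J" for k
    proof -
      have "y \<in> secant_family (J - {k}) v ` ball (base k) (1 / 2)"
        using y that interior_subset by (fastforce simp: \<Omega>_def)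
      then obtain h where "h \<in> ball (base k) (1 / 2)" "y = secant_family (J - {k}) v h" by blast
      then show ?thesis unfolding mem_ball by blast
    qed
    then obtain h where h: "\<And>k. k \<in> J \<Longrightarrow> dist (base k) (h k) < 1 / 2"
      "\<And>k. k \<in> J \<Longrightarrow> y = secant_family (J - {k}) v (h k)" by metis
    define s where "s k = snd (snd (h k))" for k
    have s: "dist (- (\<xi> $ k)) (s k) < 1 / 2" if "k \<in> J" for k
    proof -
      have "dist (- (\<xi> $ k)) (s k) \<le> dist (snd (base k)) (snd (h k))"
        unfolding s_def base_def using dist_snd_le[of "(\<xi>, - (\<xi> $ k))" "snd (h k)"] by simp
      also have "\<dots> \<le> dist (base k) (h k)" by (rule dist_snd_le)
      finally show ?thesis using h(1)[OF that] by simp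
    qed
    have inj_s: "inj_on s J"
    proof (rule inj_onI, rule ccontr)
      fix i k assume ik: "i \<in> J" "k \<in> J" "s i = s k" "i \<noteq> k"
      have "dist (\<xi> $ i) (\<xi> $ k) = dist (- (\<xi> $ i)) (- (\<xi> $ k))" by (simp add: dist_norm norm_minus_commute)
      also have "\<dots> \<le> dist (- (\<xi> $ i)) (s i) + dist (- (\<xi> $ k)) (s k)"
        using ik(3) by (metis dist_triangle2)
      also have "\<dots> < 1" using s[OF ik(1)] s[OF ik(2)] by simp
      finally show False using sep[OF ik(4)] by simp
    qed
    have "\<exists>Z. finite Z \<and> card Z = t \<and> y + s k *s v \<in> vec.span (veronese ` Z)" if k: "k \<in> J" for k
    proof -
      define x where "x = fst (snd (h k))"
      have x: "dist (\<xi> $ i) (x $ i) < 1 / 2" for i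
      proof -
        have "dist (\<xi> $ i) (x $ i) \<le> dist \<xi> x" by (rule dist_vec_nth_le)
        also have "\<dots> \<le> dist (snd (base k)) (snd (h k))"
          unfolding x_def base_def using dist_fst_le[of "(\<xi>, - (\<xi> $ k))" "snd (h k)"] by simp
        also have "\<dots> \<le> dist (base k) (h k)" by (rule dist_snd_le)
        finally show ?thesis using h(1)[OF k] by simp
      qed
      have inj_x: "inj_on (\<lambda>i. x $ i) (J - {k})"
      proof (rule inj_onI, rule ccontr)
        fix i j assume ij: "x $ i = x $ j" "i \<noteq> j"
        have "dist (\<xi> $ i) (\<xi> $ j) \<le> dist (\<xi> $ i) (x $ i) + dist (\<xi> $ j) (x $ j)"
          using ij(1) by (metis dist_triangle2)
        also have "\<dots> < 1" using x[of i] x[of j] by simp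
        finally show False using sep[OF ij(2)] by simp
      qed
      let ?Z = "(\<lambda>i. x $ i) ` (J - {k})"
      have "y + s k *s v = (\<Sum>i\<in>J - {k}. fst (h k) $ i *s veronese (x $ i))"
        using h(2)[OF k] by (simp add: secant_family_def x_def s_def)
      also have "\<dots> \<in> vec.span (veronese ` ?Z)"
        by (intro vec.span_sum vec.span_scale vec.span_base) auto
      finally show ?thesis
        using J k by (intro exI[of _ ?Z]) (simp add: card_image[OF inj_x])
    qed
    then show "meets_secants v y"
      unfolding meets_secants_def using J by (intro exI[of _ "s ` J"]) (auto simp: card_image[OF inj_s])
  qed
qed

end

section \<open>Forms that are singular along the curve\<close>

context rnc_coordinates
begin

definition curve_set :: "(complex ^ 'N) set" where
  "curve_set = {c *s curve_vec s u | c s u. c \<noteq> 0 \<and> (s, u) \<noteq> (0, 0)}"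

lemma veronese_in_curve_set: "veronese z \<in> curve_set"
  unfolding curve_set_def by (intro CollectI exI[of _ 1] exI[of _ z]) simp

text \<open>The parametrisation \<open>(s, u) = (1 + \<kappa> z, z)\<close> of the curve misses only the point with
  \<open>(s, u) = (\<kappa>, 1)\<close>, so for general \<open>\<kappa>\<close> it reaches finitely many given points.\<close>

abbreviation shifted :: "complex \<Rightarrow> 'N \<Rightarrow> complex poly" where
  "shifted \<kappa> \<equiv> param [:1, \<kappa>:] [:0, 1:]"

lemma curve_vec_eq_shifted:
  assumes "s \<noteq> \<kappa> * u"
  shows "curve_vec s u = (s - \<kappa> * u) ^ (2 * t) *s curve_point (shifted \<kappa>) (u / (s - \<kappa> * u))"
proof -
  let ?c = "s - \<kappa> * u"
  have "?c * (1 + \<kappa> * (u / ?c)) = s" "?c * (u / ?c) = u"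
    using assms by (auto simp: field_simps)
  then show ?thesis
    using curve_vec_scale[of ?c "1 + \<kappa> * (u / ?c)" "u / ?c"]
    by (simp add: curve_point_param mult.commute[of _ \<kappa>])
qed

lemma span_shifted_cofinite:
  assumes S: "finite S"
  shows "vec.span (curve_point (shifted \<kappa>) ` (- S)) = UNIV"
proof -
  let ?V = "vec.span (curve_point (shifted \<kappa>) ` (- S))"
  let ?S = "insert (1 / \<kappa>) ((\<lambda>z. z / (1 + \<kappa> * z)) ` S)"
  have "veronese ` (- ?S) \<subseteq> ?V"
  proof
    fix y assume "y \<in> veronese ` (- ?S)"
    then obtain z where z: "y = veronese z" "z \<noteq> 1 / \<kappa>" "z \<notin> (\<lambda>z. z / (1 + \<kappa> * z)) ` S" by auto
    have c: "1 - \<kappa> * z \<noteq> 0" using z(2) by (cases "\<kappa> = 0") (auto simp: field_simps)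
    have "1 + \<kappa> * (z / (1 - \<kappa> * z)) = 1 / (1 - \<kappa> * z)"
      using c by (simp add: field_simps)
    then have eq: "z / (1 - \<kappa> * z) / (1 + \<kappa> * (z / (1 - \<kappa> * z))) = z"
      using c by simp
    have S': "z / (1 - \<kappa> * z) \<in> - S"
    proof (rule ComplI)
      assume "z / (1 - \<kappa> * z) \<in> S"
      then have "z / (1 - \<kappa> * z) / (1 + \<kappa> * (z / (1 - \<kappa> * z))) \<in> (\<lambda>z. z / (1 + \<kappa> * z)) ` S"
        by (rule imageI)
      then show False using z(3) unfolding eq by contradiction
    qed
    have "1 \<noteq> \<kappa> * z" using c by simp
    from curve_vec_eq_shifted[OF this] S' show "y \<in> ?V"
      unfolding z(1) by (simp only:) (intro vec.span_scale vec.span_base imageI)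
  qed
  then have "vec.span (veronese ` (- ?S)) \<subseteq> ?V"
    by (rule vec.span_minimal) (rule vec.subspace_span)
  moreover have "vec.span (veronese ` (- ?S)) = UNIV"
    using S by (intro span_veronese_cofinite) simp
  ultimately show ?thesis by auto
qed

text \<open>The missing point is a limit of other points, and vanishing is a polynomial condition.\<close>

lemma mult_at_least_curve_set_if_shifted:
  assumes F: "homogeneous d F" and k: "\<And>z. mult_at_least k F (curve_point (shifted \<kappa>) z)"
    and x: "x \<in> curve_set"
  shows "mult_at_least k F x"
proof -
  have off: "mult_at_least k F (curve_vec s u)" if "s \<noteq> \<kappa> * u" for s u
    unfolding curve_vec_eq_shifted[OF that]
    using that by (intro mult_at_least_scale[OF F k]) auto
  have inf: "mult_at_least k F (curve_vec \<kappa> 1)"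
    unfolding mult_at_least_def
  proof (intro allI impI)
    fix "is" :: "'N list" assume l: "length is < k"
    let ?P = "along_curve (param [:\<kappa>, 1:] 1) (foldr partial_deriv is F)"
    have "poly ?P z = 0" if "z \<noteq> 0" for z
      using off[of "\<kappa> + z" 1] l that by (simp add: poly_along_curve curve_point_param mult_at_least_def)
    then have "- {0} \<subseteq> {z. poly ?P z = 0}" by auto
    moreover have "infinite (- {0 :: complex})"
      using infinite_UNIV_char_0 by (metis Compl_eq_Diff_UNIV finite.emptyI finite_Diff2 finite_insert)
    ultimately have "?P = 0" using poly_roots_finite finite_subset by blast
    then have "poly ?P 0 = 0" by simp
    then show "peval (foldr partial_deriv is F) (curve_vec \<kappa> 1) = 0"
      by (simp add: poly_along_curve curve_point_param)
  qed
  have "mult_at_least k F (curve_vec s u)" if su: "(s, u) \<noteq> (0, 0)" for s u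
  proof (cases "s = \<kappa> * u")
    case True
    then have "u \<noteq> 0" using su by auto
    then show ?thesis
      using True curve_vec_scale[of u \<kappa> 1] mult_at_least_scale[OF F inf, of "u ^ (2 * t)"]
      by (simp add: mult.commute)
  qed (rule off)
  moreover obtain c s u where "x = c *s curve_vec s u" "c \<noteq> 0" "(s, u) \<noteq> (0, 0)"
    using x unfolding curve_set_def by blast
  ultimately show ?thesis using mult_at_least_scale[OF F, of k "curve_vec s u" c] by simp
qed

text \<open>Choose the parametrisation so that none of the given points is at infinity.  Their parameters are
  distinct because any two of the points are independent.\<close>

lemma mult_at_least_curve_set:
  fixes p :: "nat \<Rightarrow> complex ^ 'N"
  assumes gp: "general_position p" and p: "\<And>i. i \<in> {1..2 * t + 3} \<Longrightarrow> p i \<in> curve_set"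
    and F: "homogeneous (a * (t + 1)) F"
    and m: "\<And>i. i \<in> {1..2 * t + 3} \<Longrightarrow> mult_at_least (a * t) F (p i)" and x: "x \<in> curve_set"
  shows "mult_at_least (a * t) F x"
proof -
  let ?I = "{1..2 * t + 3}"
  have "\<forall>i\<in>?I. \<exists>h. case h of (b, s, u) \<Rightarrow>
      p i = b *s curve_vec s u \<and> b \<noteq> 0 \<and> (s, u) \<noteq> (0, 0)"
  proof
    fix i assume "i \<in> ?I"
    then obtain b s u where "p i = b *s curve_vec s u" "b \<noteq> 0" "(s, u) \<noteq> (0, 0)"
      using p[of i] unfolding curve_set_def by blast
    then show "\<exists>h. case h of (b, s, u) \<Rightarrow> p i = b *s curve_vec s u \<and> b \<noteq> 0 \<and> (s, u) \<noteq> (0, 0)"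
      by (intro exI[of _ "(b, s, u)"]) simp
  qed
  from bchoice[OF this] obtain f where
    f: "\<forall>i\<in>?I. case f i of (b, s, u) \<Rightarrow> p i = b *s curve_vec s u \<and> b \<noteq> 0 \<and> (s, u) \<noteq> (0, 0)" by blast
  define b where "b i = fst (f i)" for i
  define s where "s i = fst (snd (f i))" for i
  define u where "u i = snd (snd (f i))" for i
  have bsu: "p i = b i *s curve_vec (s i) (u i)" "b i \<noteq> 0" "(s i, u i) \<noteq> (0, 0)" if "i \<in> ?I" for i
    using bspec[OF f that] unfolding b_def s_def u_def by (cases "f i" rule: prod_cases3; simp)+
  \<comment> \<open>For \<open>u i = 0\<close> the quotient is \<open>0\<close>; such a point is finite for every \<open>\<kappa>\<close>.\<close>
  obtain \<kappa> where \<kappa>: "\<kappa> \<notin> (\<lambda>i. s i / u i) ` ?I"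
    using ex_new_if_finite[OF infinite_UNIV_char_0, of "(\<lambda>i. s i / u i) ` ?I"] by auto
  define c where "c i = s i - \<kappa> * u i" for i
  define z where "z i = u i / c i" for i
  define q where "q i = b i * c i ^ (2 * t)" for i
  have c: "s i \<noteq> \<kappa> * u i" if "i \<in> ?I" for i
  proof
    assume s: "s i = \<kappa> * u i"
    then have "u i \<noteq> 0" using bsu(3)[OF that] by auto
    then have "\<kappa> = s i / u i" using s by simp
    then show False using \<kappa> that by blast
  qed
  have q: "q i \<noteq> 0" if "i \<in> ?I" for i
    using c[OF that] bsu(2)[OF that] by (simp add: q_def c_def)
  have pq: "p i = q i *s curve_point (shifted \<kappa>) (z i)" if "i \<in> ?I" for i
    unfolding bsu(1)[OF that] curve_vec_eq_shifted[OF c[OF that]] q_def z_def c_def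
    by (rule vec.scale_scale)
  have inj: "inj_on z ?I"
  proof (rule inj_onI, rule ccontr)
    fix i j assume ij: "i \<in> ?I" "j \<in> ?I" "z i = z j" "i \<noteq> j"
    have "{i, j} \<subseteq> {1..pdim TYPE('N) + 3}" "card {i, j} \<le> pdim TYPE('N) + 1"
      using ij t by (auto simp: card_N)
    then have "inj_on p {i, j}" and ind: "vec.independent (p ` {i, j})"
      using gp by (auto simp only: general_position_def)
    then have ne: "p i \<noteq> p j" using ij(4) by auto
    have "p i = (q i / q j) *s p j"
      using pq[OF ij(1)] pq[OF ij(2)] q[OF ij(2)] ij(3) by simp
    then have "p i \<in> vec.span {p j}" by (auto simp: vec.span_singleton)
    moreover have "p ` {i, j} - {p i} = {p j}" using ne by auto
    ultimately have "vec.dependent (p ` {i, j})" unfolding vec.dependent_def by auto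
    then show False using ind by blast
  qed
  have Z: "mult_at_least (a * t) F (curve_point (shifted \<kappa>) y)" if "y \<in> z ` ?I" for y
  proof -
    from that obtain i where i: "i \<in> ?I" "y = z i" by blast
    have "curve_point (shifted \<kappa>) y = (1 / q i) *s p i" using pq[OF i(1)] q[OF i(1)] i(2) by simp
    then show ?thesis using mult_at_least_scale[OF F m[OF i(1)], of "1 / q i"] q[OF i(1)] by simp
  qed
  have "mult_at_least (a * t) F (curve_point (shifted \<kappa>) y)" for y
  proof (rule mult_at_least_rational_curve[OF F _ _ _ Z])
    show "degree (shifted \<kappa> i) \<le> 2 * t" for i by (rule degree_param) auto
    show "card (z ` ?I) = 2 * t + 3" using card_image[OF inj] by simp
    show "2 * t * (a * (t + 1)) + a * t \<le> (2 * t + 3) * (a * t)" by (simp add: algebra_simps)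
    show "vec.span (curve_point (shifted \<kappa>) ` (- S)) = UNIV" if "finite S" for S
      using that by (rule span_shifted_cofinite)
  qed auto
  then show ?thesis by (rule mult_at_least_curve_set_if_shifted[OF F _ x])
qed

lemma mult_at_least_secant_span:
  assumes F: "homogeneous (a * (t + 1)) F" and m: "\<And>x. x \<in> curve_set \<Longrightarrow> mult_at_least (a * t) F x"
    and T: "finite T" "card T = t" "T \<subseteq> curve_set" and x: "x \<in> vec.span T"
  shows "mult_at_least a F x"
proof (rule mult_at_least_span[OF F _ T(1) _ _ x])
  show "a + (card T - 1) * (a * (t + 1)) \<le> card T * (a * t)"
    using t T(2) by (cases t) (auto simp: algebra_simps)
  show "T \<noteq> {}" using T(2) t by auto
qed (use m T in auto)

lemma mult_hankel_det_curve_set: "x \<in> curve_set \<Longrightarrow> mult_at_least t hankel_det x"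
  using mult_at_least_scale[OF homogeneous_hankel_det mult_hankel_det_curve_vec]
  by (auto simp: curve_set_def)

lemma hankel_det_secant_span:
  assumes "finite T" "card T = t" "T \<subseteq> curve_set" "x \<in> vec.span T"
  shows "peval hankel_det x = 0"
proof -
  have "mult_at_least 1 hankel_det x"
    using assms homogeneous_hankel_det mult_hankel_det_curve_set
    by (intro mult_at_least_secant_span[of 1 hankel_det T]) auto
  then show ?thesis by (simp add: mult_at_least_def)
qed

section \<open>The equation of the secant variety\<close>

definition secant_points :: "(complex ^ 'N) set" where
  "secant_points = \<Union>{proj_span T | T. T \<subseteq> curve_set \<and> finite T \<and> card T = t \<and> vec.independent T}"

lemma card_veronese: "card (veronese ` Z) = card Z"
  by (rule card_image) (rule inj_on_subset[OF inj_veronese subset_UNIV])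

lemma veronese_span_subset_secant_points:
  assumes "finite Z" "card Z = t"
  shows "proj_span (veronese ` Z) \<subseteq> secant_points"
proof -
  have "veronese ` Z \<subseteq> curve_set" using veronese_in_curve_set by auto
  moreover have "finite (veronese ` Z)" "card (veronese ` Z) = t"
    using assms by (simp_all add: card_veronese)
  moreover have "vec.independent (veronese ` Z)" using assms by (intro independent_veronese) auto
  ultimately show ?thesis
    unfolding secant_points_def by (intro Union_upper CollectI exI[of _ "veronese ` Z"] conjI refl)
qed

text \<open>The zero vector, which represents no point, is included because the lines of the next proof may
  pass through it.\<close>

lemma vanishes_on_veronese_span:
  assumes G: "homogeneous d G" "vanishes_on G secant_points" and Z: "finite Z" "card Z = t"
    and x: "x \<in> vec.span (veronese ` Z)"
  shows "peval G x = 0"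
proof (cases "x = 0")
  case False
  then show ?thesis
    using x veronese_span_subset_secant_points[OF Z] G(2) by (auto simp: proj_span_def vanishes_on_def)
next
  case True
  obtain z where z: "z \<in> Z" using Z t by fastforce
  have "coord 0 (veronese z) \<noteq> coord 0 0" by (simp add: coord_curve_vec)
  then have "veronese z \<noteq> 0" by (rule contrapos_nn) simp
  then have "veronese z \<in> secant_points"
    using veronese_span_subset_secant_points[OF Z] vec.span_base[of "veronese z" "veronese ` Z"] z
    by (auto simp: proj_span_def)
  then have "peval G (0 *s veronese z) = 0"
    using G by (simp only: peval_scale[OF G(1)] vanishes_on_def) simp
  then show ?thesis using True by simp
qed

text \<open>On a line that meets the secant variety in \<open>t + 1\<close> points the remainder has degree at most
  \<open>t\<close>, but \<open>t + 1\<close> zeros.\<close>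

theorem hankel_det_dvd:
  assumes G: "homogeneous d G" "vanishes_on G secant_points"
  shows "hankel_det dvd G"
proof -
  obtain v \<Omega> where v: "peval hankel_det v \<noteq> 0" and \<Omega>: "open \<Omega>" "\<Omega> \<noteq> {}"
    and lines: "\<And>y. y \<in> \<Omega> \<Longrightarrow> meets_secants v y"
    using secant_lines by blast
  have "peval hankel_det 0 = 0" using peval_scale[OF homogeneous_hankel_det, of 0 0] by (simp add: power_0_left)
  then have v0: "v \<noteq> 0" using v by auto
  have top: "(dir_deriv v ^^ (t + 1)) hankel_det = Poly_Mapping.single 0 (fact (t + 1) * peval hankel_det v)"
    by (rule homogeneous_top_dir_deriv[OF homogeneous_hankel_det])
  have "(fact (t + 1) * peval hankel_det v :: complex) \<noteq> 0" using v by simp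
  from division_along[OF top this v0 homogeneous_dir_deriv_vanishes[OF G(1)]]
  obtain Q R where QR: "G = hankel_det * Q + R" "(dir_deriv v ^^ (t + 1)) R = 0" by blast
  have "R = 0"
  proof (rule cpoly_eq_0_if_many_zeros_on_lines[OF \<Omega> _ QR(2)])
    fix y assume "y \<in> \<Omega>"
    then have "meets_secants v y" by (rule lines)
    then obtain S where S: "finite S" "card S = t + 1"
      and Z: "\<And>s. s \<in> S \<Longrightarrow> \<exists>Z. finite Z \<and> card Z = t \<and> y + s *s v \<in> vec.span (veronese ` Z)"
      unfolding meets_secants_def by blast
    have "mult_at_least 1 R (y + s *s v)" if "s \<in> S" for s
    proof -
      obtain Z where Z: "finite Z" "card Z = t" "y + s *s v \<in> vec.span (veronese ` Z)"
        using Z[OF \<open>s \<in> S\<close>] by blast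
      have "card (veronese ` Z) = t" using Z by (simp add: card_veronese)
      then have "peval hankel_det (y + s *s v) = 0"
        using Z veronese_in_curve_set by (intro hankel_det_secant_span[of "veronese ` Z"]) auto
      moreover have "peval G (y + s *s v) = 0" by (rule vanishes_on_veronese_span[OF G Z])
      ultimately have "peval R (y + s *s v) = 0" by (simp add: QR(1) peval_add peval_mult)
      then show ?thesis by (simp add: mult_at_least_def)
    qed
    then show "\<exists>S. finite S \<and> card S = t + 1 \<and> (\<forall>s\<in>S. mult_at_least 1 R (y + s *s v))"
      using S by blast
  qed simp
  then have "G = hankel_det * Q" using QR(1) by simp
  then show ?thesis by (rule dvdI)
qed

lemma vanishes_on_secant_points: "vanishes_on hankel_det secant_points"
  unfolding vanishes_on_def
proof
  fix x assume "x \<in> secant_points"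
  then obtain T where "T \<subseteq> curve_set" "finite T" "card T = t" "x \<in> vec.span T"
    unfolding secant_points_def proj_span_def by blast
  then show "peval hankel_det x = 0" by (intro hankel_det_secant_span)
qed

lemma hankel_det_power_neq_0: "hankel_det ^ a \<noteq> 0"
proof -
  obtain v where "peval hankel_det v \<noteq> 0" using secant_lines by blast
  then have "peval (hankel_det ^ a) v \<noteq> 0" unfolding peval_power by simp
  then show ?thesis by auto
qed

lemma hankel_det_neq_0: "hankel_det \<noteq> 0"
  using hankel_det_power_neq_0[of 1] by simp

lemma reduced_equation_hankel_det: "reduced_equation hankel_det (secant t curve_set)"
proof -
  have sec: "secant t curve_set = zariski_closure secant_points"
    using t by (simp add: secant_def secant_points_def)
  have sub: "secant_points \<subseteq> zariski_closure secant_points"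
    by (auto simp: zariski_closure_def vanishes_on_def secant_points_def proj_span_def)
  have zero: "zariski_closure secant_points = {x. x \<noteq> 0 \<and> peval hankel_det x = 0}"
  proof (intro equalityI subsetI)
    fix x assume "x \<in> zariski_closure secant_points"
    then show "x \<in> {x. x \<noteq> 0 \<and> peval hankel_det x = 0}"
      using homogeneous_hankel_det vanishes_on_secant_points by (auto simp: zariski_closure_def)
  next
    fix x assume x: "x \<in> {x. x \<noteq> 0 \<and> peval hankel_det x = 0}"
    have "peval G x = 0" if G: "homogeneous d G" "vanishes_on G secant_points" for d G
    proof -
      obtain Q where "G = hankel_det * Q" using hankel_det_dvd[OF G] by (rule dvdE)
      then show ?thesis using x by (simp add: peval_mult)
    qed
    then show "x \<in> zariski_closure secant_points" using x by (auto simp: zariski_closure_def)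
  qed
  have "vanishes_on G (zariski_closure secant_points) \<longleftrightarrow> hankel_det dvd G" if "homogeneous d G" for d G
  proof
    assume "vanishes_on G (zariski_closure secant_points)"
    then have "vanishes_on G secant_points" using sub by (auto simp: vanishes_on_def)
    then show "hankel_det dvd G" by (rule hankel_det_dvd[OF that])
  next
    assume "hankel_det dvd G"
    then show "vanishes_on G (zariski_closure secant_points)"
      by (auto simp: vanishes_on_def zero peval_mult elim!: dvdE)
  qed
  moreover have "\<exists>e\<ge>1. homogeneous e hankel_det"
    using homogeneous_hankel_det by (intro exI[of _ "t + 1"]) simp
  ultimately show ?thesis
    unfolding reduced_equation_def sec using hankel_det_neq_0 zero by blast
qed

section \<open>The linear system\<close>

lemma homogeneous_hankel_det_power: "homogeneous (a * (t + 1)) (hankel_det ^ a)"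
  by (rule homogeneous_power[OF homogeneous_hankel_det])

lemma mult_hankel_det_power: "x \<in> curve_set \<Longrightarrow> mult_at_least (a * t) (hankel_det ^ a) x"
  by (rule mult_at_least_power[OF mult_hankel_det_curve_set])

text \<open>After subtracting the right multiple of the power, the difference has degree less than
  \<open>a (t + 1)\<close> on each line in the direction \<open>v\<close>, but \<open>t + 1\<close> zeros of order \<open>a\<close> on many of
  them.\<close>

lemma eq_hankel_det_power:
  assumes F: "homogeneous (a * (t + 1)) F" and m: "\<And>x. x \<in> curve_set \<Longrightarrow> mult_at_least (a * t) F x"
  shows "\<exists>c. F = pscale c (hankel_det ^ a)"
proof -
  obtain v \<Omega> where v: "peval hankel_det v \<noteq> 0" and \<Omega>: "open \<Omega>" "\<Omega> \<noteq> {}"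
    and lines: "\<And>y. y \<in> \<Omega> \<Longrightarrow> meets_secants v y"
    using secant_lines by blast
  define c where "c = peval F v / peval hankel_det v ^ a"
  define E where "E = F - pscale c (hankel_det ^ a)"
  have E: "homogeneous (a * (t + 1)) E"
    unfolding E_def by (intro homogeneous_diff F homogeneous_pscale homogeneous_hankel_det_power)
  have "peval E v = 0" using v by (simp add: E_def c_def peval_diff peval_pscale peval_power)
  then have top: "(dir_deriv v ^^ (a * (t + 1))) E = 0"
    by (simp only: homogeneous_top_dir_deriv[OF E] mult_zero_right single_zero)
  have mE: "mult_at_least (a * t) E x" if "x \<in> curve_set" for x
    unfolding E_def by (intro mult_at_least_diff mult_at_least_pscale m mult_hankel_det_power that)
  have "E = 0"
  proof (rule cpoly_eq_0_if_many_zeros_on_lines[OF \<Omega> _ top])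
    show "a * (t + 1) \<le> (t + 1) * a" by simp
    fix y assume "y \<in> \<Omega>"
    then have "meets_secants v y" by (rule lines)
    then obtain S where S: "finite S" "card S = t + 1"
      and Z: "\<And>s. s \<in> S \<Longrightarrow> \<exists>Z. finite Z \<and> card Z = t \<and> y + s *s v \<in> vec.span (veronese ` Z)"
      unfolding meets_secants_def by blast
    have "mult_at_least a E (y + s *s v)" if "s \<in> S" for s
    proof -
      obtain Z where Z: "finite Z" "card Z = t" "y + s *s v \<in> vec.span (veronese ` Z)"
        using Z[OF \<open>s \<in> S\<close>] by blast
      have "card (veronese ` Z) = t" using Z by (simp add: card_veronese)
      then show ?thesis
        using Z veronese_in_curve_set by (intro mult_at_least_secant_span[OF E mE, of "veronese ` Z"]) auto
    qed
    then show "\<exists>S. finite S \<and> card S = t + 1 \<and> (\<forall>s\<in>S. mult_at_least a E (y + s *s v))"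
      using S by blast
  qed
  then show ?thesis by (auto simp: E_def)
qed

text \<open>Otherwise the form would vanish on the span of the point with \<open>t\<close> general points of the
  curve, hence at a sum of \<open>t + 1\<close> points of the curve.\<close>

lemma mult_hankel_det_power_le:
  assumes x: "x \<in> curve_set" and a: "a \<ge> 1" and m: "mult_at_least m (hankel_det ^ a) x"
  shows "m \<le> a * t"
proof (rule ccontr)
  assume "\<not> m \<le> a * t"
  then have m': "mult_at_least (a * t + 1) (hankel_det ^ a) x" using m mult_at_least_mono by fastforce
  obtain b s u where x: "x = b *s curve_vec s u" "b \<noteq> 0" "(s, u) \<noteq> (0, 0)"
    using x by (auto simp: curve_set_def)
  have "infinite (- {u / s})"
    using infinite_UNIV_char_0[where 'a = complex] by (metis Compl_eq_Diff_UNIV finite.emptyI finite_Diff2 finite_insert)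
  then obtain Z where Z: "finite Z" "card Z = t" "Z \<subseteq> - {u / s}"
    using infinite_arbitrarily_large by blast
  define V where "V = (\<Sum>z\<in>Z. veronese z)"
  have "card (veronese ` Z) = t" using Z by (simp add: card_veronese)
  moreover have "V \<in> vec.span (veronese ` Z)"
    unfolding V_def by (intro vec.span_sum vec.span_base) auto
  ultimately have "mult_at_least a (hankel_det ^ a) V"
    using Z veronese_in_curve_set
    by (intro mult_at_least_secant_span[OF homogeneous_hankel_det_power mult_hankel_det_power, of "veronese ` Z"]) auto
  then have "mult_at_least 1 (hankel_det ^ a) (1 *s x + 1 *s V)"
    using a by (intro mult_at_least_join[OF homogeneous_hankel_det_power m' _]) (auto simp: algebra_simps)
  then have "peval (hankel_det ^ a) (x + V) = 0" by (simp add: mult_at_least_def)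
  then have 0: "peval hankel_det (x + V) = 0" by (simp add: peval_power)
  show False
  proof (cases "s = 0")
    case True
    then have "x + V = (\<Sum>z\<in>Z. 1 *s veronese z) + (b * u ^ (2 * t)) *s w (2 * t)"
      using x(1) by (simp add: V_def curve_vec_at_infinity add.commute)
    then show False using hankel_det_nonzero[of Z "\<lambda>_. 1" "b * u ^ (2 * t)"] Z x True 0 by simp
  next
    case False
    let ?c = "\<lambda>z. if z = u / s then b * s ^ (2 * t) else 1"
    have "(\<Sum>z\<in>insert (u / s) Z. ?c z *s veronese z) = x + (\<Sum>z\<in>Z. ?c z *s veronese z)"
      using Z x(1) curve_vec_eq_veronese[OF False, of u] by (subst sum.insert) auto
    also have "(\<Sum>z\<in>Z. ?c z *s veronese z) = V"
      unfolding V_def by (intro sum.cong refl) (use Z in auto)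
    finally have "x + V = (\<Sum>z\<in>insert (u / s) Z. ?c z *s veronese z) + 0 *s w (2 * t)" by simp
    moreover have "card (insert (u / s) Z) = t + 1" using Z by (subst card_insert_disjoint) auto
    ultimately show False
      using hankel_det_nonzero[of "insert (u / s) Z" ?c 0] Z(1) x(2) False 0 by auto
  qed
qed

end

lemma hypersurface_pscale:
  assumes "c \<noteq> 0"
  shows "hypersurface (pscale c f) = hypersurface f"
proof (intro equalityI subsetI)
  fix g assume "g \<in> hypersurface (pscale c f)"
  then obtain b where "b \<noteq> 0" "g = pscale b (pscale c f)" by (auto simp: hypersurface_def)
  then have "g = pscale (b * c) f" "b * c \<noteq> 0" using assms by auto
  then show "g \<in> hypersurface f" unfolding hypersurface_def by blast
next
  fix g assume "g \<in> hypersurface f"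
  then obtain b where "b \<noteq> 0" "g = pscale b f" by (auto simp: hypersurface_def)
  then have "g = pscale (b / c) (pscale c f)" "b / c \<noteq> 0" using assms by auto
  then show "g \<in> hypersurface (pscale c f)" unfolding hypersurface_def by blast
qed

theorem proposition6p12:
  fixes t a :: nat and p :: "nat \<Rightarrow> complex ^ 'N::finite" and C :: "(complex ^ 'N) set"
  assumes "t \<ge> 1" and "a \<ge> 1"
    and "CARD('N) = 2 * t + 1"
    and "general_position p"
    and "rational_normal_curve C" and "\<forall>i\<in>{1..2 * t + 3}. p i \<in> C"
  shows "(\<exists>F. reduced_equation F (secant t C) \<and>
            linear_system p (a * (t + 1)) (\<lambda>_. a * t) = {hypersurface (F ^ a)}) \<and>
         (special p (a * (t + 1)) (\<lambda>_. a * t) \<longrightarrow>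
            (\<exists>I \<subseteq> {1..2 * t + 3}. 2 \<le> card I \<and> card I \<le> 2 * t \<and>
               proj_span (p ` I) \<subseteq> base_locus p (a * (t + 1)) (\<lambda>_. a * t)) \<or>
            (\<exists>I \<subseteq> {1..2 * t + 3}. \<exists>\<tau>\<ge>1. card I + 2 * \<tau> \<le> 2 * t \<and>
               proj_join (proj_span (p ` I)) (secant \<tau> C)
                 \<subseteq> base_locus p (a * (t + 1)) (\<lambda>_. a * t))) \<and>
         dim_system p (a * (t + 1)) (\<lambda>_. a * t) = sigma_ldim p (a * (t + 1)) (\<lambda>_. a * t)"
proof -
  let ?d = "a * (t + 1)" and ?m = "\<lambda>_::nat. a * t"
  have pdim: "pdim TYPE('N) = 2 * t" using assms(3) by simp
  obtain w where w: "inj_on w {0..2 * t}" "vec.independent (w ` {0..2 * t})"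
    and C: "C = {c *s (\<Sum>j = 0..2 * t. (s ^ (2 * t - j) * u ^ j) *s w j) | c s u. c \<noteq> 0 \<and> (s, u) \<noteq> (0, 0)}"
    using assms(5) unfolding rational_normal_curve_def Let_def pdim by blast
  interpret rnc_coordinates w t
    by unfold_locales (use assms w in auto)
  have C: "C = curve_set" unfolding C curve_set_def curve_vec_def ..
  define F where "F = hankel_det ^ a"
  have F0: "F \<noteq> 0" by (simp add: F_def hankel_det_power_neq_0)
  have p: "p i \<in> curve_set" if "i \<in> {1..2 * t + 3}" for i using assms(6) that C by blast
  have forms: "forms p ?d ?m = range (\<lambda>c. pscale c F)"
  proof (intro equalityI subsetI)
    fix f assume "f \<in> forms p ?d ?m"
    then have f: "homogeneous ?d f" "\<And>i. i \<in> {1..2 * t + 3} \<Longrightarrow> mult_at_least (a * t) f (p i)"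
      unfolding forms_def pdim by blast+
    have "mult_at_least (a * t) f x" if "x \<in> curve_set" for x
      by (rule mult_at_least_curve_set[OF assms(4) p f that])
    then obtain c where "f = pscale c F"
      using eq_hankel_det_power[OF f(1)] unfolding F_def by blast
    then show "f \<in> range (\<lambda>c. pscale c F)" by blast
  next
    fix f assume "f \<in> range (\<lambda>c. pscale c F)"
    then obtain c where f: "f = pscale c F" by blast
    have "homogeneous ?d f"
      unfolding f F_def by (intro homogeneous_pscale homogeneous_hankel_det_power)
    moreover have "mult_at_least (a * t) f (p i)" if "i \<in> {1..2 * t + 3}" for i
      unfolding f F_def by (intro mult_at_least_pscale mult_hankel_det_power p that)
    ultimately show "f \<in> forms p ?d ?m" unfolding forms_def pdim by blast
  qed
  have system: "linear_system p ?d ?m = {hypersurface F}"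
  proof -
    have "hypersurface f = hypersurface F" if "f \<in> forms p ?d ?m - {0}" for f
    proof -
      from that obtain c where c: "f = pscale c F" unfolding forms by blast
      then have "c \<noteq> 0" using that by auto
      then show ?thesis unfolding c by (rule hypersurface_pscale)
    qed
    moreover have "F \<in> forms p ?d ?m - {0}"
      using F0 rangeI[of "\<lambda>c. pscale c F" 1] unfolding forms by simp
    ultimately show ?thesis unfolding linear_system_def by blast
  qed
  \<comment> \<open>The base locus contains \<open>\<sigma>\<^sub>t\<close>, which is the cone over itself with empty vertex.\<close>
  have cone: "proj_join (proj_span (p ` {})) (secant t C) \<subseteq> base_locus p ?d ?m"
  proof -
    have "proj_span (p ` {}) = {}" by (simp add: proj_span_def)
    then have "proj_join (proj_span (p ` {})) (secant t C) = secant t C" by (simp add: proj_join_def)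
    also have "\<dots> \<subseteq> base_locus p ?d ?m"
    proof
      fix x assume "x \<in> secant t C"
      then have "x \<noteq> 0" "peval hankel_det x = 0"
        using reduced_equation_hankel_det unfolding C reduced_equation_def by auto
      moreover from this have "peval F x = 0" using assms(2) by (simp add: F_def peval_power)
      ultimately show "x \<in> base_locus p ?d ?m" by (auto simp: base_locus_def forms peval_pscale)
    qed
    finally show ?thesis .
  qed
  have dim: "dim_system p ?d ?m = 1"
  proof -
    have "forms p ?d ?m = cpoly.span {F}" by (simp add: forms cpoly.span_singleton)
    then have "cpoly.dim (forms p ?d ?m) = cpoly.dim {F}" by (simp add: cpoly.dim_span)
    also have "\<dots> = card {F}" using F0 by (intro cpoly.dim_eq_card_independent) (simp add: cpoly.independent_insert)
    finally show ?thesis by (simp add: dim_system_def)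
  qed
  \<comment> \<open>Hence the first case in the definition of the secant linear dimension does not occur.\<close>
  have "slvdim (2 * t) ?d m' \<ge> 0" if sub: "linear_system p ?d ?m \<subseteq> linear_system p ?d m'" for m'
  proof (rule slvdim_nonneg[OF refl refl assms(2)])
    fix i assume i: "i \<in> {1..2 * t + 3}"
    obtain g where g: "g \<in> forms p ?d m'" "hypersurface F = hypersurface g"
      using sub system by (auto simp: linear_system_def)
    have "F \<in> hypersurface F" unfolding hypersurface_def by (intro CollectI exI[of _ 1]) simp
    then have "F \<in> hypersurface g" by (simp only: g(2))
    then obtain c where "F = pscale c g" by (auto simp: hypersurface_def)
    moreover have "mult_at_least (m' i) g (p i)" using g(1) i by (auto simp: forms_def pdim)
    ultimately have "mult_at_least (m' i) F (p i)" by (simp add: mult_at_least_pscale)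
    then show "m' i \<le> a * t" unfolding F_def by (rule mult_hankel_det_power_le[OF p[OF i] assms(2)])
  qed
  then have "sigma_ldim p ?d ?m = 1"
    using slvdim_secant[OF assms(2), of t] unfolding sigma_ldim_def pdim by (auto simp: not_less)
  then have "dim_system p ?d ?m = sigma_ldim p ?d ?m" using dim by simp
  moreover have "\<exists>F. reduced_equation F (secant t C) \<and> linear_system p ?d ?m = {hypersurface (F ^ a)}"
    using reduced_equation_hankel_det system by (auto simp: C F_def)
  moreover have "\<exists>I \<subseteq> {1..2 * t + 3}. \<exists>\<tau>\<ge>1. card I + 2 * \<tau> \<le> 2 * t \<and>
      proj_join (proj_span (p ` I)) (secant \<tau> C) \<subseteq> base_locus p ?d ?m"
    using cone assms(1) by (intro exI[of _ "{}"] conjI exI[of _ t]) auto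
  ultimately show ?thesis by blast
qed

end
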